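(* Let $\Omega\subseteq\mathbb{C}^n$ be a bounded pseudoconvex domain with $C^\infty$ boundary $b\Omega$, and let $q\in\{1,\dots,n\}$. Let $\mathcal{N}$ be the Levi null distribution on $b\Omega$, and let $S_{\mathfrak{C}_q(\mathcal{N})}\subseteq b\Omega$ be the support of the Levi $q$-core $\mathfrak{C}_q(\mathcal{N})$ of $b\Omega$. Then $S_{\mathfrak{C}_q(\mathcal{N})}$ satisfies Property $(P_q)$ if and only if $b\Omega$ satisfies Property $(P_q)$.
   Context: **Property $(P_q)$.** A compact set $X\subseteq\mathbb{C}^n$ satisfies Property $(P_q)$ if for every $M>0$ there exist a neighborhood $U$ of $X$ and a $C^2$ function $\phi:U\to[0,1]$ such that for every $z\in U$ the sum of the $q$ smallest eigenvalues of the Hermitian matrix $\left(\frac{\partial^2\phi(z)}{\partial z_j\partial\bar z_k}\right)_{j,k}$ is at least $M$. (The empty set satisfies it vacuously.) **Levi null distribution.** Let $M=b\Omega$ and let $r$ be a smooth defining function of $\Omega$. For $p\in M$, $T^{1,0}_pM=\{a=\sum_j a_j\partial_{z_j}:\ \sum_j \frac{\partial r}{\partial z_j}(p)a_j=0\}\subseteq \mathbb{C}T_pM$ ($\mathbb{C}TM$ is the complexified tangent bundle), and $\mathcal{N}_p$ is the null space of the Levi form: $\mathcal{N}_p=\{a\in T^{1,0}_pM:\ \sum_{j,k}\frac{\partial^2 r}{\partial z_j\partial\bar z_k}(p)a_j\bar b_k=0\ \text{ for all } b\in T^{1,0}_pM\}$. The set $\mathcal{N}=\bigcup_p\mathcal{N}_p\subseteq\mathbb{C}TM$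 is a closed set whose fibers are complex vector subspaces. **Tangent distribution of a subset.** For a closed set $S\subseteq M$ and $p\in M$, $T_pS=\{v\in T_pM:\ df_p(v)=0 \text{ for every smooth } f:M\to\mathbb{R} \text{ vanishing on } S\}$; this is $\{0\}$ if $p\notin S$. Its complexification is $\mathbb{C}T_pS=T_pS\otimes\mathbb{C}\subseteq\mathbb{C}T_pM$. **Grassmannian $q$-core.** Let $\mathrm{Gr}_q(\mathbb{C}TM)\to M$ be the bundle whose fiber at $p$ is the Grassmannian of complex $q$-dimensional subspaces of $\mathbb{C}T_pM$. For a subset $\mathcal{F}\subseteq\mathrm{Gr}_q(\mathbb{C}TM)$ with fibers $\mathcal{F}_p$, its support is $S_{\mathcal{F}}=\{p\in M:\mathcal{F}_p\neq\emptyset\}$. For a set $\mathcal{D}\subseteq\mathbb{C}TM$ with complex linear fibers, $\mathrm{Gr}_q(\mathcal{D})\subseteq\mathrm{Gr}_q(\mathbb{C}TM)$ is the set whose fiber at $p$ is the set of complex $q$-dimensional subspaces of $\mathcal{D}_p$ (empty if $\dim_{\mathbb{C}}\mathcal{D}_p<q$); it is closed if $\mathcal{D}$ is closed. If $\mathcal{F}$ is closed, its Grassmannian derived set is $\mathcal{F}'=\mathcal{F}\cap\mathrm{Gr}_q(\mathbb{C}TS_{\mathcal{F}})$, which is again closed. Define by transfinite recursion $\mathcal{F}^0=\mathcal{F}$, $\mathcal{F}^{\beta+1}=(\mathcal{F}^\beta)'$, and $\mathcal{F}^\alpha=\bigcap_{\beta<\alpha}\mathcal{F}^\beta$ for limit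 ordinals $\alpha$. This decreasing family of closed sets stabilizes at some countable ordinal $\gamma$ ($\mathcal{F}^{\gamma'}=\mathcal{F}^\gamma$ for all $\gamma'\ge\gamma$); set $\mathfrak{C}(\mathcal{F})=\mathcal{F}^\gamma$. The Grassmannian $q$-core of a closed distribution $\mathcal{D}$ is $\mathfrak{C}_q(\mathcal{D})=\mathfrak{C}(\mathrm{Gr}_q(\mathcal{D}))$. The Levi $q$-core of $M=b\Omega$ is $\mathfrak{C}_q(\mathcal{N})$. *)

theory Defs
  imports "HOL-Analysis.Analysis" "HOL-Computational_Algebra.Computational_Algebra"
begin

section \<open>Differentiability classes and Wirtinger derivatives\<close>

(* C^k on an open set U (the library has no such notion). *)
primrec Ck_on :: "nat \<Rightarrow> ('a::euclidean_space \<Rightarrow> real) \<Rightarrow> 'a set \<Rightarrow> bool" where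
  "Ck_on 0 f U \<longleftrightarrow> continuous_on U f"
| "Ck_on (Suc k) f U \<longleftrightarrow>
     (\<forall>x\<in>U. f differentiable (at x)) \<and>
     (\<forall>v. Ck_on k (\<lambda>x. frechet_derivative f (at x) v) U)"

definition smooth_on :: "('a::euclidean_space \<Rightarrow> real) \<Rightarrow> 'a set \<Rightarrow> bool" where
  "smooth_on f U \<longleftrightarrow> (\<forall>k. Ck_on k f U)"

(* With z_j = x_j + i y_j, the direction of x_j is axis j 1 and that of y_j is axis j \<i>. *)
definition d_dz :: "'n::finite \<Rightarrow> (complex^'n \<Rightarrow> complex) \<Rightarrow> complex^'n \<Rightarrow> complex" where
  "d_dz j f z = (frechet_derivative f (at z) (axis j 1)
                 - \<i> * frechet_derivative f (at z) (axis j \<i>)) / 2"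

definition d_dzbar :: "'n::finite \<Rightarrow> (complex^'n \<Rightarrow> complex) \<Rightarrow> complex^'n \<Rightarrow> complex" where
  "d_dzbar j f z = (frechet_derivative f (at z) (axis j 1)
                    + \<i> * frechet_derivative f (at z) (axis j \<i>)) / 2"

definition complex_gradient :: "(complex^'n \<Rightarrow> real) \<Rightarrow> complex^'n \<Rightarrow> complex^'n" where
  "complex_gradient f z = (\<chi> j. d_dz j (\<lambda>w. complex_of_real (f w)) z)"

definition complex_hessian :: "(complex^'n \<Rightarrow> real) \<Rightarrow> complex^'n \<Rightarrow> complex^'n^'n" where
  "complex_hessian f z = (\<chi> j k. d_dz j (d_dzbar k (\<lambda>w. complex_of_real (f w))) z)"


section \<open>Property (P_q)\<close>

definition charpoly :: "complex^'n^'n \<Rightarrow> complex poly" where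
  "charpoly H = det (\<chi> j k. (if j = k then [:0, 1:] else 0) - [:H $ j $ k:])"

(* The eigenvalues in increasing order, repeated according to multiplicity. Meant for
   Hermitian H only, whose eigenvalues are real. *)
definition hermitian_eigenvalues :: "complex^'n^'n \<Rightarrow> real list" where
  "hermitian_eigenvalues H = sorted_list_of_multiset (image_mset Re (proots (charpoly H)))"

definition property_P :: "nat \<Rightarrow> (complex^'n) set \<Rightarrow> bool" where
  "property_P q X \<longleftrightarrow> compact X \<and>
     (\<forall>M>0. \<exists>U \<phi>. open U \<and> X \<subseteq> U \<and> Ck_on 2 \<phi> U \<and> \<phi> ` U \<subseteq> {0..1} \<and>
        (\<forall>z\<in>U. sum_list (take q (hermitian_eigenvalues (complex_hessian \<phi> z))) \<ge> M))"


section \<open>Smoothly bounded pseudoconvex domains\<close>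

definition smooth_defining_function ::
    "(complex^'n \<Rightarrow> real) \<Rightarrow> (complex^'n) set \<Rightarrow> bool" where
  "smooth_defining_function r \<Omega> \<longleftrightarrow>
     (\<exists>U. open U \<and> frontier \<Omega> \<subseteq> U \<and> smooth_on r U \<and>
          \<Omega> \<inter> U = {z\<in>U. r z < 0} \<and> frontier \<Omega> = {z\<in>U. r z = 0} \<and>
          (\<forall>p\<in>frontier \<Omega>. \<exists>v. frechet_derivative r (at p) v \<noteq> 0))"

(* T^{1,0}_p as vectors of coefficients a with respect to d/dz_1, ..., d/dz_n. *)
definition T10 :: "(complex^'n \<Rightarrow> real) \<Rightarrow> complex^'n \<Rightarrow> (complex^'n) set" where
  "T10 r p = {a. (\<Sum>j\<in>UNIV. complex_gradient r p $ j * a $ j) = 0}"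

definition levi_form ::
    "(complex^'n \<Rightarrow> real) \<Rightarrow> complex^'n \<Rightarrow> complex^'n \<Rightarrow> complex^'n \<Rightarrow> complex" where
  "levi_form r p a b = (\<Sum>j\<in>UNIV. \<Sum>k\<in>UNIV. complex_hessian r p $ j $ k * a $ j * cnj (b $ k))"

(* Pseudoconvexity of a smoothly bounded domain with defining function r: the Levi form is
   positive semidefinite at every boundary point. It is real on the diagonal. *)
definition levi_pseudoconvex ::
    "(complex^'n \<Rightarrow> real) \<Rightarrow> (complex^'n) set \<Rightarrow> bool" where
  "levi_pseudoconvex r \<Omega> \<longleftrightarrow> (\<forall>p\<in>frontier \<Omega>. \<forall>a\<in>T10 r p. Re (levi_form r p a a) \<ge> 0)"


section \<open>Distributions in the complexified tangent bundle\<close>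

(* The complexified tangent space of C^n at any point is complex^('n + 'n): the component
   Inl j is the coefficient of d/dz_j and Inr j that of d/dzbar_j. A subset of CTM is
   a set of pairs (base point, vector). *)

type_synonym 'n ctangent = "complex^('n + 'n)"

(* Real tangent vector v = sum_j (Re v_j d/dx_j + Im v_j d/dy_j)
                         = sum_j (v_j d/dz_j + conj(v_j) d/dzbar_j). *)
definition of_real_tangent :: "complex^'n \<Rightarrow> 'n ctangent" where
  "of_real_tangent v = (\<chi> s. case s of Inl j \<Rightarrow> v $ j | Inr j \<Rightarrow> cnj (v $ j))"

definition of_type10 :: "complex^'n \<Rightarrow> 'n ctangent" where
  "of_type10 a = (\<chi> s. case s of Inl j \<Rightarrow> a $ j | Inr j \<Rightarrow> 0)"

definition levi_null ::
    "(complex^'n \<Rightarrow> real) \<Rightarrow> (complex^'n) set \<Rightarrow> ((complex^'n) \<times> 'n ctangent) set" where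
  "levi_null r M = {(p, of_type10 a) | p a.
     p \<in> M \<and> a \<in> T10 r p \<and> (\<forall>b\<in>T10 r p. levi_form r p a b = 0)}"

definition local_extension ::
    "(complex^'n) set \<Rightarrow> (complex^'n \<Rightarrow> real) \<Rightarrow> complex^'n \<Rightarrow> (complex^'n \<Rightarrow> real) \<Rightarrow> bool" where
  "local_extension M f p g \<longleftrightarrow>
     (\<exists>U. open U \<and> p \<in> U \<and> smooth_on g U \<and> (\<forall>x\<in>U \<inter> M. g x = f x))"

(* f is a smooth function on the embedded hypersurface M; only its values on M matter. *)
definition smooth_on_hypersurface ::
    "(complex^'n) set \<Rightarrow> (complex^'n \<Rightarrow> real) \<Rightarrow> bool" where
  "smooth_on_hypersurface M f \<longleftrightarrow> (\<forall>p\<in>M. \<exists>g. local_extension M f p g)"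

definition real_tangent_space :: "(complex^'n \<Rightarrow> real) \<Rightarrow> complex^'n \<Rightarrow> (complex^'n) set" where
  "real_tangent_space r p = {v. frechet_derivative r (at p) v = 0}"

(* T_p S. For v tangent to M, df_p(v) is the derivative at p along v of any local smooth
   extension g of f. *)
definition subset_tangent_space ::
    "(complex^'n \<Rightarrow> real) \<Rightarrow> (complex^'n) set \<Rightarrow> (complex^'n) set \<Rightarrow> complex^'n \<Rightarrow> (complex^'n) set" where
  "subset_tangent_space r M S p = {v \<in> real_tangent_space r p.
     \<forall>f g. smooth_on_hypersurface M f \<and> (\<forall>x\<in>S. f x = 0) \<and> local_extension M f p g
            \<longrightarrow> frechet_derivative g (at p) v = 0}"

definition complexified_tangent ::
    "(complex^'n \<Rightarrow> real) \<Rightarrow> (complex^'n) set \<Rightarrow> (complex^'n) set \<Rightarrow> ((complex^'n) \<times> 'n ctangent) set" where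
  "complexified_tangent r M S =
     {(p, w). p \<in> M \<and> w \<in> vec.span (of_real_tangent ` subset_tangent_space r M S p)}"


section \<open>Grassmannian q-cores\<close>

type_synonym 'n grassmann = "(complex^'n) \<times> 'n ctangent set"

definition Gr :: "nat \<Rightarrow> ((complex^'n) \<times> 'n ctangent) set \<Rightarrow> 'n grassmann set" where
  "Gr q D = {(p, V). vec.subspace V \<and> vec.dim V = q \<and> V \<subseteq> D `` {p}}"

definition support :: "'n grassmann set \<Rightarrow> (complex^'n) set" where
  "support F = fst ` F"

definition grassmann_derived ::
    "(complex^'n \<Rightarrow> real) \<Rightarrow> (complex^'n) set \<Rightarrow> nat \<Rightarrow> 'n grassmann set \<Rightarrow> 'n grassmann set" where
  "grassmann_derived r M q F = F \<inter> Gr q (complexified_tangent r M (support F))"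

(* The first uncountable ordinal as a well-order; the elements of its field are the
   countable ordinals. *)
definition omega1 :: "nat set rel" where
  "omega1 = cardSuc natLeq"

definition is_pred_ord :: "nat set \<Rightarrow> nat set \<Rightarrow> bool" where
  "is_pred_ord \<beta> \<alpha> \<longleftrightarrow> \<beta> \<in> underS omega1 \<alpha> \<and> (\<forall>\<delta>\<in>underS omega1 \<alpha>. (\<delta>, \<beta>) \<in> omega1)"

(* Transfinite recursion with cases zero, successor, limit; the three equations are
   proved below. *)
definition transfinite_iterate :: "('a set \<Rightarrow> 'a set) \<Rightarrow> 'a set \<Rightarrow> nat set \<Rightarrow> 'a set" where
  "transfinite_iterate D F = wo_rel.worec omega1 (\<lambda>G \<alpha>.
     if underS omega1 \<alpha> = {} then F
     else if \<exists>\<beta>. is_pred_ord \<beta> \<alpha> then D (G (THE \<beta>. is_pred_ord \<beta> \<alpha>))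
     else (\<Inter>\<beta>\<in>underS omega1 \<alpha>. G \<beta>))"

lemma wo_rel_omega1: "wo_rel omega1"
  unfolding omega1_def wo_rel_def
  using cardSuc_Card_order[OF natLeq_Card_order] by (simp add: card_order_on_def)

lemma is_pred_ord_unique: "is_pred_ord \<beta> \<alpha> \<Longrightarrow> is_pred_ord \<beta>' \<alpha> \<Longrightarrow> \<beta> = \<beta>'"
  using wo_rel.ANTISYM[OF wo_rel_omega1] unfolding is_pred_ord_def antisym_def by blast

lemma the_is_pred_ord: "is_pred_ord \<beta> \<alpha> \<Longrightarrow> (THE \<beta>. is_pred_ord \<beta> \<alpha>) = \<beta>"
  by (rule the_equality) (auto dest: is_pred_ord_unique)

lemma transfinite_iterate_unfold:
  "transfinite_iterate D F \<alpha> =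
     (if underS omega1 \<alpha> = {} then F
      else if \<exists>\<beta>. is_pred_ord \<beta> \<alpha>
        then D (transfinite_iterate D F (THE \<beta>. is_pred_ord \<beta> \<alpha>))
      else (\<Inter>\<beta>\<in>underS omega1 \<alpha>. transfinite_iterate D F \<beta>))"
proof -
  define H where "H = (\<lambda>G \<alpha>.
     if underS omega1 \<alpha> = {} then F
     else if \<exists>\<beta>. is_pred_ord \<beta> \<alpha> then D (G (THE \<beta>. is_pred_ord \<beta> \<alpha>))
     else (\<Inter>\<beta>\<in>underS omega1 \<alpha>. G \<beta>))"
  have eq: "transfinite_iterate D F = wo_rel.worec omega1 H"
    by (simp add: transfinite_iterate_def H_def)
  have "wo_rel.adm_wo omega1 H"
    unfolding wo_rel.adm_wo_def[OF wo_rel_omega1]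
  proof (intro allI impI)
    fix f g :: "nat set \<Rightarrow> 'a set" and x
    assume a: "\<forall>y\<in>underS omega1 x. f y = g y"
    have "f (THE \<beta>. is_pred_ord \<beta> x) = g (THE \<beta>. is_pred_ord \<beta> x)" if "is_pred_ord \<beta> x" for \<beta>
      using that a by (simp add: the_is_pred_ord) (simp add: is_pred_ord_def)
    then show "H f x = H g x"
      using a by (auto simp: H_def)
  qed
  from wo_rel.worec_fixpoint[OF wo_rel_omega1 this]
  have "transfinite_iterate D F \<alpha> = H (transfinite_iterate D F) \<alpha>"
    by (simp add: eq[symmetric])
  then show ?thesis by (simp add: H_def)
qed

lemma transfinite_iterate_zero:
  "underS omega1 \<alpha> = {} \<Longrightarrow> transfinite_iterate D F \<alpha> = F"
  by (subst transfinite_iterate_unfold) simp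

lemma transfinite_iterate_succ:
  assumes "is_pred_ord \<beta> \<alpha>"
  shows "transfinite_iterate D F \<alpha> = D (transfinite_iterate D F \<beta>)"
proof -
  have "underS omega1 \<alpha> \<noteq> {}" using assms by (auto simp: is_pred_ord_def)
  then show ?thesis
    using assms by (subst transfinite_iterate_unfold) (auto simp: the_is_pred_ord)
qed

lemma transfinite_iterate_limit:
  "underS omega1 \<alpha> \<noteq> {} \<Longrightarrow> \<nexists>\<beta>. is_pred_ord \<beta> \<alpha> \<Longrightarrow>
     transfinite_iterate D F \<alpha> = (\<Inter>\<beta>\<in>underS omega1 \<alpha>. transfinite_iterate D F \<beta>)"
  by (subst transfinite_iterate_unfold) simp

definition stable_value :: "('a set \<Rightarrow> 'a set) \<Rightarrow> 'a set \<Rightarrow> 'a set" where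
  "stable_value D F = transfinite_iterate D F
     (SOME \<gamma>. \<gamma> \<in> Field omega1 \<and>
        (\<forall>\<gamma>'. (\<gamma>, \<gamma>') \<in> omega1 \<longrightarrow> transfinite_iterate D F \<gamma>' = transfinite_iterate D F \<gamma>))"

definition q_core ::
    "(complex^'n \<Rightarrow> real) \<Rightarrow> (complex^'n) set \<Rightarrow> nat \<Rightarrow> ((complex^'n) \<times> 'n ctangent) set
       \<Rightarrow> 'n grassmann set" where
  "q_core r M q D = stable_value (grassmann_derived r M q) (Gr q D)"

end

theory Submission
  imports Defs
begin

text \<open>Property $(P_q)$ only involves traces of the complex Hessian over Hermitian orthonormal
  \<open>q\<close>-frames (Ky Fan), which behave well under sums, products and compactness. Since Property
  $(P_q)$ allows arbitrarily large Hessians, it glues: if a closed subset \<open>B\<close> of a compact set \<open>X\<close>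
  has it and every point of \<open>X - B\<close> has a neighborhood in \<open>X\<close> that has it, then \<open>X\<close> has it. One adds
  to a function that is good near \<open>B\<close> small multiples of \<open>\<eta>\<^sup>4 e\<^sup>\<phi>\<close>, where \<open>\<eta>\<close> is a cutoff and the Hessian
  of \<open>\<phi>\<close> is huge compared with the derivatives of \<open>\<eta>\<close>.

  Let \<open>B\<close> be the set of points of the boundary \<open>M\<close> none of whose neighborhoods in \<open>M\<close> has Property
  $(P_q)$. If at some \<open>p \<in> B\<close> the space \<open>\<N>\<^sub>p \<inter> \<complex>T\<^sub>pB\<close> had dimension less than \<open>q\<close>, then a combination of
  \<open>r\<close>, \<open>r\<^sup>2\<close> and squares of functions vanishing on \<open>B\<close> would show that \<open>B\<close> has Property $(P_q)$ near \<open>p\<close>,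
  and by gluing so would \<open>M\<close>. Hence these dimensions are at least \<open>q\<close>, so \<open>B\<close> survives every step
  of the transfinite derivation and lies in the support of the core. If that support has Property
  $(P_q)$, then so does \<open>B\<close>, and gluing once more gives it for \<open>M\<close>. The stability of the
  transfinite sequence plays no role.\<close>

text \<open>Property (P_q) asks for bounded functions with huge Hessians, so the danger in gluing is
  the collar where a cutoff decays. Let s = \<eta>^2, let L bound the traces of \<phi> from below
  and let B bound the derivatives of \<eta>. The trace of \<eta>^4 exp \<phi> is then at least exp
  \<phi> times s (s L - B), which is never below -B^2 / (4 L). A large L makes the loss in the
  collar harmless and the gain where \<eta> = 1 as large as desired, while a small factor in front
  keeps the range under control.

  The combination near a point of B works because its terms share out the directions. At a zero of r
  the Hessian of r^2 is positive exactly off \<open>T10\<close>. On \<open>T10\<close>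
  pseudoconvexity makes the Hessian of r nonnegative, with the Levi kernel as null space. Squares of
  functions vanishing on B take care of kernel directions not tangent to B. As the sum vanishes on
  B, a large multiple of it still has small values close to B.

  Working with the whole bad set B replaces a step-by-step descent through the ordinals: tangent
  spaces grow with the set, so the fibers belonging to B bound those of every later stage from
  below.\<close>

no_notation fps_nth (infixl "$" 75)

subsection \<open>Orthonormal frames and sums of smallest eigenvalues\<close>

definition cip :: "complex^'n \<Rightarrow> complex^'n \<Rightarrow> complex" where
  "cip a b = (\<Sum>j\<in>UNIV. a $ j * cnj (b $ j))"

definition hform :: "complex^'n^'n \<Rightarrow> complex^'n \<Rightarrow> complex^'n \<Rightarrow> complex" where
  "hform H a b = (\<Sum>j\<in>UNIV. \<Sum>k\<in>UNIV. H $ j $ k * a $ j * cnj (b $ k))"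

text \<open>Indexing by a subset J of the coordinate type, with \<open>card J\<close> in the role of
  q, makes a frame a point of a finite-dimensional matrix space, where continuity and compactness
  are available. Rows outside J are unconstrained.\<close>

definition frame :: "'n set \<Rightarrow> complex^'m^'n \<Rightarrow> bool" where
  "frame J e \<longleftrightarrow> (\<forall>i\<in>J. \<forall>j\<in>J. cip (e $ i) (e $ j) = (if i = j then 1 else 0))"

lemma cip_add_left: "cip (a + b) c = cip a c + cip b c"
  and cip_diff_left: "cip (a - b) c = cip a c - cip b c"
  and cip_scale_left: "cip (x *s a) c = x * cip a c"
  and cip_add_right: "cip c (a + b) = cip c a + cip c b"
  and cip_scale_right: "cip c (x *s a) = cnj x * cip c a"
  and cip_zero_left: "cip 0 c = 0"
  and cip_zero_right: "cip c 0 = 0"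
  by (simp_all add: cip_def algebra_simps sum.distrib sum_subtractf sum_distrib_left)

lemma cip_sum_left: "cip (\<Sum>i\<in>S. f i) c = (\<Sum>i\<in>S. cip (f i) c)"
  by (induction S rule: infinite_finite_induct) (simp_all add: cip_add_left cip_zero_left)

lemma cip_sum_right: "cip c (\<Sum>i\<in>S. f i) = (\<Sum>i\<in>S. cip c (f i))"
  by (induction S rule: infinite_finite_induct) (simp_all add: cip_add_right cip_zero_right)

lemma cip_commute: "cip b a = cnj (cip a b)"
  by (simp add: cip_def mult.commute)

lemma Re_cip: "Re (cip a b) = inner a b"
  by (simp add: cip_def inner_vec_def inner_complex_def)

lemma cip_self: "cip a a = of_real ((norm a)\<^sup>2)"
proof -
  have "Im (cip a a) = 0" by (simp add: cip_def mult.commute)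
  then show ?thesis by (simp add: complex_eq_iff Re_cip power2_norm_eq_inner)
qed

lemma hform_add_left: "hform H (a + b) c = hform H a c + hform H b c"
  and hform_scale_left: "hform H (x *s a) c = x * hform H a c"
  and hform_add_right: "hform H c (a + b) = hform H c a + hform H c b"
  and hform_scale_right: "hform H c (x *s a) = cnj x * hform H c a"
  and hform_zero_left: "hform H 0 c = 0"
  and hform_zero_right: "hform H c 0 = 0"
  by (simp_all add: hform_def algebra_simps sum.distrib sum_distrib_left)

lemma hform_sum_left: "hform H (\<Sum>i\<in>S. f i) c = (\<Sum>i\<in>S. hform H (f i) c)"
  by (induction S rule: infinite_finite_induct) (simp_all add: hform_add_left hform_zero_left)

lemma hform_sum_right: "hform H c (\<Sum>i\<in>S. f i) = (\<Sum>i\<in>S. hform H c (f i))"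
  by (induction S rule: infinite_finite_induct) (simp_all add: hform_add_right hform_zero_right)

lemma hform_commute:
  assumes "\<And>j k. H $ k $ j = cnj (H $ j $ k)"
  shows "hform H b a = cnj (hform H a b)"
proof -
  have "hform H b a = (\<Sum>k\<in>UNIV. \<Sum>j\<in>UNIV. H $ j $ k * b $ j * cnj (a $ k))"
    unfolding hform_def by (rule sum.swap)
  also have "\<dots> = (\<Sum>k\<in>UNIV. \<Sum>j\<in>UNIV. cnj (H $ k $ j * a $ k * cnj (b $ j)))"
  proof (intro sum.cong refl)
    fix j k
    show "H $ j $ k * b $ j * cnj (a $ k) = cnj (H $ k $ j * a $ k * cnj (b $ j))"
      using assms[of k j] by (simp add: mult_ac)
  qed
  finally show ?thesis by (simp add: hform_def)
qed

lemma scaleR_eq_vector_scalar: "t *\<^sub>R (a :: complex^'n) = of_real t *s a"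
  by (vector scaleR_conv_of_real)

lemma frame_norm: "frame J e \<Longrightarrow> j \<in> J \<Longrightarrow> norm (e $ j) = 1"
  using cip_self[of "e $ j"] by (simp add: frame_def power2_eq_1_iff flip: of_real_power)
    (metis neg_0_le_iff_le norm_ge_zero not_one_le_zero)

lemma frame_expansion_orthogonal:
  assumes "frame J e" "finite J" "j \<in> J"
  shows "cip (a - (\<Sum>i\<in>J. cip a (e $ i) *s e $ i)) (e $ j) = 0"
proof -
  have "(\<Sum>i\<in>J. cip (cip a (e $ i) *s e $ i) (e $ j)) = (\<Sum>i\<in>J. if i = j then cip a (e $ i) else 0)"
    using assms by (intro sum.cong) (auto simp: cip_scale_left frame_def)
  with assms show ?thesis by (simp add: cip_diff_left cip_sum_left)
qed

text \<open>A Gram-Schmidt step: fewer than \<open>vec.dim V\<close> vectors cannot span V, and a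
  vector that they miss, minus its projection, is nonzero and can be normalized.\<close>

lemma orthonormal_extension:
  fixes e :: "complex^'m^'n"
  assumes "vec.subspace V" "frame S e" "finite S" "\<And>j. j \<in> S \<Longrightarrow> e $ j \<in> V" "card S < vec.dim V"
  obtains u where "u \<in> V" "norm u = 1" "\<And>j. j \<in> S \<Longrightarrow> cip u (e $ j) = 0"
proof -
  have "\<not> V \<subseteq> vec.span ((\<lambda>j. e $ j) ` S)"
  proof
    assume "V \<subseteq> vec.span ((\<lambda>j. e $ j) ` S)"
    then have "vec.dim V \<le> card ((\<lambda>j. e $ j) ` S)"
      using assms(3) by (intro vec.dim_le_card) auto
    with card_image_le[OF assms(3), of "\<lambda>j. e $ j"] assms(5) show False by simp
  qed
  then obtain v where v: "v \<in> V" "v \<notin> vec.span ((\<lambda>j. e $ j) ` S)" by auto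
  define s where "s = (\<Sum>i\<in>S. cip v (e $ i) *s e $ i)"
  have s: "s \<in> vec.span ((\<lambda>j. e $ j) ` S)"
    unfolding s_def by (intro vec.span_sum vec.span_scale vec.span_base) auto
  have sV: "s \<in> V"
    unfolding s_def using assms by (intro vec.subspace_sum vec.subspace_scale) auto
  define w where "w = v - s"
  have w0: "w \<noteq> 0" using s v by (auto simp: w_def)
  have wV: "w \<in> V" using sV v assms by (auto simp: w_def vec.subspace_diff)
  have wo: "cip w (e $ j) = 0" if "j \<in> S" for j
    unfolding w_def s_def using frame_expansion_orthogonal[OF assms(2,3) that] .
  show ?thesis
  proof (rule that[of "of_real (inverse (norm w)) *s w"])
    show "of_real (inverse (norm w)) *s w \<in> V" using wV assms vec.subspace_scale by blast
    show "norm (of_real (inverse (norm w)) *s w) = 1"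
      unfolding scaleR_eq_vector_scalar[symmetric] using w0 by simp
    show "cip (of_real (inverse (norm w)) *s w) (e $ j) = 0" if "j \<in> S" for j
      using wo[OF that] by (simp add: cip_scale_left)
  qed
qed

lemma frame_insert:
  assumes "frame S e" "i \<notin> S" "norm u = 1" "\<And>j. j \<in> S \<Longrightarrow> cip u (e $ j) = 0"
  shows "frame (insert i S) (\<chi> j. if j = i then u else e $ j)"
proof -
  have "cip (e $ j) u = 0" if "j \<in> S" for j using assms(4)[OF that] cip_commute[of "e $ j" u] by simp
  moreover have "cip u u = 1" using assms by (simp add: cip_self)
  ultimately show ?thesis using assms by (auto simp: frame_def)
qed

lemma frame_exists:
  fixes J :: "'n::finite set" and V :: "(complex^'m) set"
  assumes "vec.subspace V" "card J \<le> vec.dim V"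
  shows "\<exists>e. frame J e \<and> (\<forall>j\<in>J. e $ j \<in> V)"
  using finite[of J] assms(2)
proof (induction J rule: finite_induct)
  case empty
  then show ?case by (simp add: frame_def)
next
  case (insert i S)
  then obtain e :: "complex^'m^'n" where e: "frame S e" "\<forall>j\<in>S. e $ j \<in> V" by auto
  obtain u where u: "u \<in> V" "norm u = 1" "\<And>j. j \<in> S \<Longrightarrow> cip u (e $ j) = 0"
    using orthonormal_extension[OF assms(1) e(1), of thesis] e insert by auto
  have "frame (insert i S) (\<chi> j. if j = i then u else e $ j)"
    using frame_insert[of S e i u] e u insert by auto
  moreover have "\<forall>j\<in>insert i S. (\<chi> j. if j = i then u else e $ j) $ j \<in> V"
    using e u by auto
  ultimately show ?case by blast
qed

lemma frame_dim_span:
  fixes e :: "complex^'m^'n"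
  assumes "frame J e"
  shows "vec.dim (vec.span ((\<lambda>j. e $ j) ` J)) = card J"
proof -
  have inj: "inj_on (\<lambda>j. e $ j) J"
    using assms by (intro inj_onI) (metis (no_types) frame_def one_neq_zero)
  have "vec.independent ((\<lambda>j. e $ j) ` J)"
  proof (rule vec.independent_if_scalars_zero)
    fix f x assume *: "(\<Sum>x\<in>(\<lambda>j. e $ j) ` J. f x *s x) = 0" "x \<in> (\<lambda>j. e $ j) ` J"
    then obtain i where i: "i \<in> J" "x = e $ i" by auto
    have "0 = cip (\<Sum>j\<in>J. f (e $ j) *s e $ j) (e $ i)"
      using * inj by (simp add: sum.reindex cip_zero_left)
    also have "\<dots> = (\<Sum>j\<in>J. if j = i then f (e $ j) else 0)"
      unfolding cip_sum_left using assms i by (intro sum.cong) (auto simp: cip_scale_left frame_def)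
    finally show "f x = 0" using i by simp
  qed auto
  then show ?thesis
    using inj by (metis vec.dim_span_eq_card_independent card_image)
qed

text \<open>Pythagoras for a = w + s, where s is the projection to the frame and w is orthogonal to
  it; in the second claim w = 0.\<close>

lemma frame_bessel:
  assumes "frame J e" "finite J"
  shows "(\<Sum>j\<in>J. (cmod (cip a (e $ j)))\<^sup>2) \<le> (norm a)\<^sup>2"
    and "a = (\<Sum>i\<in>J. cip a (e $ i) *s e $ i) \<Longrightarrow> (\<Sum>j\<in>J. (cmod (cip a (e $ j)))\<^sup>2) = (norm a)\<^sup>2"
proof -
  define s where "s = (\<Sum>i\<in>J. cip a (e $ i) *s e $ i)"
  define w where "w = a - s"
  have wo: "cip w (e $ j) = 0" if "j \<in> J" for j
    unfolding w_def s_def using frame_expansion_orthogonal[OF assms that] .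
  have "cip s w = (\<Sum>i\<in>J. cip a (e $ i) * cnj (cip w (e $ i)))"
    unfolding s_def cip_sum_left cip_scale_left by (simp only: cip_commute[of _ w])
  then have sw: "cip s w = 0" using wo by simp
  have "cip s a = (\<Sum>i\<in>J. cip a (e $ i) * cnj (cip a (e $ i)))"
    unfolding s_def cip_sum_left cip_scale_left by (simp only: cip_commute[of "e $ _" a])
  also have "\<dots> = of_real (\<Sum>j\<in>J. (cmod (cip a (e $ j)))\<^sup>2)"
    by (simp add: complex_norm_square del: of_real_power)
  finally have sa: "cip s a = of_real (\<Sum>j\<in>J. (cmod (cip a (e $ j)))\<^sup>2)" .
  have as: "a = w + s" by (simp add: w_def)
  have "cip a a = cip w w + cip w s + cip s a"
    by (subst as) (simp add: cip_add_left, simp add: as cip_add_right)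
  moreover have "cip w s = 0" using sw cip_commute[of w s] by simp
  ultimately have "of_real ((norm a)\<^sup>2) = complex_of_real ((norm w)\<^sup>2 + (\<Sum>j\<in>J. (cmod (cip a (e $ j)))\<^sup>2))"
    by (simp add: cip_self sa del: of_real_power)
  then have *: "(norm a)\<^sup>2 = (norm w)\<^sup>2 + (\<Sum>j\<in>J. (cmod (cip a (e $ j)))\<^sup>2)"
    using of_real_eq_iff by blast
  then show "(\<Sum>j\<in>J. (cmod (cip a (e $ j)))\<^sup>2) \<le> (norm a)\<^sup>2" by simp
  show "(\<Sum>j\<in>J. (cmod (cip a (e $ j)))\<^sup>2) = (norm a)\<^sup>2" if "a = (\<Sum>i\<in>J. cip a (e $ i) *s e $ i)"
    using that * by (simp add: w_def s_def)
qed

text \<open>A frame indexed by all coordinates spans, by a dimension count, so the residue of the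
  expansion is orthogonal to itself.\<close>

lemma frame_UNIV_expansion:
  fixes e :: "complex^'n^'n"
  assumes "frame UNIV e"
  shows "a = (\<Sum>i\<in>UNIV. cip a (e $ i) *s e $ i)"
proof (rule ccontr)
  assume n: "a \<noteq> (\<Sum>i\<in>UNIV. cip a (e $ i) *s e $ i)"
  have "vec.span ((\<lambda>j. e $ j) ` UNIV) = UNIV"
    using frame_dim_span[OF assms] vec.dim_eq_full
    by (metis vec.dim_UNIV vec.span_span vec_dim_card vec.dimension_def)
  then have "a - (\<Sum>i\<in>UNIV. cip a (e $ i) *s e $ i) \<in> vec.span (range (\<lambda>j. e $ j))" by simp
  moreover define w where "w = a - (\<Sum>i\<in>UNIV. cip a (e $ i) *s e $ i)"
  have wo: "cip w (e $ j) = 0" for j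
    unfolding w_def using frame_expansion_orthogonal[OF assms] by simp
  have "x \<in> vec.span (range (\<lambda>j. e $ j)) \<Longrightarrow> cip w x = 0" for x
  proof (induction rule: vec.span_induct_alt)
    case base show ?case by (simp add: cip_def)
  next
    case (step c x y) then show ?case using wo by (auto simp: cip_add_right cip_scale_right)
  qed
  ultimately have "cip w w = 0" by (simp add: w_def)
  then show False using n by (simp add: cip_self w_def)
qed

text \<open>The first-order condition at a minimum. It serves twice: for Rayleigh minimizers and for
  null vectors of a semidefinite Levi form.\<close>

lemma linear_coefficient_zero:
  fixes X Y :: real
  assumes "\<And>t. 0 \<le> t * X + t\<^sup>2 * Y"
  shows "X = 0"
proof (rule ccontr)
  assume X: "X \<noteq> 0"
  \<comment> \<open>With s |Y| < 1 the quadratic term at t = - s X is too small to compensate the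
    negative linear term.\<close>
  define s where "s = 1 / (2 * (\<bar>Y\<bar> + 1))"
  have s: "s > 0" "s * \<bar>Y\<bar> < 1" by (auto simp: s_def divide_simps)
  have "0 \<le> (- s * X) * X + (- s * X)\<^sup>2 * Y" by (rule assms)
  also have "\<dots> = s * X\<^sup>2 * (s * Y - 1)" by (simp add: power2_eq_square algebra_simps)
  finally have "0 \<le> s * X\<^sup>2 * (s * Y - 1)" .
  moreover have "s * Y - 1 < 0" using s mult_left_mono[OF abs_ge_self[of Y], of s] by linarith
  moreover have "s * X\<^sup>2 > 0" using s X by simp
  ultimately show False by (metis linorder_not_less mult_pos_neg)
qed

lemma continuous_on_hform [continuous_intros]:
  assumes "continuous_on S f" "continuous_on S g"
  shows "continuous_on S (\<lambda>x. hform H (f x) (g x))"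
  unfolding hform_def using assms by (intro continuous_intros)

lemma continuous_on_cip [continuous_intros]:
  assumes "continuous_on S f" "continuous_on S g"
  shows "continuous_on S (\<lambda>x. cip (f x) (g x))"
  unfolding cip_def using assms by (intro continuous_intros)

text \<open>Eigenvectors are produced one at a time, as minimizers of the Rayleigh quotient on
  the orthogonal complement of the previous ones.\<close>

lemma hermitian_eigenframe:
  fixes H :: "complex^'n^'n"
  assumes H: "\<And>j k. H $ k $ j = cnj (H $ j $ k)"
  shows "\<exists>(e :: complex^'n^'n) d. frame S e \<and>
    (\<forall>j\<in>S. \<forall>b. hform H (e $ j) b = of_real (d j) * cip (e $ j) b)"
  using finite[of S]
proof (induction S rule: finite_induct)
  case empty
  then show ?case by (simp add: frame_def)
next
  case (insert i S)
  then obtain e :: "complex^'n^'n" and d where e: "frame S e"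
    and d: "\<And>j b. j \<in> S \<Longrightarrow> hform H (e $ j) b = of_real (d j) * cip (e $ j) b" by blast
  define V where "V = {a. \<forall>j\<in>S. cip a (e $ j) = 0}"
  have V: "vec.subspace V"
    by (auto simp: V_def vec.subspace_def cip_zero_left cip_add_left cip_scale_left)
  have "card S < CARD('n)"
    using insert by (intro psubset_card_mono) auto
  then obtain u0 where u0: "norm u0 = 1" "u0 \<in> V"
    using orthonormal_extension[of UNIV S e thesis] e insert(1)
    by (auto simp: V_def vec_dim_card simp del: vec.dim_UNIV)
  have hself: "hform H a a = of_real (Re (hform H a a))" for a
    using hform_commute[OF H, of a a] by (simp add: complex_eq_iff)
  have "closed V"
  proof -
    have "V = (\<Inter>j\<in>S. {a. cip a (e $ j) = 0})" by (auto simp: V_def)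
    then show ?thesis by (auto intro!: closed_INT closed_Collect_eq continuous_intros)
  qed
  then have "compact (V \<inter> sphere 0 1)"
    by (intro closed_Int_compact) auto
  moreover have "V \<inter> sphere 0 1 \<noteq> {}" using u0 by auto
  moreover have "continuous_on (V \<inter> sphere 0 1) (\<lambda>a. Re (hform H a a))"
    by (intro continuous_intros)
  ultimately obtain u where "u \<in> V \<inter> sphere 0 1"
    and "\<forall>a\<in>V \<inter> sphere 0 1. Re (hform H u u) \<le> Re (hform H a a)"
    using continuous_attains_inf[of "V \<inter> sphere 0 1" "\<lambda>a. Re (hform H a a)"] by blast
  then have u: "u \<in> V" "norm u = 1"
    and umin: "\<And>a. a \<in> V \<Longrightarrow> norm a = 1 \<Longrightarrow> Re (hform H u u) \<le> Re (hform H a a)"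
    by auto
  define l where "l = Re (hform H u u)"
  have ray: "l * (norm a)\<^sup>2 \<le> Re (hform H a a)" if "a \<in> V" for a
  proof (cases "a = 0")
    case False
    define a' where "a' = of_real (inverse (norm a)) *s a"
    have "a' \<in> V" using that V by (auto simp: a'_def vec.subspace_scale)
    moreover have "norm a' = 1"
      unfolding a'_def scaleR_eq_vector_scalar[symmetric] using False by simp
    ultimately have "l \<le> Re (hform H a' a')" using umin by (simp add: l_def)
    also have "hform H a' a' = of_real ((inverse (norm a))\<^sup>2) * hform H a a"
      by (simp add: a'_def hform_scale_left hform_scale_right power2_eq_square)
    also have "Re \<dots> = (inverse (norm a))\<^sup>2 * Re (hform H a a)"
      by (metis Re_complex_of_real hself of_real_mult)
    finally show ?thesis using False by (simp add: field_simps)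
  qed (simp add: hform_zero_left)
  have Reeig: "Re (hform H u b) = l * Re (cip u b)" if "b \<in> V" for b
  proof -
    have "2 * (Re (hform H u b) - l * Re (cip u b)) = 0"
    proof (rule linear_coefficient_zero)
      fix t :: real
      have "u + of_real t *s b \<in> V" using u that V by (auto simp: vec.subspace_add vec.subspace_scale)
      from ray[OF this]
      have "l * Re (cip (u + of_real t *s b) (u + of_real t *s b))
        \<le> Re (hform H (u + of_real t *s b) (u + of_real t *s b))" by (simp add: cip_self)
      moreover have "Re (hform H b u) = Re (hform H u b)" "Re (cip b u) = Re (cip u b)"
        using hform_commute[OF H, of b u] cip_commute[of b u] by simp_all
      moreover have "Re (cip u u) = 1" using u by (simp add: cip_self)
      ultimately show "0 \<le> t * (2 * (Re (hform H u b) - l * Re (cip u b)))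
          + t\<^sup>2 * (Re (hform H b b) - l * Re (cip b b))"
        by (simp add: hform_add_left hform_add_right hform_scale_left hform_scale_right
            cip_add_left cip_add_right cip_scale_left cip_scale_right l_def power2_eq_square algebra_simps)
    qed
    then show ?thesis by simp
  qed
  \<comment> \<open>Testing the real identity on b and on i b yields the real and imaginary parts of
    the complex one.\<close>
  have eigV: "hform H u b = of_real l * cip u b" if "b \<in> V" for b
  proof -
    have "\<i> *s b \<in> V" using that V by (auto simp: vec.subspace_scale)
    from Reeig[OF this] Reeig[OF that] show ?thesis
      by (simp add: complex_eq_iff hform_scale_right cip_scale_right)
  qed
  have cu: "cip u (e $ j) = 0" if "j \<in> S" for j using u that by (auto simp: V_def)
  have eige: "hform H u (e $ j) = 0" if "j \<in> S" for j
    using hform_commute[OF H, of u "e $ j"] d[OF that, of u] cip_commute[of "e $ j" u] cu[OF that] by simp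
  \<comment> \<open>Any b is a vector of \<open>V\<close> plus a combination of the earlier
    eigenvectors, and on the latter both sides vanish by \<open>eige\<close> and
    \<open>cu\<close>.\<close>
  have eig: "hform H u b = of_real l * cip u b" for b
  proof -
    define s where "s = (\<Sum>i\<in>S. cip b (e $ i) *s e $ i)"
    have "b - s \<in> V" using frame_expansion_orthogonal[OF e insert(1)] by (auto simp: V_def s_def)
    moreover have "hform H u s = 0" by (simp add: s_def hform_sum_right hform_scale_right eige)
    moreover have "cip u s = 0"
      by (simp add: s_def cip_sum_right cip_scale_right cu)
    ultimately show ?thesis
      using eigV[of "b - s"] hform_add_right[of H u "b - s" s] cip_add_right[of u "b - s" s]
      by (simp only: diff_add_cancel add_0_right)
  qed
  have "frame (insert i S) (\<chi> j. if j = i then u else e $ j)"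
    by (rule frame_insert[OF e insert(2) u(2) cu])
  moreover have "\<forall>j\<in>insert i S. \<forall>b. hform H ((\<chi> j. if j = i then u else e $ j) $ j) b
      = of_real ((d(i := l)) j) * cip ((\<chi> j. if j = i then u else e $ j) $ j) b"
    using insert(2) by (auto simp: eig d)
  ultimately show ?case by (intro exI conjI)
qed

text \<open>As \<open>hform\<close> contracts the first index of H with its first argument, the rows
  of the frame are left eigenvectors. Over the polynomial ring this reads E P = D E with D diagonal.
  The ring is a domain and det E is nonzero, so det E cancels and the characteristic polynomial
  splits into the factors x - \<open>d l\<close>, multiplicities included.\<close>

lemma hermitian_eigenvalues_eigenframe:
  fixes H e :: "complex^'n^'n"
  assumes e: "frame UNIV e"
    and d: "\<And>j b. hform H (e $ j) b = of_real (d j) * cip (e $ j) b"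
  shows "hermitian_eigenvalues H = sorted_list_of_multiset (image_mset d (mset_set UNIV))"
proof -
  define P :: "complex poly^'n^'n" where
    "P = (\<chi> j k. (if j = k then [:0, 1:] else 0) - [:H $ j $ k:])"
  define E :: "complex poly^'n^'n" where "E = (\<chi> l k. [:e $ l $ k:])"
  define E' :: "complex poly^'n^'n" where "E' = (\<chi> k l. [:cnj (e $ l $ k):])"
  define D :: "complex poly^'n^'n" where
    "D = (\<chi> l m. if l = m then [:- of_real (d l), 1:] else 0)"
  have const_sum: "(\<Sum>i\<in>S. [:f i:]) = [:\<Sum>i\<in>S. f i:]" for f :: "'n \<Rightarrow> complex" and S
    by (induction S rule: infinite_finite_induct) auto
  have "(E ** E') $ i $ j = mat 1 $ i $ j" for i j
  proof -
    have "(E ** E') $ i $ j = [:cip (e $ i) (e $ j):]"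
      by (simp add: matrix_matrix_mult_def E_def E'_def const_sum cip_def mult.commute)
    then show ?thesis using e by (simp add: frame_def mat_def one_pCons)
  qed
  then have "E ** E' = mat 1" by (simp add: vec_eq_iff)
  then have detE: "det E \<noteq> 0" using det_mul[of E E'] by auto
  have eH: "(\<Sum>j\<in>UNIV. e $ l $ j * H $ j $ k) = of_real (d l) * e $ l $ k" for l k
  proof -
    have "hform H (e $ l) (axis k 1) = (\<Sum>j\<in>UNIV. \<Sum>m\<in>UNIV. if m = k then e $ l $ j * H $ j $ k else 0)"
      unfolding hform_def by (intro sum.cong) (auto simp: axis_def)
    then have "hform H (e $ l) (axis k 1) = (\<Sum>j\<in>UNIV. e $ l $ j * H $ j $ k)" by simp
    moreover have "cip (e $ l) (axis k 1) = (\<Sum>j\<in>UNIV. if j = k then e $ l $ k else 0)"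
      unfolding cip_def by (intro sum.cong) (auto simp: axis_def)
    ultimately show ?thesis using d[of l "axis k 1"] by simp
  qed
  have "(E ** P) $ l $ k = (D ** E) $ l $ k" for l k
  proof -
    have "(E ** P) $ l $ k = (\<Sum>j\<in>UNIV. (if j = k then [:0, e $ l $ k:] else 0) - [:e $ l $ j * H $ j $ k:])"
      unfolding matrix_matrix_mult_def by (simp, intro sum.cong) (auto simp: E_def P_def algebra_simps)
    also have "\<dots> = [:0, e $ l $ k:] - [:of_real (d l) * e $ l $ k:]"
      by (simp add: sum_subtractf const_sum eH)
    also have "\<dots> = [:- of_real (d l), 1:] * [:e $ l $ k:]" by simp
    also have "\<dots> = (\<Sum>j\<in>UNIV. if j = l then [:- of_real (d l), 1:] * [:e $ l $ k:] else 0)" by simp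
    also have "\<dots> = (D ** E) $ l $ k"
      unfolding matrix_matrix_mult_def by (simp only: vec_lambda_beta, intro sum.cong) (auto simp: E_def D_def)
    finally show ?thesis .
  qed
  then have "E ** P = D ** E" by (simp add: vec_eq_iff)
  then have "det E * det P = det D * det E" by (metis det_mul)
  then have "det P = det D" using detE by simp
  also have "\<dots> = (\<Prod>l\<in>UNIV. [:- of_real (d l), 1:])"
    by (subst det_diagonal) (auto simp: D_def)
  finally have "charpoly H = (\<Prod>l\<in>UNIV. [:- of_real (d l), 1:])" by (simp add: charpoly_def P_def)
  then have "proots (charpoly H) = (\<Sum>l\<in>UNIV. {#complex_of_real (d l)#})"
    by (simp add: proots_prod)
  also have "\<dots> = image_mset (\<lambda>l. of_real (d l)) (mset_set UNIV)"
    by (simp add: sum_unfold_sum_mset)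
  finally show ?thesis by (simp add: hermitian_eigenvalues_def multiset.map_comp comp_def)
qed

text \<open>Sorting the indices by eigenvalue turns a prefix of the list into an index set
  \<open>T\<close>. With repeated eigenvalues \<open>T\<close> depends on the sorting, so only a
  weak inequality between inside and outside is recorded.\<close>

lemma hermitian_smallest_eigenvalues:
  fixes H :: "complex^'n^'n"
  assumes H: "\<And>j k. H $ k $ j = cnj (H $ j $ k)" and q: "q \<le> CARD('n)"
  obtains e :: "complex^'n^'n" and d T where "frame UNIV e"
    "\<And>j b. hform H (e $ j) b = of_real (d j) * cip (e $ j) b"
    "card T = q" "\<And>i j. i \<in> T \<Longrightarrow> j \<notin> T \<Longrightarrow> d i \<le> d j"
    "sum_list (take q (hermitian_eigenvalues H)) = (\<Sum>j\<in>T. d j)"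
proof -
  obtain e :: "complex^'n^'n" and d where e: "frame UNIV e"
    and d: "\<And>j b. hform H (e $ j) b = of_real (d j) * cip (e $ j) b"
    using hermitian_eigenframe[OF H, of UNIV] by auto
  obtain ys :: "'n list" where ys: "set ys = UNIV" "distinct ys"
    using finite_distinct_list[of "UNIV :: 'n set"] by auto
  define xs where "xs = sort_key d ys"
  have xs: "set xs = UNIV" "distinct xs" "sorted (map d xs)"
    using ys by (simp_all add: xs_def)
  have len: "length xs = CARD('n)" using xs distinct_card by fastforce
  have "hermitian_eigenvalues H = sorted_list_of_multiset (mset (map d xs))"
    using hermitian_eigenvalues_eigenframe[OF e d] xs mset_set_set[OF xs(2)] by simp
  also have "\<dots> = map d xs" using xs(3) by (simp only: sorted_list_of_multiset_mset sorted_sort_id)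
  finally have *: "sum_list (take q (hermitian_eigenvalues H)) = sum_list (map d (take q xs))"
    by (simp add: take_map)
  define T where "T = set (take q xs)"
  have "card T = q" using xs(2) len q by (simp add: T_def distinct_card)
  moreover have "d i \<le> d j" if "i \<in> T" "j \<notin> T" for i j
  proof -
    have "set (take q xs) \<union> set (drop q xs) = UNIV"
      unfolding set_append[symmetric] append_take_drop_id xs(1) ..
    then have "j \<in> set (drop q xs)" using that unfolding T_def by blast
    moreover have "sorted (map d (take q xs) @ map d (drop q xs))"
      unfolding map_append[symmetric] append_take_drop_id by (rule xs(3))
    ultimately show ?thesis using that by (auto simp: T_def sorted_append)
  qed
  moreover have "sum_list (map d (take q xs)) = (\<Sum>j\<in>T. d j)"
    using xs(2) by (simp add: T_def sum_list_distinct_conv_sum_set)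
  ultimately show ?thesis using that[of e d T] e d * by simp
qed

text \<open>Ky Fan's minimum principle. Eigenvectors attain the sum. For any other frame the trace
  is a weighted sum of the eigenvalues, with weights in [0, 1] of total \<open>card J\<close>, and
  this is least when all weight sits on the smallest ones.\<close>

lemma sum_smallest_eigenvalues_ge_iff:
  fixes H :: "complex^'n^'n" and J :: "'n set"
  assumes H: "\<And>j k. H $ k $ j = cnj (H $ j $ k)"
  shows "sum_list (take (card J) (hermitian_eigenvalues H)) \<ge> c \<longleftrightarrow>
    (\<forall>g :: complex^'n^'n. frame J g \<longrightarrow> (\<Sum>j\<in>J. Re (hform H (g $ j) (g $ j))) \<ge> c)"
proof -
  have "card J \<le> CARD('n)" by (simp add: card_mono)
  from hermitian_smallest_eigenvalues[OF H this]
  obtain e :: "complex^'n^'n" and d T where e: "frame UNIV e"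
    and d: "\<And>j b. hform H (e $ j) b = of_real (d j) * cip (e $ j) b"
    and T: "card T = card J" "\<And>i j. i \<in> T \<Longrightarrow> j \<notin> T \<Longrightarrow> d i \<le> d j"
    and s: "sum_list (take (card J) (hermitian_eigenvalues H)) = (\<Sum>j\<in>T. d j)"
    by blast
  have "\<exists>g :: complex^'n^'n. frame J g \<and> (\<Sum>j\<in>J. Re (hform H (g $ j) (g $ j))) = (\<Sum>j\<in>T. d j)"
  proof -
    obtain f where f: "bij_betw f J T"
      using T(1) by (metis finite_same_card_bij finite)
    define g :: "complex^'n^'n" where "g = (\<chi> j. e $ f j)"
    have "frame J g" using e f by (auto simp: g_def frame_def bij_betw_def inj_on_def)
    moreover have "(\<Sum>j\<in>J. Re (hform H (g $ j) (g $ j))) = (\<Sum>j\<in>J. d (f j))"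
      using e by (simp add: g_def d frame_def)
    moreover have "(\<Sum>j\<in>J. d (f j)) = (\<Sum>j\<in>T. d j)" by (rule sum.reindex_bij_betw[OF f])
    ultimately show ?thesis by auto
  qed
  moreover have "(\<Sum>j\<in>T. d j) \<le> (\<Sum>j\<in>J. Re (hform H (g $ j) (g $ j)))"
    if g: "frame J g" for g :: "complex^'n^'n"
  proof -
    \<comment> \<open>The squared length of the projection of \<open>e $ l\<close> to the span of
      the frame g. Bessel for g bounds it by 1, and Parseval for e gives the total.\<close>
    define w where "w l = (\<Sum>j\<in>J. (cmod (cip (g $ j) (e $ l)))\<^sup>2)" for l
    have "Re (hform H a a) = (\<Sum>l\<in>UNIV. d l * (cmod (cip a (e $ l)))\<^sup>2)" for a
    proof -
      have "hform H a a = hform H (\<Sum>l\<in>UNIV. cip a (e $ l) *s e $ l) a"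
        by (rule arg_cong[where f = "\<lambda>x. hform H x a", OF frame_UNIV_expansion[OF e]])
      also have "\<dots> = (\<Sum>l\<in>UNIV. cip a (e $ l) * (of_real (d l) * cnj (cip a (e $ l))))"
        by (simp only: hform_sum_left hform_scale_left d cip_commute[of "e $ _" a])
      also have "\<dots> = (\<Sum>l\<in>UNIV. of_real (d l * (cmod (cip a (e $ l)))\<^sup>2))"
        by (intro sum.cong refl) (simp only: of_real_mult complex_norm_square mult_ac)
      finally show ?thesis by (simp only: of_real_sum[symmetric] Re_complex_of_real)
    qed
    then have "(\<Sum>j\<in>J. Re (hform H (g $ j) (g $ j)))
        = (\<Sum>j\<in>J. \<Sum>l\<in>UNIV. d l * (cmod (cip (g $ j) (e $ l)))\<^sup>2)" by simp
    also have "\<dots> = (\<Sum>l\<in>UNIV. d l * w l)"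
      unfolding w_def sum_distrib_left by (rule sum.swap)
    finally have tr: "(\<Sum>j\<in>J. Re (hform H (g $ j) (g $ j))) = (\<Sum>l\<in>UNIV. d l * w l)" .
    have w0: "w l \<ge> 0" for l by (simp add: w_def sum_nonneg)
    have w1: "w l \<le> 1" for l
    proof -
      have "w l = (\<Sum>j\<in>J. (cmod (cip (e $ l) (g $ j)))\<^sup>2)"
        unfolding w_def by (intro sum.cong refl) (metis cip_commute complex_mod_cnj)
      also have "\<dots> \<le> (norm (e $ l))\<^sup>2" by (rule frame_bessel(1)[OF g]) simp
      finally show ?thesis using frame_norm[OF e] by simp
    qed
    have "(\<Sum>l\<in>UNIV. w l) = (\<Sum>j\<in>J. \<Sum>l\<in>UNIV. (cmod (cip (g $ j) (e $ l)))\<^sup>2)"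
      unfolding w_def by (rule sum.swap)
    also have "\<dots> = (\<Sum>j\<in>J. (norm (g $ j))\<^sup>2)"
      by (simp only: frame_bessel(2)[OF e finite frame_UNIV_expansion[OF e]])
    also have "\<dots> = card J" using frame_norm[OF g] by simp
    finally have wsum: "(\<Sum>l\<in>UNIV. w l) = card T" using T by simp
    \<comment> \<open>A threshold separating the chosen eigenvalues from the others; for empty
      \<open>T\<close> the least eigenvalue will do.\<close>
    obtain m where m: "\<And>i. i \<in> T \<Longrightarrow> d i \<le> m" "\<And>j. j \<notin> T \<Longrightarrow> m \<le> d j"
    proof (cases "T = {}")
      case True
      then show ?thesis using that[of "Min (range d)"] by auto
    next
      case False
      then show ?thesis using that[of "Max (d ` T)"] T(2) by auto
    qed
    have "(\<Sum>l\<in>UNIV. m * (w l - of_bool (l \<in> T))) = 0"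
      by (simp add: sum_distrib_left[symmetric] sum_subtractf wsum of_bool_def sum.If_cases)
    \<comment> \<open>The factors \<open>d l - m\<close> and
      \<open>w l - of_bool (l \<in> T)\<close> are both nonpositive on \<open>T\<close> and both
      nonnegative off it.\<close>
    moreover have "m * (w l - of_bool (l \<in> T)) \<le> d l * (w l - of_bool (l \<in> T))" for l
    proof (cases "l \<in> T")
      case True
      then show ?thesis using m(1)[of l] w1[of l] by (simp add: mult_right_mono_neg)
    next
      case False
      then show ?thesis using m(2)[of l] w0[of l] by (simp add: mult_right_mono)
    qed
    ultimately have "0 \<le> (\<Sum>l\<in>UNIV. d l * (w l - of_bool (l \<in> T)))"
      by (metis (no_types, lifting) sum_mono)
    also have "\<dots> = (\<Sum>l\<in>UNIV. d l * w l) - (\<Sum>l\<in>UNIV. d l * of_bool (l \<in> T))"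
      by (simp only: right_diff_distrib sum_subtractf)
    also have "(\<Sum>l\<in>UNIV. d l * of_bool (l \<in> T)) = (\<Sum>l\<in>T. d l)"
      by (simp add: of_bool_def sum.If_cases if_distrib cong: if_cong)
    finally show ?thesis using tr by simp
  qed
  ultimately show ?thesis using s by (metis order_trans)
qed

subsection \<open>Calculus of twice continuously differentiable functions\<close>

lemma Ck_on_cong:
  assumes "open U" "\<And>x. x \<in> U \<Longrightarrow> f x = g x" "Ck_on k f U"
  shows "Ck_on k g U"
  using assms(2,3)
proof (induction k arbitrary: f g)
  case 0
  then show ?case using continuous_on_cong[of U U f g] by simp
next
  case (Suc k)
  have "g differentiable (at x)" if "x \<in> U" for x
    using Suc.prems that assms(1) unfolding differentiable_def Ck_on.simps(2)
    by (meson has_derivative_transform_within_open)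
  moreover have "Ck_on k (\<lambda>x. frechet_derivative g (at x) v) U" for v
  proof (rule Suc.IH)
    show "Ck_on k (\<lambda>x. frechet_derivative f (at x) v) U" using Suc.prems by simp
    show "frechet_derivative f (at x) v = frechet_derivative g (at x) v" if "x \<in> U" for x
      using frechet_derivative_transform_within_open[of f x U g] Suc.prems that assms(1) by simp
  qed
  ultimately show ?case by simp
qed

lemma Ck_on_subset: "Ck_on k f U \<Longrightarrow> V \<subseteq> U \<Longrightarrow> Ck_on k f V"
  by (induction k arbitrary: f) (auto intro: continuous_on_subset)

lemma Ck_on_Suc: "Ck_on (Suc k) f U \<Longrightarrow> Ck_on k f U"
proof (induction k arbitrary: f)
  case 0
  then show ?case
    by (auto intro!: continuous_at_imp_continuous_on differentiable_imp_continuous_within)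
next
  case (Suc k)
  then show ?case by (metis Ck_on.simps(2))
qed

lemma Ck_on_Un:
  assumes "open U" "open V" "Ck_on k f U" "Ck_on k f V"
  shows "Ck_on k f (U \<union> V)"
  using assms(3,4) by (induction k arbitrary: f) (use assms(1,2) continuous_on_open_Un in auto)

lemma Ck_on_const: "Ck_on k (\<lambda>x. c) U"
  by (induction k arbitrary: c) (auto simp: frechet_derivative_const)

lemma frechet_derivative_add_at:
  assumes "f differentiable (at x)" "g differentiable (at x)"
  shows "frechet_derivative (\<lambda>x. f x + g x) (at x) v
    = frechet_derivative f (at x) v + frechet_derivative g (at x) v"
proof -
  have "((\<lambda>x. f x + g x) has_derivative
      (\<lambda>v. frechet_derivative f (at x) v + frechet_derivative g (at x) v)) (at x)"
    using assms by (intro has_derivative_add) (auto simp: frechet_derivative_works)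
  from fun_cong[OF frechet_derivative_at[OF this]] show ?thesis by simp
qed

lemma Ck_on_add:
  assumes "open U" "Ck_on k f U" "Ck_on k g U"
  shows "Ck_on k (\<lambda>x. f x + g x) U"
  using assms(2,3)
proof (induction k arbitrary: f g)
  case 0
  then show ?case by (auto intro: continuous_intros)
next
  case (Suc k)
  have "Ck_on k (\<lambda>x. frechet_derivative (\<lambda>x. f x + g x) (at x) v) U" for v
    by (rule Ck_on_cong[OF assms(1) _ Suc.IH[of "\<lambda>x. frechet_derivative f (at x) v"
        "\<lambda>x. frechet_derivative g (at x) v"]])
      (use Suc.prems in \<open>auto simp: frechet_derivative_add_at\<close>)
  with Suc.prems show ?case by auto
qed

lemma frechet_derivative_mult_at:
  fixes f g :: "'a::euclidean_space \<Rightarrow> real"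
  assumes "f differentiable (at x)" "g differentiable (at x)"
  shows "frechet_derivative (\<lambda>x. f x * g x) (at x) v
    = f x * frechet_derivative g (at x) v + frechet_derivative f (at x) v * g x"
proof -
  have "((\<lambda>x. f x * g x) has_derivative
      (\<lambda>v. f x * frechet_derivative g (at x) v + frechet_derivative f (at x) v * g x)) (at x)"
    using assms by (intro has_derivative_mult) (auto simp: frechet_derivative_works)
  from fun_cong[OF frechet_derivative_at[OF this]] show ?thesis by simp
qed

lemma Ck_on_mult:
  assumes "open U" "Ck_on k f U" "Ck_on k g U"
  shows "Ck_on k (\<lambda>x. f x * g x) U"
  using assms(2,3)
proof (induction k arbitrary: f g)
  case 0
  then show ?case by (auto intro: continuous_intros)
next
  case (Suc k)
  have "Ck_on k (\<lambda>x. f x * frechet_derivative g (at x) v + frechet_derivative f (at x) v * g x) U" for v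
    using Suc.prems Ck_on_Suc by (intro Ck_on_add assms(1) Suc.IH) auto
  then have "Ck_on k (\<lambda>x. frechet_derivative (\<lambda>x. f x * g x) (at x) v) U" for v
    by (rule Ck_on_cong[OF assms(1), rotated])
      (use Suc.prems in \<open>auto simp: frechet_derivative_mult_at\<close>)
  with Suc.prems show ?case by auto
qed

lemma frechet_derivative_compose_real:
  assumes "f differentiable (at x)" "(h has_real_derivative d) (at (f x))"
  shows "frechet_derivative (\<lambda>x. h (f x)) (at x) v = d * frechet_derivative f (at x) v"
    and "(\<lambda>x. h (f x)) differentiable (at x)"
proof -
  have "((\<lambda>x. h (f x)) has_derivative (\<lambda>v. d * frechet_derivative f (at x) v)) (at x)"
    using has_derivative_compose[of f "frechet_derivative f (at x)" x UNIV h "(*) d"] assms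
    by (auto simp: frechet_derivative_works has_field_derivative_def)
  from fun_cong[OF frechet_derivative_at[OF this], of v] differentiableI[OF this]
  show "frechet_derivative (\<lambda>x. h (f x)) (at x) v = d * frechet_derivative f (at x) v"
    and "(\<lambda>x. h (f x)) differentiable (at x)" by simp_all
qed

text \<open>The family \<open>h\<close> lists the successive derivatives of \<open>h 0\<close>. The
  chain rule leaves a product whose first factor starts the shifted family, to which the induction
  hypothesis applies.\<close>

lemma Ck_on_compose_real:
  assumes "open U" "Ck_on k f U" "\<And>i t. i < k \<Longrightarrow> (h i has_real_derivative h (Suc i) t) (at t)"
    "continuous_on UNIV (h k)"
  shows "Ck_on k (\<lambda>x. h 0 (f x)) U"
  using assms(2-4)
proof (induction k arbitrary: h)
  case 0
  then show ?case using continuous_on_compose2[of UNIV "h 0" U f] by auto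
next
  case (Suc k)
  have "Ck_on k (\<lambda>x. (\<lambda>i. h (Suc i)) 0 (f x) * frechet_derivative f (at x) v) U" for v
    using Suc.prems Ck_on_Suc[OF Suc.prems(1)]
    by (intro Ck_on_mult assms(1) Suc.IH[of "\<lambda>i. h (Suc i)"]) auto
  moreover have "frechet_derivative (\<lambda>x. h 0 (f x)) (at x) v = h 1 (f x) * frechet_derivative f (at x) v"
    "(\<lambda>x. h 0 (f x)) differentiable (at x)" if "x \<in> U" for x v
    using frechet_derivative_compose_real[of f x "h 0" "h 1 (f x)"] that Suc.prems by auto
  ultimately show ?case
    by (auto intro: Ck_on_cong[OF assms(1), of "\<lambda>x. h 1 (f x) * frechet_derivative f (at x) _"])
qed

lemma Ck_on_2_compose_real:
  assumes "open U" "Ck_on 2 f U" "\<And>t. (h has_real_derivative h' t) (at t)"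
    "\<And>t. (h' has_real_derivative h'' t) (at t)" "continuous_on UNIV h''"
  shows "Ck_on 2 (\<lambda>x. h (f x)) U"
proof -
  define F where "F i = (if i = 0 then h else if i = 1 then h' else h'')" for i :: nat
  have "(F i has_real_derivative F (Suc i) t) (at t)" if i: "i < 2" for i t
  proof -
    consider "i = 0" | "i = 1" using i by linarith
    then show ?thesis by cases (simp_all add: F_def assms(3,4))
  qed
  moreover have "continuous_on UNIV (F 2)" using assms(5) by (simp add: F_def)
  ultimately have "Ck_on 2 (\<lambda>x. F 0 (f x)) U" by (rule Ck_on_compose_real[of U 2 f F, OF assms(1,2)])
  then show ?thesis by (simp add: F_def)
qed

lemma Ck_on_inner: "Ck_on k (\<lambda>x. c * inner (x - p) v + b) U"
proof (cases k)
  case 0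
  then show ?thesis by (auto intro!: continuous_intros)
next
  case (Suc k')
  have *: "((\<lambda>x. c * inner (x - p) v + b) has_derivative (\<lambda>w. c * inner w v)) (at x)" for x
    by (auto intro!: derivative_eq_intros)
  have "frechet_derivative (\<lambda>x. c * inner (x - p) v + b) (at x) = (\<lambda>w. c * inner w v)" for x
    by (rule frechet_derivative_at[OF *, symmetric])
  then show ?thesis using * by (auto simp: Suc Ck_on_const differentiable_def)
qed

lemma Ck_on_norm_squared: "Ck_on k (\<lambda>x. (norm (x - p))\<^sup>2) U"
proof (cases k)
  case 0
  then show ?thesis by (auto intro!: continuous_intros)
next
  case (Suc k')
  have *: "((\<lambda>x. (norm (x - p))\<^sup>2) has_derivative (\<lambda>w. 2 * inner (x - p) w + 0)) (at x)" for x
    unfolding power2_norm_eq_inner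
    by (auto intro!: derivative_eq_intros simp: inner_commute)
  have "frechet_derivative (\<lambda>x. (norm (x - p))\<^sup>2) (at x) = (\<lambda>w. 2 * inner (x - p) w + 0)" for x
    by (rule frechet_derivative_at[OF *, symmetric])
  then show ?thesis using * Ck_on_inner[of k' 2 p _ 0 U] by (auto simp: Suc differentiable_def)
qed

section \<open>First and second directional derivatives\<close>

definition D1 :: "('a::euclidean_space \<Rightarrow> real) \<Rightarrow> 'a \<Rightarrow> 'a \<Rightarrow> real" where
  "D1 f z v = frechet_derivative f (at z) v"

definition D2 :: "('a::euclidean_space \<Rightarrow> real) \<Rightarrow> 'a \<Rightarrow> 'a \<Rightarrow> 'a \<Rightarrow> real" where
  "D2 f z v w = D1 (\<lambda>x. D1 f x v) z w"

lemma Ck_on_2_iff: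
  "Ck_on 2 f U \<longleftrightarrow> (\<forall>x\<in>U. f differentiable (at x)) \<and>
    (\<forall>v. \<forall>x\<in>U. (\<lambda>x. D1 f x v) differentiable (at x)) \<and>
    (\<forall>v w. continuous_on U (\<lambda>x. D2 f x v w))"
  by (auto simp: numeral_2_eq_2 D1_def D2_def)

lemma D1_eqI: "(f has_derivative f') (at z) \<Longrightarrow> D1 f z v = f' v"
  unfolding D1_def by (simp add: frechet_derivative_at[symmetric])

lemma D1_has_derivative: "f differentiable (at z) \<Longrightarrow> (f has_derivative D1 f z) (at z)"
  unfolding D1_def by (simp add: frechet_derivative_works[symmetric] eta_contract_eq)

lemma D1_cong:
  assumes "f differentiable (at z)" "open U" "z \<in> U" "\<And>x. x \<in> U \<Longrightarrow> f x = g x"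
  shows "D1 f z v = D1 g z v"
  unfolding D1_def using frechet_derivative_transform_within_open[of f z U g] assms by simp

lemma D1_add: "f differentiable (at z) \<Longrightarrow> g differentiable (at z) \<Longrightarrow>
    D1 (\<lambda>x. f x + g x) z v = D1 f z v + D1 g z v"
  by (rule D1_eqI) (intro has_derivative_add D1_has_derivative)

lemma D1_mult: "f differentiable (at z) \<Longrightarrow> g differentiable (at z) \<Longrightarrow>
    D1 (\<lambda>x. f x * g x) z v = f z * D1 g z v + D1 f z v * g z"
  unfolding D1_def by (rule frechet_derivative_mult_at)

lemma D1_compose:
  "f differentiable (at z) \<Longrightarrow> (h has_real_derivative d) (at (f z)) \<Longrightarrow>
    D1 (\<lambda>x. h (f x)) z v = d * D1 f z v"
  unfolding D1_def by (rule frechet_derivative_compose_real)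

lemma D1_linear: "f differentiable (at z) \<Longrightarrow> linear (D1 f z)"
  using D1_has_derivative has_derivative_linear by blast

lemma D1_expand:
  assumes "f differentiable (at z)"
  shows "D1 f z v = (\<Sum>b\<in>Basis. inner v b * D1 f z b)"
proof -
  have "D1 f z v = D1 f z (\<Sum>b\<in>Basis. inner v b *\<^sub>R b)" by (simp add: euclidean_representation)
  also have "\<dots> = (\<Sum>b\<in>Basis. inner v b * D1 f z b)"
    using D1_linear[OF assms] by (simp add: linear_sum linear_scale)
  finally show ?thesis .
qed

lemma D2_linear_right:
  assumes "Ck_on 2 f U" "z \<in> U"
  shows "linear (D2 f z v)"
  unfolding D2_def using D1_linear[of "\<lambda>x. D1 f x v" z] assms by (auto simp: Ck_on_2_iff)

lemma D2_linear_left: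
  assumes "Ck_on 2 f U" "open U" "z \<in> U"
  shows "linear (\<lambda>v. D2 f z v w)"
proof (rule linearI)
  note C = assms(1)[unfolded Ck_on_2_iff]
  have lin: "linear (D1 f x)" if "x \<in> U" for x using C that D1_linear by blast
  show "D2 f z (v + v') w = D2 f z v w + D2 f z v' w" for v v'
  proof -
    have "D2 f z (v + v') w = D1 (\<lambda>x. D1 f x v + D1 f x v') z w"
      unfolding D2_def by (rule D1_cong[OF _ assms(2,3)]) (use C assms(3) linear_add[OF lin] in auto)
    then show ?thesis using C assms(3) by (simp add: D2_def D1_add)
  qed
  show "D2 f z (c *\<^sub>R v) w = c *\<^sub>R D2 f z v w" for c v
  proof -
    have "D2 f z (c *\<^sub>R v) w = D1 (\<lambda>x. c * D1 f x v) z w"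
      unfolding D2_def by (rule D1_cong[OF _ assms(2,3)]) (use C assms(3) linear_scale[OF lin] in auto)
    also have "\<dots> = c * D1 (\<lambda>x. D1 f x v) z w"
      by (rule D1_compose) (use C assms(3) in \<open>auto intro!: derivative_eq_intros\<close>)
    finally show ?thesis by (simp add: D2_def)
  qed
qed

lemma D2_expand:
  assumes "Ck_on 2 f U" "open U" "z \<in> U"
  shows "D2 f z v w = (\<Sum>b\<in>Basis. \<Sum>c\<in>Basis. inner v b * inner w c * D2 f z b c)"
proof -
  have "D2 f z v w = D2 f z (\<Sum>b\<in>Basis. inner v b *\<^sub>R b) w" by (simp add: euclidean_representation)
  also have "\<dots> = (\<Sum>b\<in>Basis. inner v b * D2 f z b w)"
    by (simp only: linear_sum[OF D2_linear_left[OF assms, of w]]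
        linear_scale[OF D2_linear_left[OF assms, of w]] real_scaleR_def)
  also have "\<dots> = (\<Sum>b\<in>Basis. inner v b * (\<Sum>c\<in>Basis. inner w c * D2 f z b c))"
    unfolding D2_def using assms by (subst D1_expand) (auto simp: Ck_on_2_iff)
  finally show ?thesis by (simp add: sum_distrib_left mult.assoc)
qed

text \<open>\<open>Ck_on\<close> gives continuity in the point for each fixed direction. Expanding
  the direction in the basis makes it joint, as arguments by compactness over frames
  require.\<close>

lemma continuous_on_D1:
  assumes "Ck_on 2 f U" "continuous_on S g" "continuous_on S h" "g ` S \<subseteq> U"
  shows "continuous_on S (\<lambda>s. D1 f (g s) (h s))"
proof -
  have "continuous_on U (\<lambda>x. D1 f x b)" for b
    using assms(1) unfolding Ck_on_2_iff
    by (auto intro!: continuous_at_imp_continuous_on differentiable_imp_continuous_within)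
  then have "continuous_on S (\<lambda>s. D1 f (g s) b)" for b
    using continuous_on_compose2[OF _ assms(2,4)] by blast
  then have "continuous_on S (\<lambda>s. \<Sum>b\<in>Basis. inner (h s) b * D1 f (g s) b)"
    by (intro continuous_intros assms)
  then show ?thesis
    by (rule continuous_on_eq) (use assms in \<open>auto simp: Ck_on_2_iff intro!: D1_expand[symmetric]\<close>)
qed

lemma continuous_on_D2:
  assumes "Ck_on 2 f U" "open U" "continuous_on S g" "continuous_on S h" "continuous_on S k" "g ` S \<subseteq> U"
  shows "continuous_on S (\<lambda>s. D2 f (g s) (h s) (k s))"
proof -
  have "continuous_on U (\<lambda>x. D2 f x b c)" for b c
    using assms(1) by (simp add: Ck_on_2_iff)
  then have "continuous_on S (\<lambda>s. D2 f (g s) b c)" for b c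
    using continuous_on_compose2[OF _ assms(3,6)] by blast
  then have "continuous_on S (\<lambda>s. \<Sum>b\<in>Basis. \<Sum>c\<in>Basis. inner (h s) b * inner (k s) c * D2 f (g s) b c)"
    by (intro continuous_intros assms)
  then show ?thesis
    by (rule continuous_on_eq) (use assms in \<open>auto intro!: D2_expand[OF assms(1,2), symmetric]\<close>)
qed

text \<open>Both mixed derivatives are values of the same second difference quotient.\<close>

lemma second_difference_eq_D2:
  assumes C: "Ck_on 2 f U" and h: "h > 0"
    and U: "\<And>s t. 0 \<le> s \<Longrightarrow> s \<le> h \<Longrightarrow> 0 \<le> t \<Longrightarrow> t \<le> h \<Longrightarrow> z + s *\<^sub>R v + t *\<^sub>R w \<in> U"
  shows "\<exists>s t. 0 \<le> s \<and> s \<le> h \<and> 0 \<le> t \<and> t \<le> h \<and>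
    f (z + h *\<^sub>R v + h *\<^sub>R w) - f (z + h *\<^sub>R v) - f (z + h *\<^sub>R w) + f z
      = h\<^sup>2 * D2 f (z + s *\<^sub>R v + t *\<^sub>R w) v w"
proof -
  note C' = C[unfolded Ck_on_2_iff]
  define g where "g s = f (z + s *\<^sub>R v + h *\<^sub>R w) - f (z + s *\<^sub>R v)" for s
  have chain: "((\<lambda>s. F (a + s *\<^sub>R b)) has_real_derivative D1 F (a + s *\<^sub>R b) b) (at s)"
    if "F differentiable (at (a + s *\<^sub>R b))" for F :: "'a \<Rightarrow> real" and a b s
  proof -
    have "((\<lambda>s. F (a + s *\<^sub>R b)) has_derivative (\<lambda>x. D1 F (a + s *\<^sub>R b) (x *\<^sub>R b))) (at s)"
      by (rule has_derivative_compose[of "\<lambda>s. a + s *\<^sub>R b" _ s UNIV F])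
        (auto intro!: derivative_eq_intros D1_has_derivative that)
    moreover have "D1 F (a + s *\<^sub>R b) (x *\<^sub>R b) = D1 F (a + s *\<^sub>R b) b * x" for x
      using D1_linear[OF that] by (simp add: linear_scale)
    ultimately show ?thesis by (simp add: has_field_derivative_def)
  qed
  have "\<exists>s. 0 < s \<and> s < h \<and> g h - g 0 = (h - 0) *
      (D1 f (z + s *\<^sub>R v + h *\<^sub>R w) v - D1 f (z + s *\<^sub>R v) v)"
  proof (rule MVT2[OF h])
    fix s assume s: "0 \<le> s" "s \<le> h"
    have "z + h *\<^sub>R w + s *\<^sub>R v \<in> U" "z + s *\<^sub>R v \<in> U"
      using U[OF s, of h] U[OF s, of 0] h by (simp_all add: algebra_simps)
    then show "(g has_real_derivative D1 f (z + s *\<^sub>R v + h *\<^sub>R w) v - D1 f (z + s *\<^sub>R v) v) (at s)"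
      unfolding g_def using chain[of f "z + h *\<^sub>R w" s v] chain[of f z s v] C'
      by (auto intro!: derivative_eq_intros simp: algebra_simps)
  qed
  then obtain s where s: "0 < s" "s < h"
    and gs: "g h - g 0 = h * (D1 f (z + s *\<^sub>R v + h *\<^sub>R w) v - D1 f (z + s *\<^sub>R v) v)" by auto
  have "\<exists>t. 0 < t \<and> t < h \<and>
      D1 f (z + s *\<^sub>R v + h *\<^sub>R w) v - D1 f (z + s *\<^sub>R v + 0 *\<^sub>R w) v
        = (h - 0) * D2 f (z + s *\<^sub>R v + t *\<^sub>R w) v w"
  proof (rule MVT2[OF h])
    fix t assume t: "0 \<le> t" "t \<le> h"
    have "z + s *\<^sub>R v + t *\<^sub>R w \<in> U" using U t s by simp
    then show "((\<lambda>t. D1 f (z + s *\<^sub>R v + t *\<^sub>R w) v) has_real_derivative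
        D2 f (z + s *\<^sub>R v + t *\<^sub>R w) v w) (at t)"
      unfolding D2_def using chain[of "\<lambda>x. D1 f x v" "z + s *\<^sub>R v" t w] C' by auto
  qed
  then obtain t where t: "0 < t" "t < h"
    and "D1 f (z + s *\<^sub>R v + h *\<^sub>R w) v - D1 f (z + s *\<^sub>R v) v = h * D2 f (z + s *\<^sub>R v + t *\<^sub>R w) v w"
    by auto
  with gs have "g h - g 0 = h\<^sup>2 * D2 f (z + s *\<^sub>R v + t *\<^sub>R w) v w"
    by (simp add: power2_eq_square)
  then show ?thesis using s t by (intro exI[of _ s] exI[of _ t]) (simp add: g_def)
qed

lemma D2_commute:
  assumes C: "Ck_on 2 f U" and "open U" "z \<in> U"
  shows "D2 f z v w = D2 f z w v"
proof (rule ccontr)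
  assume ne: "D2 f z v w \<noteq> D2 f z w v"
  \<comment> \<open>Half the gap: the equal values found at two nearby points cannot lie within
    \<epsilon> of both derivatives.\<close>
  define \<epsilon> where "\<epsilon> = \<bar>D2 f z v w - D2 f z w v\<bar> / 2"
  have e: "\<epsilon> > 0" using ne by (simp add: \<epsilon>_def)
  have "\<exists>d>0. \<forall>x. dist x z < d \<longrightarrow> x \<in> U \<and> \<bar>D2 f x v w - D2 f z v w\<bar> < \<epsilon>" for v w
  proof -
    have "continuous (at z) (\<lambda>x. D2 f x v w)"
      using C assms(2,3) by (simp add: Ck_on_2_iff continuous_on_eq_continuous_at)
    then obtain d1 where d1: "d1 > 0" "\<And>x. dist x z < d1 \<Longrightarrow> \<bar>D2 f x v w - D2 f z v w\<bar> < \<epsilon>"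
      using e unfolding continuous_at_eps_delta dist_real_def by blast
    obtain d2 where "d2 > 0" "ball z d2 \<subseteq> U" using assms(2,3) open_contains_ball by blast
    then show ?thesis using d1 by (intro exI[of _ "min d1 d2"]) (auto simp: dist_commute)
  qed
  then obtain d1 d2 where d: "d1 > 0" "d2 > 0"
    "\<And>x. dist x z < d1 \<Longrightarrow> x \<in> U \<and> \<bar>D2 f x v w - D2 f z v w\<bar> < \<epsilon>"
    "\<And>x. dist x z < d2 \<Longrightarrow> x \<in> U \<and> \<bar>D2 f x w v - D2 f z w v\<bar> < \<epsilon>" by metis
  \<comment> \<open>Small enough for the whole parallelogram spanned by h v and h w at z to stay in
    both neighborhoods.\<close>
  define h where "h = min d1 d2 / (norm v + norm w + 1)"
  have n: "norm v + norm w + 1 > 0" using norm_ge_zero[of v] norm_ge_zero[of w] by linarith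
  then have h: "h > 0" using d by (simp add: h_def)
  have near: "dist (z + s *\<^sub>R v + t *\<^sub>R w) z < min d1 d2"
    if "0 \<le> s" "s \<le> h" "0 \<le> t" "t \<le> h" for s t
  proof -
    have "dist (z + s *\<^sub>R v + t *\<^sub>R w) z = norm (s *\<^sub>R v + t *\<^sub>R w)" by (simp add: dist_norm)
    also have "\<dots> \<le> s * norm v + t * norm w"
      using norm_triangle_ineq[of "s *\<^sub>R v" "t *\<^sub>R w"] that by simp
    also have "\<dots> \<le> h * norm v + h * norm w" using that by (intro add_mono mult_right_mono) auto
    also have "\<dots> < h * (norm v + norm w + 1)" using h by (simp add: algebra_simps)
    also have "\<dots> = min d1 d2" using n by (simp add: h_def)
    finally show ?thesis .
  qed
  have near': "dist (z + t *\<^sub>R w + s *\<^sub>R v) z < min d1 d2"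
    if "0 \<le> s" "s \<le> h" "0 \<le> t" "t \<le> h" for s t
    using near[OF that] by (simp add: add.commute add.left_commute)
  obtain s t where st: "0 \<le> s" "s \<le> h" "0 \<le> t" "t \<le> h"
    "f (z + h *\<^sub>R v + h *\<^sub>R w) - f (z + h *\<^sub>R v) - f (z + h *\<^sub>R w) + f z
      = h\<^sup>2 * D2 f (z + s *\<^sub>R v + t *\<^sub>R w) v w"
    using second_difference_eq_D2[OF C h, of z v w] near d(3) by fastforce
  obtain s' t' where st': "0 \<le> s'" "s' \<le> h" "0 \<le> t'" "t' \<le> h"
    "f (z + h *\<^sub>R w + h *\<^sub>R v) - f (z + h *\<^sub>R w) - f (z + h *\<^sub>R v) + f z
      = h\<^sup>2 * D2 f (z + t' *\<^sub>R w + s' *\<^sub>R v) w v"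
    using second_difference_eq_D2[OF C h, of z w v] near' d(3) by fastforce
  have "h\<^sup>2 * D2 f (z + s *\<^sub>R v + t *\<^sub>R w) v w = h\<^sup>2 * D2 f (z + t' *\<^sub>R w + s' *\<^sub>R v) w v"
    using st(5) st'(5) by (simp add: algebra_simps)
  then have "D2 f (z + s *\<^sub>R v + t *\<^sub>R w) v w = D2 f (z + t' *\<^sub>R w + s' *\<^sub>R v) w v" using h by simp
  moreover have "\<bar>D2 f (z + s *\<^sub>R v + t *\<^sub>R w) v w - D2 f z v w\<bar> < \<epsilon>"
    using d(3) near[OF st(1-4)] by simp
  moreover have "\<bar>D2 f (z + t' *\<^sub>R w + s' *\<^sub>R v) w v - D2 f z w v\<bar> < \<epsilon>"
    using d(4) near'[OF st'(1-4)] by simp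
  ultimately show False unfolding \<epsilon>_def by (simp add: abs_if split: if_splits)
qed

lemma Ck_on_2D:
  assumes "Ck_on 2 f U" "z \<in> U"
  shows "f differentiable (at z)" "(\<lambda>x. D1 f x v) differentiable (at z)"
  using assms by (auto simp: Ck_on_2_iff)

lemma D2_add:
  assumes "open U" "Ck_on 2 f U" "Ck_on 2 g U" "z \<in> U"
  shows "D2 (\<lambda>x. f x + g x) z v w = D2 f z v w + D2 g z v w"
proof -
  have "D2 (\<lambda>x. f x + g x) z v w = D1 (\<lambda>x. D1 f x v + D1 g x v) z w"
    unfolding D2_def
    by (rule D1_cong[OF _ assms(1,4)])
      (use assms Ck_on_2D(2)[OF Ck_on_add[OF assms(1-3)]] in \<open>auto simp: Ck_on_2_iff D1_add\<close>)
  also have "\<dots> = D2 f z v w + D2 g z v w"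
    unfolding D2_def using assms by (intro D1_add) (auto simp: Ck_on_2_iff)
  finally show ?thesis .
qed

lemma D2_mult:
  assumes "open U" "Ck_on 2 f U" "Ck_on 2 g U" "z \<in> U"
  shows "D2 (\<lambda>x. f x * g x) z v w
    = f z * D2 g z v w + D1 f z w * D1 g z v + D1 f z v * D1 g z w + D2 f z v w * g z"
proof -
  have "D2 (\<lambda>x. f x * g x) z v w = D1 (\<lambda>x. f x * D1 g x v + D1 f x v * g x) z w"
    unfolding D2_def
    by (rule D1_cong[OF _ assms(1,4)])
      (use assms Ck_on_2D(2)[OF Ck_on_mult[OF assms(1-3)]] in \<open>auto simp: Ck_on_2_iff D1_mult\<close>)
  also have "\<dots> = f z * D2 g z v w + D1 f z w * D1 g z v + D1 f z v * D1 g z w + D2 f z v w * g z"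
    unfolding D2_def using Ck_on_2D[OF assms(2,4)] Ck_on_2D[OF assms(3,4)]
    by (simp add: D1_add D1_mult algebra_simps)
  finally show ?thesis .
qed

lemma D2_compose:
  assumes "open U" "Ck_on 2 f U" "z \<in> U" "\<And>t. (h has_real_derivative h' t) (at t)"
    "\<And>t. (h' has_real_derivative h'' t) (at t)" "continuous_on UNIV h''"
  shows "D2 (\<lambda>x. h (f x)) z v w = h'' (f z) * D1 f z v * D1 f z w + h' (f z) * D2 f z v w"
proof -
  have "D2 (\<lambda>x. h (f x)) z v w = D1 (\<lambda>x. h' (f x) * D1 f x v) z w"
    unfolding D2_def
    by (rule D1_cong[OF _ assms(1,3)])
      (use assms Ck_on_2D(2)[OF Ck_on_2_compose_real[OF assms(1,2,4-6)]] in
        \<open>auto simp: Ck_on_2_iff intro!: D1_compose\<close>)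
  also have "\<dots> = h' (f z) * D1 (\<lambda>x. D1 f x v) z w + D1 (\<lambda>x. h' (f x)) z w * D1 f z v"
    using Ck_on_2D[OF assms(2,3)] frechet_derivative_compose_real(2)[OF _ assms(5)]
    by (intro D1_mult) auto
  also have "D1 (\<lambda>x. h' (f x)) z w = h'' (f z) * D1 f z w"
    using Ck_on_2D[OF assms(2,3)] assms(5) by (intro D1_compose) auto
  finally show ?thesis by (simp add: D2_def mult_ac)
qed

lemma D1_const: "D1 (\<lambda>x. c) z v = 0"
  by (rule D1_eqI) (rule has_derivative_const)

lemma D2_const: "D2 (\<lambda>x. c) z v w = 0"
  by (simp add: D2_def D1_const)

lemma D2_cong:
  assumes "Ck_on 2 f U" "open U" "z \<in> U" "\<And>x. x \<in> U \<Longrightarrow> f x = g x"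
  shows "D2 f z v w = D2 g z v w"
  unfolding D2_def
  by (rule D1_cong[OF _ assms(2,3)]) (use assms in \<open>auto simp: Ck_on_2_iff intro: D1_cong\<close>)

subsection \<open>The Levi form and traces over frames\<close>

text \<open>A quarter of the Laplacian along the complex line through a, that is, the Levi form on
  the diagonal in real derivatives.\<close>

definition lev :: "(complex^'n \<Rightarrow> real) \<Rightarrow> complex^'n \<Rightarrow> complex^'n \<Rightarrow> real" where
  "lev f z a = (D2 f z a a + D2 f z (\<i> *s a) (\<i> *s a)) / 4"

text \<open>The off-diagonal Levi form, written before any symmetry of \<open>D2\<close> is known.
  The vector b comes first in \<open>D2\<close> because \<open>complex_hessian\<close>
  differentiates in the conjugate variable first.\<close>

definition levc :: "(complex^'n \<Rightarrow> real) \<Rightarrow> complex^'n \<Rightarrow> complex^'n \<Rightarrow> complex^'n \<Rightarrow> complex" where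
  "levc f z a b = (of_real (D2 f z b a) + of_real (D2 f z (\<i> *s b) (\<i> *s a))
     + \<i> * (of_real (D2 f z (\<i> *s b) a) - of_real (D2 f z b (\<i> *s a)))) / 4"

lemma vec_scale_axis: "c *s axis j x = axis j (c * x :: complex)"
  by (simp add: vec_eq_iff axis_def)

lemma vec_scale_decompose: "c *s a = Re c *\<^sub>R a + Im c *\<^sub>R (\<i> *s a)" for a :: "complex^'n"
  by (simp add: vec_eq_iff complex_eq_iff)

lemma complex_linear_sum_axis:
  fixes L :: "complex^'n \<Rightarrow> complex"
  assumes add: "\<And>a b. L (a + b) = L a + L b" and scale: "\<And>c a. L (c *s a) = c * L a"
  shows "L a = (\<Sum>j\<in>UNIV. a $ j * L (axis j 1))"
proof -
  have "L 0 = 0" using scale[of 0 0] by simp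
  then have sum: "L (\<Sum>j\<in>S. g j) = (\<Sum>j\<in>S. L (g j))" for S and g :: "'n \<Rightarrow> complex^'n"
    by (induction S rule: infinite_finite_induct) (simp_all add: add)
  have "L a = L (\<Sum>j\<in>UNIV. a $ j *s axis j 1)" by (simp add: basis_expansion)
  also have "\<dots> = (\<Sum>j\<in>UNIV. a $ j * L (axis j 1))" by (simp only: sum scale)
  finally show ?thesis .
qed

lemma frechet_derivative_of_real:
  assumes "f differentiable (at z)"
  shows "frechet_derivative (\<lambda>w. complex_of_real (f w)) (at z) v = of_real (D1 f z v)"
proof -
  have "((\<lambda>w. complex_of_real (f w)) has_derivative (\<lambda>v. of_real (D1 f z v))) (at z)"
    using D1_has_derivative[OF assms] by (intro has_derivative_of_real)
  from fun_cong[OF frechet_derivative_at[OF this]] show ?thesis by simp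
qed

text \<open>The left-hand side is the complex-linear part of the real differential of r, evaluated
  at a; the right-hand side is the usual projection onto that part.\<close>

lemma complex_gradient_sum:
  assumes "r differentiable (at p)"
  shows "(\<Sum>j\<in>UNIV. complex_gradient r p $ j * a $ j)
    = (of_real (D1 r p a) - \<i> * of_real (D1 r p (\<i> *s a))) / 2"
proof -
  note lin = D1_linear[OF assms]
  define L where "L a = (complex_of_real (D1 r p a) - \<i> * of_real (D1 r p (\<i> *s a))) / 2" for a
  have "L a = (\<Sum>j\<in>UNIV. a $ j * L (axis j 1))"
  proof (rule complex_linear_sum_axis)
    show "L (a + b) = L a + L b" for a b
      by (simp add: L_def vec.scale_right_distrib linear_add[OF lin] complex_eq_iff field_simps)
    show "L (c *s a) = c * L a" for c a
    proof -
      have 1: "D1 r p (c *s a) = Re c * D1 r p a + Im c * D1 r p (\<i> *s a)"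
        by (subst vec_scale_decompose) (simp add: linear_add[OF lin] linear_scale[OF lin])
      have "\<i> *s (c *s a) = Re c *\<^sub>R (\<i> *s a) - Im c *\<^sub>R a"
        by (simp add: vec_eq_iff complex_eq_iff)
      then have 2: "D1 r p (\<i> *s (c *s a)) = Re c * D1 r p (\<i> *s a) - Im c * D1 r p a"
        by (simp only: linear_diff[OF lin] linear_scale[OF lin] real_scaleR_def)
      show ?thesis unfolding L_def 1 2 by (simp add: complex_eq_iff)
    qed
  qed
  moreover have "complex_gradient r p $ j = L (axis j 1)" for j
    unfolding complex_gradient_def d_dz_def L_def
    by (simp add: frechet_derivative_of_real[OF assms] vec_scale_axis)
  ultimately have "(\<Sum>j\<in>UNIV. complex_gradient r p $ j * a $ j) = L a" by (simp add: mult.commute)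
  then show ?thesis by (simp only: L_def)
qed

lemma T10_iff:
  assumes "r differentiable (at p)"
  shows "a \<in> T10 r p \<longleftrightarrow> D1 r p a = 0 \<and> D1 r p (\<i> *s a) = 0"
  unfolding T10_def mem_Collect_eq complex_gradient_sum[OF assms] by (auto simp: complex_eq_iff)

lemma complex_hessian_levc:
  assumes "Ck_on 2 f U" "open U" "z \<in> U"
  shows "complex_hessian f z $ j $ k = levc f z (axis j 1) (axis k 1)"
proof -
  note C = assms(1)[unfolded Ck_on_2_iff]
  define g where "g w = (complex_of_real (D1 f w (axis k 1)) + \<i> * of_real (D1 f w (axis k \<i>))) / 2" for w
  have g: "d_dzbar k (\<lambda>w. complex_of_real (f w)) w = g w" if "w \<in> U" for w
    unfolding d_dzbar_def g_def using C that by (simp add: frechet_derivative_of_real)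
  define g' where "g' v = (complex_of_real (D2 f z (axis k 1) v) + \<i> * of_real (D2 f z (axis k \<i>) v)) / 2" for v
  have "((\<lambda>x. D1 f x v) has_derivative D2 f z v) (at z)" for v
    unfolding D2_def using C assms(3) D1_has_derivative by blast
  then have "(g has_derivative g') (at z)"
    unfolding g_def g'_def divide_inverse
    by (intro has_derivative_mult_left has_derivative_add has_derivative_mult_right has_derivative_of_real)
  then have "(d_dzbar k (\<lambda>w. complex_of_real (f w)) has_derivative g') (at z)"
    by (rule has_derivative_transform_within_open[OF _ assms(2,3)]) (simp add: g)
  then have "frechet_derivative (d_dzbar k (\<lambda>w. complex_of_real (f w))) (at z) = g'"
    by (rule frechet_derivative_at[symmetric])
  then have "complex_hessian f z $ j $ k = (g' (axis j 1) - \<i> * g' (axis j \<i>)) / 2"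
    by (simp add: complex_hessian_def d_dz_def[of j])
  then show ?thesis
    unfolding g'_def levc_def by (simp add: vec_scale_axis complex_eq_iff field_simps)
qed

text \<open>Both sides are sesquilinear, so agreement on the coordinate vectors, which is
  \<open>complex_hessian_levc\<close>, is enough.\<close>

lemma levi_form_levc:
  assumes "Ck_on 2 f U" "open U" "z \<in> U"
  shows "levi_form f z a b = levc f z a b"
proof -
  note ll = D2_linear_left[OF assms] and lr = D2_linear_right[OF assms(1,3)]
  have ii: "\<i> *s (c *s a) = Re c *\<^sub>R (\<i> *s a) - Im c *\<^sub>R a" for c and a :: "complex^'n"
    by (simp add: vec_eq_iff complex_eq_iff)
  have addl: "levc f z (a + a') b = levc f z a b + levc f z a' b" for a a' b
    by (simp add: levc_def vec.scale_right_distrib linear_add[OF lr] complex_eq_iff field_simps)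
  have scl: "levc f z (c *s a) b = c * levc f z a b" for c a b
  proof -
    have 1: "D2 f z v (c *s a) = Re c * D2 f z v a + Im c * D2 f z v (\<i> *s a)" for v
      by (subst vec_scale_decompose) (simp only: linear_add[OF lr] linear_scale[OF lr] real_scaleR_def)
    have 2: "D2 f z v (\<i> *s (c *s a)) = Re c * D2 f z v (\<i> *s a) - Im c * D2 f z v a" for v
      unfolding ii by (simp only: linear_diff[OF lr] linear_scale[OF lr] real_scaleR_def)
    show ?thesis unfolding levc_def 1 2 by (simp add: complex_eq_iff field_simps)
  qed
  have addr: "levc f z a (b + b') = levc f z a b + levc f z a b'" for a b b'
    by (simp add: levc_def vec.scale_right_distrib linear_add[OF ll] complex_eq_iff field_simps)
  have scr: "levc f z a (c *s b) = cnj c * levc f z a b" for c a b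
  proof -
    have 1: "D2 f z (c *s b) v = Re c * D2 f z b v + Im c * D2 f z (\<i> *s b) v" for v
      by (subst vec_scale_decompose) (simp only: linear_add[OF ll] linear_scale[OF ll] real_scaleR_def)
    have 2: "D2 f z (\<i> *s (c *s b)) v = Re c * D2 f z (\<i> *s b) v - Im c * D2 f z b v" for v
      unfolding ii by (simp only: linear_diff[OF ll] linear_scale[OF ll] real_scaleR_def)
    show ?thesis unfolding levc_def 1 2 by (simp add: complex_eq_iff field_simps)
  qed
  have r: "cnj (levc f z a b) = (\<Sum>k\<in>UNIV. b $ k * cnj (levc f z a (axis k 1)))" for a b
    by (rule complex_linear_sum_axis[of "\<lambda>b. cnj (levc f z a b)"]) (simp_all add: addr scr)
  have r': "levc f z a b = (\<Sum>k\<in>UNIV. cnj (b $ k) * levc f z a (axis k 1))" for a b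
    using arg_cong[OF r[of a b], of cnj] by simp
  have "levc f z a b = (\<Sum>j\<in>UNIV. a $ j * levc f z (axis j 1) b)"
    by (rule complex_linear_sum_axis) (simp_all add: addl scl)
  also have "\<dots> = (\<Sum>j\<in>UNIV. \<Sum>k\<in>UNIV. levc f z (axis j 1) (axis k 1) * a $ j * cnj (b $ k))"
    by (subst r') (simp add: sum_distrib_left mult_ac)
  finally show ?thesis by (simp add: levi_form_def complex_hessian_levc[OF assms])
qed

lemma levi_form_self:
  assumes "Ck_on 2 f U" "open U" "z \<in> U"
  shows "levi_form f z a a = of_real (lev f z a)"
  using D2_commute[OF assms, of "\<i> *s a" a]
  by (simp add: levi_form_levc[OF assms] levc_def lev_def)

lemma complex_hessian_hermitian:
  assumes "Ck_on 2 f U" "open U" "z \<in> U"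
  shows "complex_hessian f z $ k $ j = cnj (complex_hessian f z $ j $ k)"
  using D2_commute[OF assms]
  by (simp add: complex_hessian_levc[OF assms] levc_def vec_scale_axis complex_eq_iff)

lemma levi_form_hform: "levi_form f z a b = hform (complex_hessian f z) a b"
  by (simp add: levi_form_def hform_def)

section \<open>Property (P_q) in terms of traces over frames\<close>

definition lev_trace :: "'n set \<Rightarrow> (complex^'n \<Rightarrow> real) \<Rightarrow> complex^'n \<Rightarrow> complex^'n^'n \<Rightarrow> real" where
  "lev_trace J f z e = (\<Sum>j\<in>J. lev f z (e $ j))"

text \<open>The Hessian bound m and the range bound c are separate parameters because every gluing
  loses a little in both.\<close>

definition admits_lev :: "'n set \<Rightarrow> (complex^'n) set \<Rightarrow> real \<Rightarrow> real \<Rightarrow> bool" where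
  "admits_lev J X m c \<longleftrightarrow> (\<exists>U \<phi>. open U \<and> X \<subseteq> U \<and> Ck_on 2 \<phi> U \<and> \<phi> ` U \<subseteq> {0..c} \<and>
     (\<forall>z\<in>U. \<forall>e. frame J e \<longrightarrow> m \<le> lev_trace J \<phi> z e))"

lemma property_P_iff:
  "property_P (card J) X \<longleftrightarrow> compact X \<and> (\<forall>M>0. admits_lev J X M 1)"
proof -
  have "(\<forall>z\<in>U. M \<le> sum_list (take (card J) (hermitian_eigenvalues (complex_hessian \<phi> z)))) \<longleftrightarrow>
      (\<forall>z\<in>U. \<forall>e. frame J e \<longrightarrow> M \<le> lev_trace J \<phi> z e)"
    if C: "open U" "Ck_on 2 \<phi> U" for U \<phi> M
  proof (rule ball_cong[OF refl])
    fix z assume "z \<in> U"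
    note U = C(2,1) this
    have "(\<Sum>j\<in>J. Re (hform (complex_hessian \<phi> z) (e $ j) (e $ j))) = lev_trace J \<phi> z e" for e :: "complex^'a^'a"
      by (simp add: lev_trace_def levi_form_hform[symmetric] levi_form_self[OF U])
    then show "M \<le> sum_list (take (card J) (hermitian_eigenvalues (complex_hessian \<phi> z))) \<longleftrightarrow>
      (\<forall>e. frame J e \<longrightarrow> M \<le> lev_trace J \<phi> z e)"
      by (simp add: sum_smallest_eigenvalues_ge_iff[OF complex_hessian_hermitian[OF U]])
  qed
  then show ?thesis
    unfolding property_P_def admits_lev_def
    by (intro conj_cong refl all_cong1 imp_cong ex_cong1)
qed

lemma admits_lev_mono:
  assumes "admits_lev J X m c" "Y \<subseteq> X" "m' \<le> m" "c \<le> c'"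
  shows "admits_lev J Y m' c'"
proof -
  obtain U \<phi> where U: "open U" "X \<subseteq> U" "Ck_on 2 \<phi> U" "\<phi> ` U \<subseteq> {0..c}"
    "\<forall>z\<in>U. \<forall>e. frame J e \<longrightarrow> m \<le> lev_trace J \<phi> z e"
    using assms(1) unfolding admits_lev_def by (elim exE conjE)
  have "\<phi> ` U \<subseteq> {0..c'}" by (rule subset_trans[OF U(4)]) (simp add: assms(4))
  moreover have "\<forall>z\<in>U. \<forall>e. frame J e \<longrightarrow> m' \<le> lev_trace J \<phi> z e"
    using U(5) order_trans[OF assms(3)] by simp
  ultimately show ?thesis
    using U(1,3) subset_trans[OF assms(2) U(2)] unfolding admits_lev_def by (intro exI conjI)
qed

lemma property_P_subset: "property_P q X \<Longrightarrow> compact Y \<Longrightarrow> Y \<subseteq> X \<Longrightarrow> property_P q Y"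
  unfolding property_P_def by (meson order_trans)

lemma lev_trace_cong:
  assumes "Ck_on 2 f U" "open U" "z \<in> U" "\<And>x. x \<in> U \<Longrightarrow> f x = g x"
  shows "lev_trace J f z e = lev_trace J g z e"
  unfolding lev_trace_def lev_def using D2_cong[OF assms] by simp

lemma lev_trace_add:
  assumes "open U" "Ck_on 2 f U" "Ck_on 2 g U" "z \<in> U"
  shows "lev_trace J (\<lambda>x. f x + g x) z e = lev_trace J f z e + lev_trace J g z e"
  unfolding lev_trace_def lev_def D2_add[OF assms] by (simp add: sum.distrib[symmetric] algebra_simps add_divide_distrib)

lemma lev_trace_zero: "lev_trace J (\<lambda>x. c) z e = 0"
  by (simp add: lev_trace_def lev_def D2_const)

lemma D2_scale:
  assumes "open U" "Ck_on 2 f U" "z \<in> U"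
  shows "D2 (\<lambda>x. c * f x) z v w = c * D2 f z v w"
  using D2_mult[OF assms(1) Ck_on_const assms(2,3), of c v w] by (simp add: D2_const D1_const)

lemma lev_trace_scale:
  assumes "open U" "Ck_on 2 f U" "z \<in> U"
  shows "lev_trace J (\<lambda>x. c * f x) z e = c * lev_trace J f z e"
  unfolding lev_trace_def lev_def D2_scale[OF assms] by (simp add: sum_distrib_left algebra_simps)

lemma continuous_on_vec_scale [continuous_intros]:
  fixes f :: "'a::topological_space \<Rightarrow> complex^'n"
  assumes "continuous_on S f"
  shows "continuous_on S (\<lambda>x. c *s f x)"
  unfolding vector_scalar_mult_def using assms by (intro continuous_intros)

lemma continuous_on_lev_trace:
  assumes "Ck_on 2 f U" "open U" "continuous_on S g" "continuous_on S e" "g ` S \<subseteq> U"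
  shows "continuous_on S (\<lambda>s. lev_trace J f (g s) (e s))"
  unfolding lev_trace_def lev_def
  by (intro continuous_intros continuous_on_D2[OF assms(1,2)] assms) auto

text \<open>Frames normalized to be zero outside J: without the normalization the set would be
  unbounded for J smaller than the whole type.\<close>

definition frames :: "'n set \<Rightarrow> (complex^'m^'n) set" where
  "frames J = {e. frame J e \<and> (\<forall>j. j \<notin> J \<longrightarrow> e $ j = 0)}"

lemma compact_frames: "compact (frames J :: (complex^'m^'n::finite) set)"
proof -
  have "closed (frames J :: (complex^'m^'n) set)"
  proof -
    have eq: "frames J = (\<Inter>i\<in>J. \<Inter>j\<in>J. {e :: complex^'m^'n. cip (e $ i) (e $ j) = (if i = j then 1 else 0)})
        \<inter> (\<Inter>j\<in>-J. {e. e $ j = 0})"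
      by (simp only: set_eq_iff frames_def frame_def Int_iff INT_iff mem_Collect_eq Compl_iff) blast
    show ?thesis unfolding eq
      by (intro closed_Int closed_INT ballI closed_Collect_eq continuous_intros)
  qed
  moreover have "norm e \<le> CARD('n)" if "e \<in> frames J" for e :: "complex^'m^'n"
  proof -
    have "norm (e $ j) \<le> 1" for j
      using that frame_norm[of J e j] by (cases "j \<in> J") (simp_all add: frames_def)
    then have "(\<Sum>j\<in>UNIV. norm (e $ j)) \<le> (\<Sum>j\<in>(UNIV :: 'n set). 1)" by (intro sum_mono)
    then show ?thesis using L2_set_le_sum[of UNIV "\<lambda>j. norm (e $ j)"]
      unfolding norm_vec_def[of e] by simp
  qed
  then have "bounded (frames J :: (complex^'m^'n) set)" unfolding bounded_iff by blast
  ultimately show ?thesis using compact_eq_bounded_closed by blast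
qed

definition frame_trunc :: "'n set \<Rightarrow> complex^'m^'n \<Rightarrow> complex^'m^'n" where
  "frame_trunc J e = (\<chi> j. if j \<in> J then e $ j else 0)"

lemma frame_trunc: "frame J e \<Longrightarrow> frame_trunc J e \<in> frames J"
  and frame_trunc_nth: "j \<in> J \<Longrightarrow> frame_trunc J e $ j = e $ j"
  by (auto simp: frame_trunc_def frames_def frame_def)

lemma lev_trace_trunc: "lev_trace J f z (frame_trunc J e) = lev_trace J f z e"
  by (simp add: lev_trace_def frame_trunc_nth)

text \<open>Invariance under truncation carries the bound from the compact set
  \<open>K \<times> frames J\<close> to all frames.\<close>

lemma frames_bounded:
  fixes G :: "complex^'n \<Rightarrow> complex^'m^'k::finite \<Rightarrow> real"
  assumes "compact K" "continuous_on (K \<times> UNIV) (\<lambda>x. G (fst x) (snd x))"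
    and "\<And>z e. G z (frame_trunc J e) = G z e"
  obtains C where "C > 0" "\<And>z e. z \<in> K \<Longrightarrow> frame J e \<Longrightarrow> \<bar>G z e\<bar> \<le> C"
proof -
  have "compact (K \<times> (frames J :: (complex^'m^'k) set))"
    using assms(1) compact_frames by (rule compact_Times)
  then have "compact ((\<lambda>x. G (fst x) (snd x)) ` (K \<times> frames J))"
    by (intro compact_continuous_image continuous_on_subset[OF assms(2)]) auto
  from compact_imp_bounded[OF this] obtain C where C: "C > 0"
    and C': "\<forall>y\<in>(\<lambda>x. G (fst x) (snd x)) ` (K \<times> frames J). norm y \<le> C"
    unfolding bounded_pos by blast
  show ?thesis
  proof (rule that[OF C])
    fix z and e :: "complex^'m^'k" assume "z \<in> K" "frame J e"
    then have "(z, frame_trunc J e) \<in> K \<times> frames J" using frame_trunc[of J e] by simp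
    from C'[rule_format, OF imageI[OF this]] show "\<bar>G z e\<bar> \<le> C" using assms(3) by simp
  qed
qed

subsection \<open>Cutoff functions and gluing\<close>

lemma has_real_derivative_max_power:
  "((\<lambda>t. (max 0 t) ^ Suc (Suc n)) has_real_derivative real (Suc (Suc n)) * (max 0 t) ^ Suc n) (at t)"
proof -
  consider "t > 0" | "t < 0" | "t = 0" by linarith
  then show ?thesis
  proof cases
    case 1
    have "((\<lambda>t. t ^ Suc (Suc n)) has_real_derivative real (Suc (Suc n)) * t ^ Suc n) (at t)"
      using DERIV_pow[of "Suc (Suc n)" t] by (simp only: diff_Suc_Suc minus_nat.diff_0)
    then have "((\<lambda>t. (max 0 t) ^ Suc (Suc n)) has_real_derivative real (Suc (Suc n)) * t ^ Suc n) (at t)"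
      by (rule has_field_derivative_transform_within_open[of _ _ _ "{0<..}"]) (use 1 in auto)
    then show ?thesis using 1 by simp
  next
    case 2
    have "((\<lambda>t. 0) has_real_derivative 0) (at t)" by simp
    then have "((\<lambda>t. (max 0 t) ^ Suc (Suc n)) has_real_derivative 0) (at t)"
      by (rule has_field_derivative_transform_within_open[of _ _ _ "{..<0}"]) (use 2 in auto)
    then show ?thesis using 2 by simp
  next
    case 3
    have "((\<lambda>y. (max 0 y) ^ Suc n) \<longlongrightarrow> (max 0 0) ^ Suc n) (at (0::real))"
      by (intro tendsto_intros)
    moreover have "eventually (\<lambda>y :: real. (max 0 y) ^ Suc n
        = ((max 0 y) ^ Suc (Suc n) - (max 0 0) ^ Suc (Suc n)) / (y - 0)) (at 0)"
      by (rule eventually_at_ball'[of 1, THEN eventually_mono]) (auto simp: max_def)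
    ultimately have "((\<lambda>y. ((max 0 y) ^ Suc (Suc n) - (max 0 0) ^ Suc (Suc n)) / (y - 0)) \<longlongrightarrow> (max 0 0) ^ Suc n)
        (at (0::real))"
      by (rule Lim_transform_eventually)
    then show ?thesis using 3 by (simp add: has_field_derivative_iff)
  qed
qed

text \<open>The cube of the positive part is C^2, so cutoffs can be built from it and
  polynomials.\<close>

lemma Ck_on_2_max_cube:
  assumes "open U" "Ck_on 2 f U"
  shows "Ck_on 2 (\<lambda>x. (max 0 (f x)) ^ 3) U"
proof (rule Ck_on_2_compose_real[OF assms, of "\<lambda>t. (max 0 t) ^ 3" "\<lambda>t. 3 * (max 0 t)\<^sup>2" "\<lambda>t. 6 * max 0 t"])
  show "((\<lambda>t. (max 0 t) ^ 3) has_real_derivative 3 * (max 0 t)\<^sup>2) (at t)" for t :: real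
    using has_real_derivative_max_power[of 1 t] by (simp add: numeral_3_eq_3 numeral_2_eq_2)
  show "((\<lambda>t. 3 * (max 0 t)\<^sup>2) has_real_derivative 6 * max 0 t) (at t)" for t :: real
    using DERIV_cmult[OF has_real_derivative_max_power[of 0 t], of 3] by (simp add: numeral_2_eq_2)
  show "continuous_on UNIV (\<lambda>t :: real. 6 * max 0 t)" by (intro continuous_intros)
qed

lemma Ck_on_affine:
  assumes "open U" "Ck_on k f U"
  shows "Ck_on k (\<lambda>x. a * f x + b) U"
  by (intro Ck_on_add Ck_on_mult Ck_on_const assms)

lemma bump_exists:
  fixes p :: "'a::euclidean_space"
  assumes "0 \<le> r" "r < R"
  obtains \<eta> where "Ck_on 2 \<eta> UNIV" "\<And>x. 0 \<le> \<eta> x" "\<And>x. \<eta> x \<le> 1"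
    "\<And>x. norm (x - p) \<le> r \<Longrightarrow> \<eta> x = 1" "\<And>x. R \<le> norm (x - p) \<Longrightarrow> \<eta> x = 0"
proof -
  \<comment> \<open>The quadratic g is at least 1 on the inner ball and at most 0 beyond the outer
    sphere. Applying t \<mapsto> 1 - max(0, t)^3 once gives h, with h \<le> 0 inside and h = 1
    outside. A second application restores the orientation and clamps the values to [0, 1].\<close>
  define d where "d = R\<^sup>2 - r\<^sup>2"
  have d: "d > 0" using assms by (simp add: d_def power_strict_mono)
  define g where "g x = (-1 / d) * (norm (x - p))\<^sup>2 + R\<^sup>2 / d" for x
  have g: "Ck_on 2 g UNIV" unfolding g_def by (intro Ck_on_affine Ck_on_norm_squared open_UNIV)
  define h where "h x = (-1) * (max 0 (g x)) ^ 3 + 1" for x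
  have h: "Ck_on 2 h UNIV" unfolding h_def by (intro Ck_on_affine Ck_on_2_max_cube g open_UNIV)
  define \<eta> where "\<eta> x = (-1) * (max 0 (h x)) ^ 3 + 1" for x
  have h1: "h x \<le> 1" for x by (simp add: h_def)
  show ?thesis
  proof (rule that[of \<eta>])
    show "Ck_on 2 \<eta> UNIV" unfolding \<eta>_def by (intro Ck_on_affine Ck_on_2_max_cube h open_UNIV)
    show "0 \<le> \<eta> x" for x using power_le_one[of "max 0 (h x)" 3] h1[of x] by (simp add: \<eta>_def)
    show "\<eta> x \<le> 1" for x by (simp add: \<eta>_def)
    show "\<eta> x = 1" if "norm (x - p) \<le> r" for x
    proof -
      have "(norm (x - p))\<^sup>2 \<le> r\<^sup>2" using that by (simp add: power_mono)
      then have "d \<le> R\<^sup>2 - (norm (x - p))\<^sup>2" by (simp add: d_def)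
      then have "1 \<le> (R\<^sup>2 - (norm (x - p))\<^sup>2) / d" using d by (simp add: le_divide_eq)
      then have "1 \<le> g x" by (simp add: g_def diff_divide_distrib)
      then have "1 \<le> (max 0 (g x)) ^ 3" by (simp add: one_le_power)
      then show ?thesis by (simp add: \<eta>_def h_def)
    qed
    show "\<eta> x = 0" if "R \<le> norm (x - p)" for x
    proof -
      have "R\<^sup>2 \<le> (norm (x - p))\<^sup>2" using that assms by (simp add: power_mono)
      then have "g x \<le> 0" using d unfolding g_def by (simp add: field_simps)
      then show ?thesis by (simp add: \<eta>_def h_def max_def)
    qed
  qed
qed

lemma cutoff_exists:
  fixes A :: "'a::euclidean_space set"
  assumes "compact A" "open U" "A \<subseteq> U"
  obtains \<rho> V S where "Ck_on 2 \<rho> UNIV" "\<And>x. 0 \<le> \<rho> x" "\<And>x. \<rho> x \<le> 1"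
    "open V" "A \<subseteq> V" "\<And>x. x \<in> V \<Longrightarrow> \<rho> x = 1" "closed S" "S \<subseteq> U" "\<And>x. x \<notin> S \<Longrightarrow> \<rho> x = 0"
proof -
  have "\<exists>r>0. cball x (2 * r) \<subseteq> U" if x: "x \<in> A" for x
  proof -
    obtain e where "e > 0" "cball x e \<subseteq> U" using x assms(2,3) open_contains_cball by blast
    then show ?thesis by (intro exI[of _ "e / 2"]) simp
  qed
  then obtain r where r: "\<And>x. x \<in> A \<Longrightarrow> r x > 0" "\<And>x. x \<in> A \<Longrightarrow> cball x (2 * r x) \<subseteq> U" by metis
  have cov: "A \<subseteq> (\<Union>x\<in>A. ball x (r x))" using r(1) by force
  obtain T where T: "T \<subseteq> A" "finite T" "A \<subseteq> (\<Union>x\<in>T. ball x (r x))"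
    by (rule compactE_image[OF assms(1), of A "\<lambda>x. ball x (r x)"]) (use cov in auto)
  have "\<exists>\<eta>. Ck_on 2 \<eta> UNIV \<and> (\<forall>x. 0 \<le> \<eta> x) \<and> (\<forall>x. \<eta> x \<le> 1) \<and>
      (\<forall>x. norm (x - p) \<le> r p \<longrightarrow> \<eta> x = 1) \<and> (\<forall>x. 2 * r p \<le> norm (x - p) \<longrightarrow> \<eta> x = 0)"
    if p: "p \<in> T" for p
  proof -
    have "0 \<le> r p" "r p < 2 * r p" using r(1)[of p] T(1) p by auto
    then show ?thesis by (rule bump_exists[of "r p" "2 * r p" p]) blast
  qed
  then have "\<exists>\<eta>. \<forall>p\<in>T. Ck_on 2 (\<eta> p) UNIV \<and> (\<forall>x. 0 \<le> \<eta> p x) \<and> (\<forall>x. \<eta> p x \<le> 1) \<and>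
      (\<forall>x. norm (x - p) \<le> r p \<longrightarrow> \<eta> p x = 1) \<and> (\<forall>x. 2 * r p \<le> norm (x - p) \<longrightarrow> \<eta> p x = 0)"
    by (intro bchoice ballI)
  then obtain \<eta> where \<eta>: "\<And>p. p \<in> T \<Longrightarrow> Ck_on 2 (\<eta> p) UNIV"
    "\<And>p x. p \<in> T \<Longrightarrow> 0 \<le> \<eta> p x" "\<And>p x. p \<in> T \<Longrightarrow> \<eta> p x \<le> 1"
    "\<And>p x. p \<in> T \<Longrightarrow> norm (x - p) \<le> r p \<Longrightarrow> \<eta> p x = 1"
    "\<And>p x. p \<in> T \<Longrightarrow> 2 * r p \<le> norm (x - p) \<Longrightarrow> \<eta> p x = 0" by blast
  \<comment> \<open>The complement 1 - P is 1 as soon as one bump is 1 and vanishes where all bumps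
    do, without leaving [0, 1].\<close>
  define P where "P x = (\<Prod>p\<in>T. 1 - \<eta> p x)" for x
  have "Ck_on 2 (\<lambda>x. \<Prod>p\<in>T'. 1 - \<eta> p x) UNIV" if "T' \<subseteq> T" for T'
    using finite_subset[OF that T(2)] that
  proof (induction T' rule: finite_induct)
    case empty
    then show ?case by (simp add: Ck_on_const)
  next
    case (insert p T')
    have "Ck_on 2 (\<lambda>x. ((-1) * \<eta> p x + 1) * (\<Prod>p\<in>T'. 1 - \<eta> p x)) UNIV"
      using insert.prems \<eta>(1)[of p] insert.IH by (intro Ck_on_mult Ck_on_affine open_UNIV) auto
    then show ?case using insert.hyps by simp
  qed
  from this[OF order_refl] have P: "Ck_on 2 P UNIV" unfolding P_def .
  have P01: "0 \<le> P x" "P x \<le> 1" for x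
    unfolding P_def using \<eta>(2,3) by (auto intro!: prod_nonneg prod_le_1)
  show ?thesis
  proof (rule that[of "\<lambda>x. (-1) * P x + 1" "\<Union>p\<in>T. ball p (r p)" "\<Union>p\<in>T. cball p (2 * r p)"])
    show "Ck_on 2 (\<lambda>x. (-1) * P x + 1) UNIV" by (rule Ck_on_affine[OF open_UNIV P])
    show "0 \<le> (-1) * P x + 1" "(-1) * P x + 1 \<le> 1" for x using P01[of x] by simp_all
    show "open (\<Union>p\<in>T. ball p (r p))" by blast
    show "A \<subseteq> (\<Union>p\<in>T. ball p (r p))" by fact
    show "closed (\<Union>p\<in>T. cball p (2 * r p))" using T(2) by (intro closed_UN) auto
    show "(\<Union>p\<in>T. cball p (2 * r p)) \<subseteq> U" using T(1) r(2) by blast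
    show "(-1) * P x + 1 = 1" if "x \<in> (\<Union>p\<in>T. ball p (r p))" for x
    proof -
      obtain p where p: "p \<in> T" "norm (x - p) \<le> r p"
        using \<open>x \<in> _\<close> by (auto simp: dist_norm norm_minus_commute less_imp_le)
      then have "P x = 0" unfolding P_def using T(2) \<eta>(4)[OF p] by (intro prod_zero) auto
      then show ?thesis by simp
    qed
    show "(-1) * P x + 1 = 0" if "x \<notin> (\<Union>p\<in>T. cball p (2 * r p))" for x
    proof -
      have "\<eta> p x = 0" if "p \<in> T" for p
        using \<open>x \<notin> _\<close> that \<eta>(5)[OF that, of x] by (auto simp: dist_norm norm_minus_commute)
      then show ?thesis by (simp add: P_def)
    qed
  qed
qed

text \<open>A cutoff makes the function global and leaves it unchanged near A. Its support lies in a
  closed set S inside U, so U and the complement of S cover the space and the extension by zero is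
  C^2.\<close>

lemma global_extension:
  fixes \<phi> :: "'a::euclidean_space \<Rightarrow> real"
  assumes "compact A" "open U" "A \<subseteq> U" "Ck_on 2 \<phi> U" "\<phi> ` U \<subseteq> {0..c}" "0 \<le> c"
  obtains \<psi> V where "Ck_on 2 \<psi> UNIV" "\<And>x. \<psi> x \<in> {0..c}" "open V" "A \<subseteq> V" "V \<subseteq> U"
    "\<And>x. x \<in> V \<Longrightarrow> \<psi> x = \<phi> x"
proof -
  obtain \<rho> V S where \<rho>: "Ck_on 2 \<rho> UNIV" "\<And>x. 0 \<le> \<rho> x" "\<And>x. \<rho> x \<le> 1"
    "open V" "A \<subseteq> V" "\<And>x. x \<in> V \<Longrightarrow> \<rho> x = 1" "closed S" "S \<subseteq> U" "\<And>x. x \<notin> S \<Longrightarrow> \<rho> x = 0"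
    by (rule cutoff_exists[OF assms(1-3)]) blast
  define \<psi> where "\<psi> x = (if x \<in> U then \<rho> x * \<phi> x else 0)" for x
  have "Ck_on 2 (\<lambda>x. \<rho> x * \<phi> x) U"
    using \<rho>(1) assms(2,4) by (intro Ck_on_mult) (auto intro: Ck_on_subset)
  then have 1: "Ck_on 2 \<psi> U"
    by (rule Ck_on_cong[OF assms(2), rotated]) (simp add: \<psi>_def)
  have "open (- S)" using \<rho>(7) by blast
  then have 2: "Ck_on 2 \<psi> (- S)"
    by (rule Ck_on_cong[OF _ _ Ck_on_const[of 2 0]]) (simp add: \<psi>_def \<rho>(9))
  have "Ck_on 2 \<psi> (U \<union> - S)" by (rule Ck_on_Un[OF assms(2) \<open>open (- S)\<close> 1 2])
  moreover have "U \<union> - S = UNIV" using \<rho>(8) by blast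
  ultimately have C: "Ck_on 2 \<psi> UNIV" by simp
  show ?thesis
  proof (rule that[OF C])
    show "\<psi> x \<in> {0..c}" for x
    proof (cases "x \<in> U")
      case True
      then have "0 \<le> \<phi> x" "\<phi> x \<le> c" using assms(5) by auto
      then show ?thesis
        using True \<rho>(2)[of x] mult_mono[OF \<rho>(3)[of x], of "\<phi> x" c] assms(6) by (simp add: \<psi>_def)
    qed (simp add: \<psi>_def assms(6))
    show "open (V \<inter> U)" "A \<subseteq> V \<inter> U" "V \<inter> U \<subseteq> U" using \<rho> assms by auto
    show "\<psi> x = \<phi> x" if "x \<in> V \<inter> U" for x using that \<rho>(6) by (simp add: \<psi>_def)
  qed
qed

text \<open>The square completed in the proof absorbs the cross terms of the product rule into the
  gradient term of the Hessian of \<open>exp \<phi>\<close>; what remains of the cutoff carries a factor \<open>\<eta>\<^sup>2\<close>.\<close>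

lemma D2_cutoff_exp_ge:
  assumes U: "open U" "z \<in> U" and C: "Ck_on 2 \<eta> U" "Ck_on 2 \<phi> U" and \<eta>: "0 \<le> \<eta> z" "\<eta> z \<le> 1"
  shows "exp (\<phi> z) * ((\<eta> z) ^ 4 * D2 \<phi> z v v - (\<eta> z)\<^sup>2 * (4 * (D1 \<eta> z v)\<^sup>2 + 4 * \<bar>D2 \<eta> z v v\<bar>))
    \<le> D2 (\<lambda>x. (\<eta> x) ^ 4 * exp (\<phi> x)) z v v"
    and "Ck_on 2 (\<lambda>x. (\<eta> x) ^ 4 * exp (\<phi> x)) U"
proof -
  have d1: "((\<lambda>t. t ^ 4) has_real_derivative 4 * t ^ 3) (at t)"
    and d2: "((\<lambda>t. 4 * t ^ 3) has_real_derivative 12 * t\<^sup>2) (at t)" for t :: real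
    by (auto intro!: derivative_eq_intros)
  have dc: "continuous_on UNIV (\<lambda>t :: real. 12 * t\<^sup>2)" by (intro continuous_intros)
  have e1: "(exp has_real_derivative exp t) (at t)" for t :: real by (rule DERIV_exp)
  have ec: "continuous_on UNIV (exp :: real \<Rightarrow> real)" by (intro continuous_intros)
  note C4 = Ck_on_2_compose_real[OF U(1) C(1) d1 d2 dc]
  note Ce = Ck_on_2_compose_real[OF U(1) C(2) e1 e1 ec]
  show "Ck_on 2 (\<lambda>x. (\<eta> x) ^ 4 * exp (\<phi> x)) U" by (rule Ck_on_mult[OF U(1) C4 Ce])
  have "D2 (\<lambda>x. (\<eta> x) ^ 4 * exp (\<phi> x)) z v v
    = (\<eta> z) ^ 4 * D2 (\<lambda>x. exp (\<phi> x)) z v v + 2 * (D1 (\<lambda>x. (\<eta> x) ^ 4) z v * D1 (\<lambda>x. exp (\<phi> x)) z v)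
      + D2 (\<lambda>x. (\<eta> x) ^ 4) z v v * exp (\<phi> z)"
    unfolding D2_mult[OF U(1) C4 Ce U(2)] by simp
  \<comment> \<open>The square contributes 16 \<eta>^2 (D1 \<eta>)^2 where the product rule has only
    12; the difference is the subtracted term with factor 4.\<close>
  also have "\<dots> = exp (\<phi> z) * ((\<eta> z) ^ 4 * D2 \<phi> z v v + ((\<eta> z)\<^sup>2 * D1 \<phi> z v + 4 * \<eta> z * D1 \<eta> z v)\<^sup>2
      - 4 * (\<eta> z)\<^sup>2 * (D1 \<eta> z v)\<^sup>2 + 4 * (\<eta> z) ^ 3 * D2 \<eta> z v v)"
    unfolding D2_compose[OF U(1) C(1) U(2) d1 d2 dc] D2_compose[OF U(1) C(2) U(2) e1 e1 ec]
      D1_compose[OF Ck_on_2D(1)[OF C(1) U(2)] d1] D1_compose[OF Ck_on_2D(1)[OF C(2) U(2)] e1]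
    by (simp add: power2_eq_square power3_eq_cube power4_eq_xxxx algebra_simps)
  finally have eq: "D2 (\<lambda>x. (\<eta> x) ^ 4 * exp (\<phi> x)) z v v = \<dots>" .
  have "(\<eta> z) ^ 3 * D2 \<eta> z v v \<ge> - ((\<eta> z)\<^sup>2 * \<bar>D2 \<eta> z v v\<bar>)"
  proof -
    have "(\<eta> z) ^ 3 \<le> (\<eta> z)\<^sup>2" using \<eta> by (simp add: power_decreasing)
    then have "(\<eta> z) ^ 3 * \<bar>D2 \<eta> z v v\<bar> \<le> (\<eta> z)\<^sup>2 * \<bar>D2 \<eta> z v v\<bar>" by (rule mult_right_mono) simp
    moreover have "(\<eta> z) ^ 3 * (- \<bar>D2 \<eta> z v v\<bar>) \<le> (\<eta> z) ^ 3 * D2 \<eta> z v v"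
      using \<eta> by (intro mult_left_mono) auto
    ultimately show ?thesis by simp
  qed
  moreover define Q where "Q = ((\<eta> z)\<^sup>2 * D1 \<phi> z v + 4 * \<eta> z * D1 \<eta> z v)\<^sup>2"
  then have "0 \<le> Q" by simp
  ultimately show "exp (\<phi> z) * ((\<eta> z) ^ 4 * D2 \<phi> z v v - (\<eta> z)\<^sup>2 * (4 * (D1 \<eta> z v)\<^sup>2 + 4 * \<bar>D2 \<eta> z v v\<bar>))
    \<le> D2 (\<lambda>x. (\<eta> x) ^ 4 * exp (\<phi> x)) z v v"
    unfolding eq Q_def[symmetric]
    by (intro mult_left_mono) (auto simp: algebra_simps)
qed

text \<open>The directional estimate, summed over the two real directions of each frame vector. Its
  factor 4 cancels the quarter in \<open>lev\<close>, so B bounds the plain sum.\<close>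

lemma lev_trace_cutoff_exp_ge:
  assumes U: "open U" "z \<in> U" and C: "Ck_on 2 \<eta> U" "Ck_on 2 \<phi> U" and \<eta>: "0 \<le> \<eta> z" "\<eta> z \<le> 1"
    and L: "L \<le> lev_trace J \<phi> z e"
    and B: "(\<Sum>j\<in>J. ((D1 \<eta> z (e $ j))\<^sup>2 + \<bar>D2 \<eta> z (e $ j) (e $ j)\<bar>)
      + ((D1 \<eta> z (\<i> *s e $ j))\<^sup>2 + \<bar>D2 \<eta> z (\<i> *s e $ j) (\<i> *s e $ j)\<bar>)) \<le> B"
  shows "exp (\<phi> z) * ((\<eta> z)\<^sup>2 * ((\<eta> z)\<^sup>2 * L - B)) \<le> lev_trace J (\<lambda>x. (\<eta> x) ^ 4 * exp (\<phi> x)) z e"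
proof -
  define w where "w v = (D1 \<eta> z v)\<^sup>2 + \<bar>D2 \<eta> z v v\<bar>" for v
  define F where "F = (\<lambda>x. (\<eta> x) ^ 4 * exp (\<phi> x))"
  have 1: "exp (\<phi> z) * ((\<eta> z) ^ 4 * D2 \<phi> z v v - (\<eta> z)\<^sup>2 * (4 * w v)) \<le> D2 F z v v" for v
    using D2_cutoff_exp_ge(1)[OF U C \<eta>, of v] by (simp add: w_def F_def distrib_left)
  have "exp (\<phi> z) * ((\<eta> z) ^ 4 * lev \<phi> z a - (\<eta> z)\<^sup>2 * (w a + w (\<i> *s a))) \<le> lev F z a" for a
    using add_mono[OF 1[of a] 1[of "\<i> *s a"]] by (simp add: lev_def algebra_simps add_divide_distrib)
  then have "(\<Sum>j\<in>J. exp (\<phi> z) * ((\<eta> z) ^ 4 * lev \<phi> z (e $ j) - (\<eta> z)\<^sup>2 * (w (e $ j) + w (\<i> *s e $ j))))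
    \<le> lev_trace J F z e"
    unfolding lev_trace_def by (intro sum_mono)
  also have "(\<Sum>j\<in>J. exp (\<phi> z) * ((\<eta> z) ^ 4 * lev \<phi> z (e $ j) - (\<eta> z)\<^sup>2 * (w (e $ j) + w (\<i> *s e $ j))))
    = exp (\<phi> z) * ((\<eta> z) ^ 4 * lev_trace J \<phi> z e - (\<eta> z)\<^sup>2 * (\<Sum>j\<in>J. w (e $ j) + w (\<i> *s e $ j)))"
    by (simp only: lev_trace_def sum_distrib_left sum_subtractf right_diff_distrib)
  finally have 2: "exp (\<phi> z) * ((\<eta> z) ^ 4 * lev_trace J \<phi> z e
      - (\<eta> z)\<^sup>2 * (\<Sum>j\<in>J. w (e $ j) + w (\<i> *s e $ j))) \<le> lev_trace J F z e" .
  have "(\<eta> z) ^ 4 * L \<le> (\<eta> z) ^ 4 * lev_trace J \<phi> z e" using L by (intro mult_left_mono) auto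
  moreover have "(\<eta> z)\<^sup>2 * (\<Sum>j\<in>J. w (e $ j) + w (\<i> *s e $ j)) \<le> (\<eta> z)\<^sup>2 * B"
    using B by (intro mult_left_mono) (auto simp: w_def)
  moreover have "(\<eta> z)\<^sup>2 * ((\<eta> z)\<^sup>2 * L - B) = (\<eta> z) ^ 4 * L - (\<eta> z)\<^sup>2 * B"
    by (simp add: algebra_simps power2_eq_square power4_eq_xxxx)
  ultimately have "exp (\<phi> z) * ((\<eta> z)\<^sup>2 * ((\<eta> z)\<^sup>2 * L - B)) \<le> exp (\<phi> z) * ((\<eta> z) ^ 4 * lev_trace J \<phi> z e
      - (\<eta> z)\<^sup>2 * (\<Sum>j\<in>J. w (e $ j) + w (\<i> *s e $ j)))"
    by (intro mult_left_mono) auto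
  from order_trans[OF this 2] show ?thesis unfolding F_def .
qed

text \<open>The added function \<Theta> is \<kappa> \<eta>^4 exp \<phi>, with \<eta> = 1 up to
  radius 2 \<delta> and \<eta> = 0 from radius 3 \<delta> on. Near A it costs at most \<epsilon>;
  elsewhere near the ball of radius \<delta> one has \<eta> = 1, and there its Hessian outweighs
  whatever the old function contributes.\<close>

lemma admits_lev_glue:
  fixes X :: "(complex^'n) set"
  assumes X: "A \<subseteq> X" "compact A" and A: "admits_lev J A m c" "0 \<le> c"
    and d: "0 < \<delta>" and K: "\<And>L. 0 < L \<Longrightarrow> admits_lev J (X \<inter> cball p (3 * \<delta>)) L 1" and e: "0 < \<epsilon>"
  shows "admits_lev J (A \<union> (X \<inter> cball p \<delta>)) (m - \<epsilon>) (c + \<epsilon>)"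
proof -
  obtain UA \<phi>A where UA: "open UA" "A \<subseteq> UA" "Ck_on 2 \<phi>A UA" "\<phi>A ` UA \<subseteq> {0..c}"
    "\<forall>z\<in>UA. \<forall>e. frame J e \<longrightarrow> m \<le> lev_trace J \<phi>A z e"
    using A(1) unfolding admits_lev_def by (elim exE conjE)
  obtain \<psi> V where \<psi>: "Ck_on 2 \<psi> UNIV" "\<And>x. \<psi> x \<in> {0..c}" "open V" "A \<subseteq> V" "V \<subseteq> UA"
    "\<And>x. x \<in> V \<Longrightarrow> \<psi> x = \<phi>A x"
    by (rule global_extension[OF X(2) UA(1-4) A(2)]) blast
  have trV: "m \<le> lev_trace J \<psi> z e" if "z \<in> V" "frame J e" for z e
  proof -
    have "lev_trace J \<psi> z e = lev_trace J \<phi>A z e"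
      by (rule lev_trace_cong[OF Ck_on_subset[OF \<psi>(1) subset_UNIV] \<psi>(3) that(1) \<psi>(6)])
    then show ?thesis using UA(5) \<psi>(5) that by auto
  qed
  define D where "D = cball p (3 * \<delta>)"
  have "0 \<le> 2 * \<delta>" "2 * \<delta> < 3 * \<delta>" using d by auto
  then obtain \<eta> where \<eta>: "Ck_on 2 \<eta> UNIV" "\<And>x. 0 \<le> \<eta> x" "\<And>x. \<eta> x \<le> 1"
    "\<And>x. norm (x - p) \<le> 2 * \<delta> \<Longrightarrow> \<eta> x = 1" "\<And>x. 3 * \<delta> \<le> norm (x - p) \<Longrightarrow> \<eta> x = 0"
    by (rule bump_exists) blast
  have \<eta>0: "\<eta> x = 0" if "x \<notin> D" for x
    using that \<eta>(5)[of x] by (simp add: D_def dist_norm norm_minus_commute)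
  have "continuous_on (D \<times> UNIV) (\<lambda>x. lev_trace J \<psi> (fst x) (snd x))"
    by (intro continuous_on_lev_trace[OF \<psi>(1)] continuous_intros) auto
  then obtain C where C: "C > 0" "\<And>z e. z \<in> D \<Longrightarrow> frame J e \<Longrightarrow> \<bar>lev_trace J \<psi> z e\<bar> \<le> C"
    by (rule frames_bounded[of D "lev_trace J \<psi>" J, rotated]) (auto simp: lev_trace_trunc D_def)
  define R where "R z e = (\<Sum>j\<in>J. ((D1 \<eta> z (e $ j))\<^sup>2 + \<bar>D2 \<eta> z (e $ j) (e $ j)\<bar>)
      + ((D1 \<eta> z (\<i> *s e $ j))\<^sup>2 + \<bar>D2 \<eta> z (\<i> *s e $ j) (\<i> *s e $ j)\<bar>))"
    for z and e :: "complex^'n^'n"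
  have "continuous_on (D \<times> UNIV) (\<lambda>x. R (fst x) (snd x))"
    unfolding R_def
    by (intro continuous_intros continuous_on_D1[OF \<eta>(1)] continuous_on_D2[OF \<eta>(1)]) auto
  then obtain B where B: "B > 0" "\<And>z e. z \<in> D \<Longrightarrow> frame J e \<Longrightarrow> \<bar>R z e\<bar> \<le> B"
    by (rule frames_bounded[of D R J, rotated]) (auto simp: R_def frame_trunc_nth D_def)
  \<comment> \<open>Since exp \<phi> \<le> e \<le> 3, this keeps \<kappa> exp \<phi>, and with it
    \<Theta>, below \<epsilon>.\<close>
  define \<kappa> where "\<kappa> = \<epsilon> / 3"
  have k: "\<kappa> > 0" using e by (simp add: \<kappa>_def)
  \<comment> \<open>The summand B^2 controls the collar. The quotient makes \<kappa> (L - B) at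
    least m + C, which pays for the worst trace -C of \<psi> at points outside \<open>V\<close>. The
    rest gives strict positivity.\<close>
  define L where "L = B\<^sup>2 + B + (\<bar>m\<bar> + C) / \<kappa> + 1"
  have L: "L > 0" "L \<ge> B\<^sup>2" "\<kappa> * (L - B) \<ge> m + C" "L > B"
  proof -
    have q: "(\<bar>m\<bar> + C) / \<kappa> > 0" using C(1) k by simp
    show "L > 0" "L \<ge> B\<^sup>2" "L > B" using q B(1) by (simp_all add: L_def add_pos_nonneg add.commute add_strict_increasing2)
    have "\<kappa> * ((\<bar>m\<bar> + C) / \<kappa>) \<le> \<kappa> * (L - B)"
      using k by (intro mult_left_mono) (auto simp: L_def)
    then show "\<kappa> * (L - B) \<ge> m + C" using k by simp
  qed
  obtain UK \<phi> where UK: "open UK" "X \<inter> D \<subseteq> UK" "Ck_on 2 \<phi> UK" "\<phi> ` UK \<subseteq> {0..1}"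
    "\<forall>z\<in>UK. \<forall>e. frame J e \<longrightarrow> L \<le> lev_trace J \<phi> z e"
    using K[OF L(1)] unfolding admits_lev_def D_def by (elim exE conjE)
  define F where "F x = (\<eta> x) ^ 4 * exp (\<phi> x)" for x
  define \<Theta> where "\<Theta> x = (if x \<in> UK then \<kappa> * F x else 0)" for x
  have \<eta>UK: "Ck_on 2 \<eta> UK" by (rule Ck_on_subset[OF \<eta>(1) subset_UNIV])
  have oD: "open (- D)" by (simp add: D_def open_Compl)
  have F: "Ck_on 2 F UK"
    unfolding F_def using D2_cutoff_exp_ge(2)[OF UK(1) _ \<eta>UK UK(3) \<eta>(2,3)]
    by (cases "UK = {}") (auto simp: Ck_on_2_iff)
  then have kF: "Ck_on 2 (\<lambda>x. \<kappa> * F x) UK" by (intro Ck_on_mult Ck_on_const UK(1))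
  then have T1: "Ck_on 2 \<Theta> UK"
    by (rule Ck_on_cong[OF UK(1), rotated]) (simp add: \<Theta>_def)
  have \<Theta>0: "\<Theta> x = 0" if "x \<in> - D" for x using that \<eta>0[of x] by (simp add: \<Theta>_def F_def)
  then have T2: "Ck_on 2 \<Theta> (- D)"
    by (intro Ck_on_cong[OF oD _ Ck_on_const[of 2 0]]) simp
  \<comment> \<open>\<Theta> is C^2 only on UK and off D, as UK covers D only along X. A point of A
    is off D or in UK because A lies in X; a point of X in the small ball is in UK.\<close>
  define W where "W = (V \<inter> (UK \<union> - D)) \<union> (UK \<inter> ball p (2 * \<delta>))"
  have oW: "open W" unfolding W_def using \<psi>(3) UK(1) oD by blast
  have WU: "W \<subseteq> UK \<union> - D" by (auto simp: W_def)
  have \<Theta>W: "Ck_on 2 \<Theta> W" by (rule Ck_on_subset[OF Ck_on_Un[OF UK(1) oD T1 T2] WU])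
  have \<psi>W: "Ck_on 2 \<psi> W" by (rule Ck_on_subset[OF \<psi>(1) subset_UNIV])
  have tr\<Theta>: "\<kappa> * (exp (\<phi> z) * ((\<eta> z)\<^sup>2 * ((\<eta> z)\<^sup>2 * L - B))) \<le> lev_trace J \<Theta> z e"
    if "z \<in> UK" "z \<in> D" "frame J e" for z e
  proof -
    have "lev_trace J \<Theta> z e = lev_trace J (\<lambda>x. \<kappa> * F x) z e"
      by (rule lev_trace_cong[OF T1 UK(1) that(1)]) (simp add: \<Theta>_def)
    also have "\<dots> = \<kappa> * lev_trace J F z e" by (rule lev_trace_scale[OF UK(1) F that(1)])
    finally have eq: "lev_trace J \<Theta> z e = \<kappa> * lev_trace J F z e" .
    have "R z e \<le> B" using B(2)[OF that(2,3)] by simp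
    then have "exp (\<phi> z) * ((\<eta> z)\<^sup>2 * ((\<eta> z)\<^sup>2 * L - B)) \<le> lev_trace J F z e"
      unfolding F_def R_def using UK(5) that
      by (intro lev_trace_cutoff_exp_ge[OF UK(1) that(1) \<eta>UK UK(3) \<eta>(2,3)]) auto
    then show ?thesis unfolding eq using k by (intro mult_left_mono) auto
  qed
  have tr\<Theta>D: "lev_trace J \<Theta> z e = 0" if "z \<in> - D" for z e
    using lev_trace_cong[OF T2 oD that \<Theta>0] lev_trace_zero[of J 0] by metis
  have exp\<phi>: "1 \<le> exp (\<phi> z)" "\<kappa> * exp (\<phi> z) \<le> \<epsilon>" if "z \<in> UK" for z
  proof -
    have "0 \<le> \<phi> z" "\<phi> z \<le> 1" using UK(4) that by auto
    then have "1 \<le> exp (\<phi> z)" "exp (\<phi> z) \<le> exp 1" by simp_all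
    moreover from this(2) have "exp (\<phi> z) \<le> 3" using exp_le by linarith
    ultimately show "1 \<le> exp (\<phi> z)" "\<kappa> * exp (\<phi> z) \<le> \<epsilon>"
      using mult_left_mono[of "exp (\<phi> z)" 3 \<kappa>] k by (simp_all add: \<kappa>_def)
  qed
  have err: "- \<epsilon> \<le> lev_trace J \<Theta> z e" if "z \<in> UK \<union> - D" "frame J e" for z e
  proof (cases "z \<in> D")
    case False
    then show ?thesis using tr\<Theta>D[of z e] e by simp
  next
    case True
    then have z: "z \<in> UK" using that by blast
    define s where "s = (\<eta> z)\<^sup>2"
    \<comment> \<open>Minimizing s (s L - B): the minimum -B^2 / (4 L) is at least -1/4 by
      \<open>L \<ge> B\<^sup>2\<close>, and the bound -1 suffices.\<close>
    have "0 \<le> (2 * (s * L) - B)\<^sup>2" by simp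
    then have "- (B\<^sup>2) \<le> 4 * L * (s * (s * L - B))" by (simp add: power2_eq_square algebra_simps)
    then have "- L \<le> 4 * L * (s * (s * L - B))" using L(2) by linarith
    then have "0 \<le> L * (1 + 4 * (s * (s * L - B)))" by (simp add: algebra_simps)
    then have "0 \<le> 1 + 4 * (s * (s * L - B))" using L(1) by (simp add: zero_le_mult_iff)
    then have "- 1 \<le> s * (s * L - B)" by simp
    then have "\<kappa> * exp (\<phi> z) * - 1 \<le> \<kappa> * exp (\<phi> z) * (s * (s * L - B))"
      using k by (intro mult_left_mono) auto
    moreover have "\<kappa> * exp (\<phi> z) * (s * (s * L - B)) \<le> lev_trace J \<Theta> z e"
      using tr\<Theta>[OF z True that(2)] by (simp add: s_def mult.assoc)
    ultimately show ?thesis using exp\<phi>(2)[OF z] by linarith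
  qed
  have tr: "m - \<epsilon> \<le> lev_trace J (\<lambda>x. \<psi> x + \<Theta> x) z e" if "z \<in> W" "frame J e" for z e
  proof -
    have eq: "lev_trace J (\<lambda>x. \<psi> x + \<Theta> x) z e = lev_trace J \<psi> z e + lev_trace J \<Theta> z e"
      by (rule lev_trace_add[OF oW \<psi>W \<Theta>W that(1)])
    show ?thesis
    proof (cases "z \<in> V")
      case True
      then show ?thesis using trV[OF True that(2)] err[OF _ that(2), of z] WU that(1) eq by auto
    next
      case False
      then have z: "z \<in> UK" "dist p z < 2 * \<delta>" using that(1) by (auto simp: W_def)
      then have zD: "z \<in> D" using d by (simp add: D_def)
      have "\<eta> z = 1" using z(2) \<eta>(4)[of z] by (simp add: dist_norm norm_minus_commute)
      then have "\<kappa> * (exp (\<phi> z) * (L - B)) \<le> lev_trace J \<Theta> z e" using tr\<Theta>[OF z(1) zD that(2)] by simp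
      moreover have "\<kappa> * (1 * (L - B)) \<le> \<kappa> * (exp (\<phi> z) * (L - B))"
        using k L(4) exp\<phi>(1)[OF z(1)] by (intro mult_left_mono mult_right_mono) auto
      ultimately show ?thesis using C(2)[OF zD that(2)] L(3) eq e by (simp add: abs_le_iff)
    qed
  qed
  have \<Theta>r: "0 \<le> \<Theta> x" "\<Theta> x \<le> \<epsilon>" for x
  proof -
    show "0 \<le> \<Theta> x" using k by (simp add: \<Theta>_def F_def)
    show "\<Theta> x \<le> \<epsilon>"
    proof (cases "x \<in> UK")
      case True
      have "(\<eta> x) ^ 4 \<le> 1" using \<eta>(2,3) by (simp add: power_le_one)
      then have "(\<eta> x) ^ 4 * (\<kappa> * exp (\<phi> x)) \<le> 1 * (\<kappa> * exp (\<phi> x))"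
        using k by (intro mult_right_mono) auto
      then show ?thesis using exp\<phi>(2)[OF True] True by (simp add: \<Theta>_def F_def mult_ac)
    qed (use e in \<open>simp add: \<Theta>_def\<close>)
  qed
  have "A \<union> (X \<inter> cball p \<delta>) \<subseteq> W"
  proof -
    have "x \<in> W" if "x \<in> A" for x using that \<psi>(4) UK(2) X(1) by (auto simp: W_def)
    moreover have "x \<in> W" if "x \<in> X" "dist p x \<le> \<delta>" for x
    proof -
      have "x \<in> D" "x \<in> ball p (2 * \<delta>)" using that(2) d by (auto simp: D_def)
      then show ?thesis using that(1) UK(2) by (auto simp: W_def)
    qed
    ultimately show ?thesis by auto
  qed
  moreover have "(\<lambda>x. \<psi> x + \<Theta> x) ` W \<subseteq> {0..c + \<epsilon>}"
    using \<psi>(2) \<Theta>r by (auto intro!: add_nonneg_nonneg add_mono)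
  moreover have "Ck_on 2 (\<lambda>x. \<psi> x + \<Theta> x) W" by (rule Ck_on_add[OF oW \<psi>W \<Theta>W])
  ultimately show ?thesis
    unfolding admits_lev_def using oW tr by (intro exI[of _ W] exI[of _ "\<lambda>x. \<psi> x + \<Theta> x"] conjI) auto
qed

lemma admits_lev_scale:
  assumes "admits_lev J X m c" "0 \<le> k"
  shows "admits_lev J X (k * m) (k * c)"
proof -
  obtain U \<phi> where U: "open U" "X \<subseteq> U" "Ck_on 2 \<phi> U" "\<phi> ` U \<subseteq> {0..c}"
    "\<forall>z\<in>U. \<forall>e. frame J e \<longrightarrow> m \<le> lev_trace J \<phi> z e"
    using assms(1) unfolding admits_lev_def by (elim exE conjE)
  have "(\<lambda>x. k * \<phi> x) ` U \<subseteq> {0..k * c}" using U(4) assms(2) by (auto intro!: mult_left_mono)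
  moreover have "\<forall>z\<in>U. \<forall>e. frame J e \<longrightarrow> k * m \<le> lev_trace J (\<lambda>x. k * \<phi> x) z e"
    using U(5) assms(2) by (auto simp: lev_trace_scale[OF U(1,3)] intro!: mult_left_mono)
  moreover have "Ck_on 2 (\<lambda>x. k * \<phi> x) U" by (intro Ck_on_mult Ck_on_const U(1,3))
  ultimately show ?thesis
    unfolding admits_lev_def using U(1,2) by (intro exI[of _ U] exI[of _ "\<lambda>x. k * \<phi> x"] conjI)
qed

text \<open>Halving a function with traces at least 2 (M + 1) gives trace bound M + 1 and range
  bound 1/2 near B. Finitely many balls cover the rest of X, and the gluings may spend 1/2 in total,
  which ends with range bound 1 and trace bound M + 1/2.\<close>

lemma admits_lev_from_local:
  fixes X :: "(complex^'n) set"
  assumes X: "compact X" and B: "\<And>L. 0 < L \<Longrightarrow> admits_lev J B L 1"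
    and loc: "\<And>p. p \<in> X - B \<Longrightarrow> \<exists>\<delta>>0. \<forall>L>0. admits_lev J (X \<inter> cball p \<delta>) L 1"
    and M: "0 < M"
  shows "admits_lev J X M 1"
proof -
  have "admits_lev J B (1 / 2 * (2 * (M + 1))) (1 / 2 * 1)"
    using M by (intro admits_lev_scale B) auto
  moreover have "1 / 2 * (2 * (M + 1)) = M + 1" by simp
  ultimately have "admits_lev J B (M + 1) (1 / 2)" by (simp only: mult_1_right)
  then obtain U \<phi> where U: "open U" "B \<subseteq> U" "Ck_on 2 \<phi> U" "\<phi> ` U \<subseteq> {0..1 / 2}"
    "\<forall>z\<in>U. \<forall>e. frame J e \<longrightarrow> M + 1 \<le> lev_trace J \<phi> z e"
    unfolding admits_lev_def by (elim exE conjE)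
  have "\<exists>\<delta>>0. \<forall>L>0. admits_lev J (X \<inter> cball p (3 * \<delta>)) L 1" if p: "p \<in> X - U" for p
  proof -
    obtain d where "d > 0" "\<forall>L>0. admits_lev J (X \<inter> cball p d) L 1"
      using loc[of p] p U(2) by blast
    then show ?thesis by (intro exI[of _ "d / 3"]) simp
  qed
  then obtain \<delta> where \<delta>: "\<And>p. p \<in> X - U \<Longrightarrow> \<delta> p > 0"
    "\<And>p L. p \<in> X - U \<Longrightarrow> L > 0 \<Longrightarrow> admits_lev J (X \<inter> cball p (3 * \<delta> p)) L 1" by metis
  have cX: "compact (X - U)" using X U(1) by (rule compact_diff)
  obtain T where T: "T \<subseteq> X - U" "finite T" "X - U \<subseteq> (\<Union>p\<in>T. ball p (\<delta> p))"
    by (rule compactE_image[OF cX, of "X - U" "\<lambda>p. ball p (\<delta> p)"]) (use \<delta>(1) in force)+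
  \<comment> \<open>The compact part of X left by the open balls. It lies in \<open>U\<close>, where
    the initial function lives; the closed balls are then glued back one at a time.\<close>
  define A where "A = X - (\<Union>p\<in>T. ball p (\<delta> p))"
  have A: "compact A" "A \<subseteq> X" "A \<subseteq> U"
    using X T(3) by (auto simp: A_def intro!: compact_diff)
  have gA: "admits_lev J A (M + 1) (1 / 2)"
    unfolding admits_lev_def using U A(3) by blast
  have step: "\<epsilon> > 0 \<Longrightarrow> admits_lev J (A \<union> (\<Union>p\<in>T'. X \<inter> cball p (\<delta> p))) (M + 1 - \<epsilon>) (1 / 2 + \<epsilon>)"
    if "T' \<subseteq> T" for T' \<epsilon>
    using finite_subset[OF that T(2)] that
  proof (induction T' arbitrary: \<epsilon> rule: finite_induct)
    case empty
    then show ?case using admits_lev_mono[OF gA, of A "M + 1 - \<epsilon>" "1 / 2 + \<epsilon>"] by simp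
  next
    case (insert p T')
    define A' where "A' = A \<union> (\<Union>p\<in>T'. X \<inter> cball p (\<delta> p))"
    have p: "p \<in> X - U" using insert.prems T(1) by blast
    \<comment> \<open>The induction hypothesis spends half of the allowance \<epsilon>, and the new
      gluing spends the other half.\<close>
    have "admits_lev J A' (M + 1 - \<epsilon> / 2) (1 / 2 + \<epsilon> / 2)"
      unfolding A'_def using insert by simp
    moreover have "compact A'"
      unfolding A'_def using A(1) X insert.hyps(1) by (intro compact_Un compact_UN) auto
    moreover have "A' \<subseteq> X" using A(2) by (auto simp: A'_def)
    ultimately have "admits_lev J (A' \<union> (X \<inter> cball p (\<delta> p))) (M + 1 - \<epsilon> / 2 - \<epsilon> / 2) (1 / 2 + \<epsilon> / 2 + \<epsilon> / 2)"
      using \<delta>[OF p] insert.prems(1) by (intro admits_lev_glue) auto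
    moreover have "A' \<union> (X \<inter> cball p (\<delta> p)) = A \<union> (\<Union>p\<in>insert p T'. X \<inter> cball p (\<delta> p))"
      by (auto simp: A'_def)
    ultimately show ?case by (simp add: algebra_simps)
  qed
  have "X \<subseteq> A \<union> (\<Union>p\<in>T. X \<inter> cball p (\<delta> p))" by (force simp: A_def)
  with step[OF order_refl, of "1 / 2"] show ?thesis by (auto intro: admits_lev_mono)
qed

subsection \<open>Points transverse to the Levi kernel\<close>

lemma smooth_on_Ck_on: "smooth_on f U \<Longrightarrow> Ck_on k f U"
  by (simp add: smooth_on_def)

text \<open>On the compact set where T \<le> 0 the penalty \<rho> has a positive minimum, so a large
  multiple outweighs the minimum of T. A second minimum over K supplies c.\<close>

lemma positive_penalized_form:
  fixes T \<rho> :: "'a::topological_space \<Rightarrow> real"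
  assumes K: "compact K" and T: "continuous_on K T" and \<rho>: "continuous_on K \<rho>" "\<And>x. x \<in> K \<Longrightarrow> 0 \<le> \<rho> x"
    and pos: "\<And>x. x \<in> K \<Longrightarrow> \<rho> x = 0 \<Longrightarrow> 0 < T x"
  obtains l c where "0 < l" "0 < c" "\<And>x. x \<in> K \<Longrightarrow> c \<le> T x + l * \<rho> x"
proof -
  have "\<exists>l>0. \<forall>x\<in>K. 0 < T x + l * \<rho> x"
  proof (cases "K \<inter> T -` {..0} = {}")
    case True
    then have "0 < T x + 1 * \<rho> x" if "x \<in> K" for x using \<rho>(2)[OF that] that by force
    then show ?thesis by (intro exI[of _ 1]) simp
  next
    case False
    have "compact (K \<inter> T -` {..0})"
    proof -
      obtain A where A: "closed A" "A \<inter> K = T -` {..0} \<inter> K"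
        using continuous_on_closed_invariant[THEN iffD1, OF T] closed_atMost by blast
      have "compact (K \<inter> A)" using K A(1) by (rule compact_Int_closed)
      then show ?thesis using A(2) by (simp add: Int_commute)
    qed
    moreover have "continuous_on (K \<inter> T -` {..0}) \<rho>" "continuous_on (K \<inter> T -` {..0}) T"
      using \<rho>(1) T by (auto intro: continuous_on_subset)
    ultimately obtain x0 x1 where x0: "x0 \<in> K" "T x0 \<le> 0" "\<And>x. x \<in> K \<Longrightarrow> T x \<le> 0 \<Longrightarrow> \<rho> x0 \<le> \<rho> x"
      and x1: "\<And>x. x \<in> K \<Longrightarrow> T x \<le> 0 \<Longrightarrow> T x1 \<le> T x"
      using continuous_attains_inf[of "K \<inter> T -` {..0}" \<rho>] continuous_attains_inf[of "K \<inter> T -` {..0}" T] False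
      by (metis IntE IntI atMost_iff vimage_eq)
    have r0: "\<rho> x0 > 0" using pos[OF x0(1)] x0(2) \<rho>(2)[OF x0(1)] by fastforce
    define l where "l = (\<bar>T x1\<bar> + 1) / \<rho> x0"
    have l: "l > 0" using r0 by (simp add: l_def)
    have "0 < T x + l * \<rho> x" if x: "x \<in> K" for x
    proof (cases "T x \<le> 0")
      case True
      have "l * \<rho> x0 \<le> l * \<rho> x" using l x0(3)[OF x True] by simp
      moreover have "l * \<rho> x0 = \<bar>T x1\<bar> + 1" using r0 by (simp add: l_def)
      ultimately show ?thesis using x1[OF x True] by linarith
    next
      case False
      have "0 \<le> l * \<rho> x" using l \<rho>(2)[OF x] by simp
      then show ?thesis using False by linarith
    qed
    then show ?thesis using l by blast
  qed
  then obtain l where l: "l > 0" "\<And>x. x \<in> K \<Longrightarrow> 0 < T x + l * \<rho> x" by blast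
  show ?thesis
  proof (cases "K = {}")
    case True
    then show ?thesis using that[of l 1] l by simp
  next
    case False
    have "continuous_on K (\<lambda>x. T x + l * \<rho> x)" by (intro continuous_intros T \<rho>)
    from continuous_attains_inf[OF K False this]
    obtain x0 where "x0 \<in> K" "\<forall>y\<in>K. T x0 + l * \<rho> x0 \<le> T y + l * \<rho> y" by blast
    then show ?thesis using that[of l "T x0 + l * \<rho> x0"] l by blast
  qed
qed

text \<open>The coefficient vectors of the (1,0) vectors in the complexified tangent space of S: the
  largest complex subspace of the real tangent space.\<close>

definition holo_tangent ::
    "(complex^'n \<Rightarrow> real) \<Rightarrow> (complex^'n) set \<Rightarrow> (complex^'n) set \<Rightarrow> complex^'n \<Rightarrow> (complex^'n) set" where
  "holo_tangent r M S p =
     {a. a \<in> subset_tangent_space r M S p \<and> \<i> *s a \<in> subset_tangent_space r M S p}"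

definition levi_kernel :: "(complex^'n \<Rightarrow> real) \<Rightarrow> complex^'n \<Rightarrow> (complex^'n) set" where
  "levi_kernel r p = {a \<in> T10 r p. \<forall>b\<in>T10 r p. levi_form r p a b = 0}"

lemma subspace_T10: "vec.subspace (T10 r p)"
proof -
  have "(\<Sum>j\<in>UNIV. complex_gradient r p $ j * (c * x $ j)) = c * (\<Sum>j\<in>UNIV. complex_gradient r p $ j * x $ j)" for c x
    by (simp add: sum_distrib_left mult_ac)
  then show ?thesis by (auto simp: vec.subspace_def T10_def distrib_left sum.distrib)
qed

lemma subspace_levi_kernel: "vec.subspace (levi_kernel r p)"
  using subspace_T10[of r p]
  by (auto simp: vec.subspace_def levi_kernel_def levi_form_hform hform_zero_left hform_add_left hform_scale_left)

lemma subspace_D1_zeros: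
  assumes "f differentiable (at p)"
  shows "vec.subspace {a. D1 f p a = 0 \<and> D1 f p (\<i> *s a) = 0}"
  using subspace_T10[of f p] unfolding T10_iff[OF assms, symmetric] by simp

text \<open>By Cauchy--Schwarz for the semidefinite Levi form. Unlike the definition, the right-hand side is
  visibly closed in \<open>(p, a)\<close>.\<close>

lemma levi_kernel_iff:
  assumes C: "Ck_on 2 r U" "open U" "p \<in> U"
    and psd: "\<And>a. a \<in> T10 r p \<Longrightarrow> 0 \<le> Re (levi_form r p a a)"
  shows "a \<in> levi_kernel r p \<longleftrightarrow> D1 r p a = 0 \<and> D1 r p (\<i> *s a) = 0 \<and> lev r p a = 0"
proof -
  have diff: "r differentiable (at p)" using Ck_on_2D(1)[OF C(1,3)] .
  have T: "a \<in> T10 r p \<longleftrightarrow> D1 r p a = 0 \<and> D1 r p (\<i> *s a) = 0" for a by (rule T10_iff[OF diff])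
  note h = levi_form_hform[of r p]
  have "levi_form r p a b = 0" if a: "a \<in> T10 r p" "lev r p a = 0" and b: "b \<in> T10 r p" for b
  proof -
    have re: "Re (levi_form r p a b) = 0" if b: "b \<in> T10 r p" for b
    proof -
      \<comment> \<open>The form is nonnegative along a + t b and its constant term vanishes, hence
        so does its linear coefficient. Replacing b by i b then handles the imaginary part.\<close>
      have "2 * Re (levi_form r p a b) = 0"
      proof (rule linear_coefficient_zero)
        fix t :: real
        have "a + of_real t *s b \<in> T10 r p"
          using a(1) b subspace_T10 by (metis vec.subspace_add vec.subspace_scale)
        from psd[OF this]
        have "0 \<le> Re (levi_form r p (a + of_real t *s b) (a + of_real t *s b))" .
        moreover have "Re (levi_form r p b a) = Re (levi_form r p a b)"
          unfolding h using hform_commute[OF complex_hessian_hermitian[OF C], of b a] by simp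
        moreover have "Re (levi_form r p a a) = 0" using levi_form_self[OF C, of a] a(2) by simp
        ultimately show "0 \<le> t * (2 * Re (levi_form r p a b)) + t\<^sup>2 * Re (levi_form r p b b)"
          unfolding h
          by (simp add: hform_add_left hform_add_right hform_scale_left hform_scale_right power2_eq_square algebra_simps)
      qed
      then show ?thesis by simp
    qed
    have "\<i> *s b \<in> T10 r p" using b subspace_T10 vec.subspace_scale by blast
    from re[OF this] re[OF b] show ?thesis
      by (simp add: h hform_scale_right complex_eq_iff)
  qed
  moreover have "lev r p a = 0" if "a \<in> levi_kernel r p"
    using that levi_form_self[OF C, of a] by (simp add: levi_kernel_def)
  ultimately show ?thesis using T[of a] by (auto simp: levi_kernel_def)
qed

lemma D1_smooth_extension:
  assumes "local_extension M f p g"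
  obtains U where "open U" "p \<in> U" "Ck_on 2 g U" "\<And>x. x \<in> U \<Longrightarrow> x \<in> M \<Longrightarrow> g x = f x"
    "g differentiable (at p)"
proof -
  obtain U where U: "open U" "p \<in> U" "smooth_on g U" "\<forall>x\<in>U \<inter> M. g x = f x"
    using assms unfolding local_extension_def by blast
  have "Ck_on 2 g U" using smooth_on_Ck_on[OF U(3)] .
  then show ?thesis using that[of U] U Ck_on_2D(1)[of g U p] by blast
qed

lemma subset_tangent_space_D1:
  "v \<in> subset_tangent_space r M S p \<longleftrightarrow> D1 r p v = 0 \<and>
    (\<forall>f g. smooth_on_hypersurface M f \<and> (\<forall>x\<in>S. f x = 0) \<and> local_extension M f p g \<longrightarrow> D1 g p v = 0)"
  by (simp add: subset_tangent_space_def real_tangent_space_def D1_def)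

lemma subspace_subset_tangent_space:
  assumes "r differentiable (at p)"
  shows "subspace (subset_tangent_space r M S p)"
proof -
  have "linear (D1 g p)" if "local_extension M f p g" for f g
    using D1_smooth_extension[OF that] D1_linear by metis
  then show ?thesis
    using D1_linear[OF assms]
    by (auto simp: subspace_def subset_tangent_space_D1 linear_0 linear_add linear_scale)
qed

lemma lev_square:
  assumes "open U" "Ck_on 2 g U" "p \<in> U" "g p = 0"
  shows "lev (\<lambda>x. g x * g x) p a = ((D1 g p a)\<^sup>2 + (D1 g p (\<i> *s a))\<^sup>2) / 2"
  unfolding lev_def D2_mult[OF assms(1,2,2,3)] using assms(4)
  by (simp add: power2_eq_square)

lemma lev_add:
  assumes "open U" "Ck_on 2 f U" "Ck_on 2 g U" "p \<in> U"
  shows "lev (\<lambda>x. f x + g x) p a = lev f p a + lev g p a"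
  unfolding lev_def D2_add[OF assms] by (simp add: add_divide_distrib)

lemma sum_squares_Ck_lev:
  assumes "finite F" "open U" "\<And>g. g \<in> F \<Longrightarrow> Ck_on 2 g U" "p \<in> U" "\<And>g. g \<in> F \<Longrightarrow> g p = 0"
  shows "Ck_on 2 (\<lambda>x. \<Sum>g\<in>F. g x * g x) U"
    and "lev (\<lambda>x. \<Sum>g\<in>F. g x * g x) p a = (\<Sum>g\<in>F. ((D1 g p a)\<^sup>2 + (D1 g p (\<i> *s a))\<^sup>2) / 2)"
proof -
  have "Ck_on 2 (\<lambda>x. \<Sum>g\<in>F. g x * g x) U \<and>
      lev (\<lambda>x. \<Sum>g\<in>F. g x * g x) p a = (\<Sum>g\<in>F. ((D1 g p a)\<^sup>2 + (D1 g p (\<i> *s a))\<^sup>2) / 2)"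
    using assms(1,3,5)
  proof (induction F rule: finite_induct)
    case empty
    then show ?case by (simp add: Ck_on_const lev_def D2_const)
  next
    case (insert g F)
    have g: "Ck_on 2 (\<lambda>x. g x * g x) U" using insert.prems(1)[of g] by (intro Ck_on_mult assms(2)) auto
    have IH: "Ck_on 2 (\<lambda>x. \<Sum>g\<in>F. g x * g x) U"
      "lev (\<lambda>x. \<Sum>g\<in>F. g x * g x) p a = (\<Sum>g\<in>F. ((D1 g p a)\<^sup>2 + (D1 g p (\<i> *s a))\<^sup>2) / 2)"
      using insert by simp_all
    have "lev (\<lambda>x. g x * g x + (\<Sum>g\<in>F. g x * g x)) p a
        = ((D1 g p a)\<^sup>2 + (D1 g p (\<i> *s a))\<^sup>2) / 2 + (\<Sum>g\<in>F. ((D1 g p a)\<^sup>2 + (D1 g p (\<i> *s a))\<^sup>2) / 2)"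
      unfolding lev_add[OF assms(2) g IH(1) assms(4)] IH(2)
      using lev_square[OF assms(2) insert.prems(1)[of g] assms(4) insert.prems(2)[of g]] by simp
    then show ?case using Ck_on_add[OF assms(2) g IH(1)] insert.hyps by simp
  qed
  then show "Ck_on 2 (\<lambda>x. \<Sum>g\<in>F. g x * g x) U"
    and "lev (\<lambda>x. \<Sum>g\<in>F. g x * g x) p a = (\<Sum>g\<in>F. ((D1 g p a)\<^sup>2 + (D1 g p (\<i> *s a))\<^sup>2) / 2)" by blast+
qed

text \<open>Choose F to minimize the dimension of the common zeros in the Levi kernel. If these
  still contained a frame, some frame vector would fail to be tangent to S, and adding a function
  that detects this would lower the dimension.\<close>

lemma finite_defining_functions:
  fixes J :: "'n::finite set" and p :: "complex^'n"
  assumes no: "\<nexists>e. frame J e \<and> (\<forall>j\<in>J. e $ j \<in> levi_kernel r p \<inter> holo_tangent r M S p)"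
    and diff: "r differentiable (at p)"
  obtains F where "finite F"
    "\<And>g. g \<in> F \<Longrightarrow> \<exists>f. smooth_on_hypersurface M f \<and> (\<forall>x\<in>S. f x = 0) \<and> local_extension M f p g"
    "vec.dim {a \<in> levi_kernel r p. \<forall>g\<in>F. D1 g p a = 0 \<and> D1 g p (\<i> *s a) = 0} < card J"
proof -
  define ok where "ok g \<longleftrightarrow> (\<exists>f. smooth_on_hypersurface M f \<and> (\<forall>x\<in>S. f x = 0) \<and> local_extension M f p g)" for g
  define Z where "Z F = {a \<in> levi_kernel r p. \<forall>g\<in>F. D1 g p a = 0 \<and> D1 g p (\<i> *s a) = 0}" for F
  have subZ: "vec.subspace (Z F)" if "\<forall>g\<in>F. ok g" for F
  proof -
    have "g differentiable (at p)" if g: "g \<in> F" for g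
    proof -
      obtain f where "local_extension M f p g" using \<open>\<forall>g\<in>F. ok g\<close> g ok_def by blast
      then show ?thesis by (rule D1_smooth_extension)
    qed
    then have "\<forall>g\<in>F. vec.subspace {a. D1 g p a = 0 \<and> D1 g p (\<i> *s a) = 0}"
      using subspace_D1_zeros by blast
    with subspace_levi_kernel[of r p] show ?thesis
      unfolding vec.subspace_def Z_def by blast
  qed
  have "\<exists>F. (finite F \<and> (\<forall>g\<in>F. ok g)) \<and>
      (\<forall>F'. finite F' \<and> (\<forall>g\<in>F'. ok g) \<longrightarrow> vec.dim (Z F) \<le> vec.dim (Z F'))"
    by (rule ex_has_least_nat[of "\<lambda>F. finite F \<and> (\<forall>g\<in>F. ok g)" "{}"]) simp
  then obtain F where F: "finite F" "\<forall>g\<in>F. ok g"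
    and least: "\<And>F'. finite F' \<Longrightarrow> \<forall>g\<in>F'. ok g \<Longrightarrow> vec.dim (Z F) \<le> vec.dim (Z F')" by blast
  have "vec.dim (Z F) < card J"
  proof (rule ccontr)
    assume "\<not> ?thesis"
    then obtain e :: "complex^'n^'n" where e: "frame J e" "\<forall>j\<in>J. e $ j \<in> Z F"
      using frame_exists[OF subZ[OF F(2)], of J] by auto
    then obtain j where j: "j \<in> J" "e $ j \<notin> holo_tangent r M S p"
      using no by (auto simp: Z_def)
    have ej: "e $ j \<in> Z F" using e(2) j(1) by blast
    then have "D1 r p (e $ j) = 0" "D1 r p (\<i> *s e $ j) = 0"
      using T10_iff[OF diff] by (auto simp: Z_def levi_kernel_def)
    then obtain f g where fg: "smooth_on_hypersurface M f" "\<forall>x\<in>S. f x = 0" "local_extension M f p g"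
      "\<not> (D1 g p (e $ j) = 0 \<and> D1 g p (\<i> *s e $ j) = 0)"
      using j(2) unfolding holo_tangent_def mem_Collect_eq subset_tangent_space_D1 by blast
    have ok: "\<forall>g\<in>insert g F. ok g" using F(2) fg(1-3) ok_def by blast
    have "Z (insert g F) \<subseteq> Z F" by (auto simp: Z_def)
    moreover have "vec.dim (Z F) \<le> vec.dim (Z (insert g F))" using least[of "insert g F"] F(1) ok by simp
    ultimately have "Z (insert g F) = Z F"
      using vec.subspace_dim_equal[OF subZ[OF ok] subZ[OF F(2)]] by blast
    then show False using ej fg(4) by (auto simp: Z_def)
  qed
  with F show ?thesis using that[of F] unfolding ok_def Z_def by blast
qed

text \<open>Near a point of \<open>S\<close> where the Levi kernel and the holomorphic tangent space of \<open>S\<close> share no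
  \<open>q\<close>-dimensional subspace, \<open>r + l r\<^sup>2 + \<Sum> g\<^sup>2\<close> vanishes on \<open>S\<close> and has a positive Hessian trace on every
  \<open>q\<close>-frame, so its large multiples are admissible.\<close>

lemma admits_lev_transverse_point:
  fixes J :: "'n::finite set" and p :: "complex^'n"
  assumes C: "Ck_on 2 r U" "open U" "p \<in> U" and r0: "\<And>x. x \<in> S \<Longrightarrow> x \<in> U \<Longrightarrow> r x = 0"
    and psd: "\<And>a. a \<in> T10 r p \<Longrightarrow> 0 \<le> Re (levi_form r p a a)"
    and S: "p \<in> S" "S \<subseteq> M"
    and no: "\<nexists>e. frame J e \<and> (\<forall>j\<in>J. e $ j \<in> levi_kernel r p \<inter> holo_tangent r M S p)"
  shows "\<exists>\<delta>>0. \<forall>L>0. admits_lev J (S \<inter> cball p \<delta>) L 1"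
proof -
  have diff: "r differentiable (at p)" using Ck_on_2D(1)[OF C(1,3)] .
  obtain F where F: "finite F"
    "\<And>g. g \<in> F \<Longrightarrow> \<exists>f. smooth_on_hypersurface M f \<and> (\<forall>x\<in>S. f x = 0) \<and> local_extension M f p g"
    "vec.dim {a \<in> levi_kernel r p. \<forall>g\<in>F. D1 g p a = 0 \<and> D1 g p (\<i> *s a) = 0} < card J"
    by (rule finite_defining_functions[OF no diff]) blast
  have "\<exists>V. open V \<and> p \<in> V \<and> Ck_on 2 g V \<and> (\<forall>x\<in>V \<inter> S. g x = 0)" if g: "g \<in> F" for g
  proof -
    obtain f where f: "\<forall>x\<in>S. f x = 0" "local_extension M f p g" using F(2)[OF g] by blast
    obtain V where V: "open V" "p \<in> V" "Ck_on 2 g V" "\<And>x. x \<in> V \<Longrightarrow> x \<in> M \<Longrightarrow> g x = f x"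
      using D1_smooth_extension[OF f(2)] by metis
    have "\<forall>x\<in>V \<inter> S. g x = 0" using V(4) f(1) S(2) by auto
    then show ?thesis using V(1-3) by blast
  qed
  then obtain V where V: "\<And>g. g \<in> F \<Longrightarrow> open (V g)" "\<And>g. g \<in> F \<Longrightarrow> p \<in> V g"
    "\<And>g. g \<in> F \<Longrightarrow> Ck_on 2 g (V g)" "\<And>g x. g \<in> F \<Longrightarrow> x \<in> V g \<Longrightarrow> x \<in> S \<Longrightarrow> g x = 0"
    by (metis IntI)
  define W where "W = U \<inter> (\<Inter>g\<in>F. V g)"
  have W: "open W" "p \<in> W" using C(2,3) V(1,2) F(1) by (auto simp: W_def intro!: open_INT)
  have rW: "Ck_on 2 r W" by (rule Ck_on_subset[OF C(1)]) (simp add: W_def)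
  have gW: "Ck_on 2 g W" if "g \<in> F" for g
    by (rule Ck_on_subset[OF V(3)[OF that]]) (use that in \<open>auto simp: W_def\<close>)
  have g0: "g x = 0" if "g \<in> F" "x \<in> W" "x \<in> S" for g x
    using V(4)[OF that(1) _ that(3)] that(1,2) by (auto simp: W_def)
  have rS: "r x = 0" if "x \<in> W" "x \<in> S" for x using r0 that by (auto simp: W_def)
  define G where "G = (\<lambda>x. \<Sum>g\<in>F. g x * g x)"
  have GW: "Ck_on 2 G W"
    unfolding G_def by (rule sum_squares_Ck_lev(1)[OF F(1) W(1) gW W(2)]) (auto intro: g0 W(2) S(1))
  have levG: "lev G p a = (\<Sum>g\<in>F. ((D1 g p a)\<^sup>2 + (D1 g p (\<i> *s a))\<^sup>2) / 2)" for a
    unfolding G_def by (rule sum_squares_Ck_lev(2)[OF F(1) W(1) gW W(2)]) (auto intro: g0 W(2) S(1))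
  have levG0: "0 \<le> lev G p a" for a unfolding levG by (intro sum_nonneg) auto
  \<comment> \<open>As r vanishes at p, \<open>\<rho>\<close> is half the sum of the squared
    derivatives of r along the frame vectors and their multiples by i. It is zero exactly when all
    frame vectors lie in \<open>T10\<close>.\<close>
  define \<rho> where "\<rho> e = lev_trace J (\<lambda>x. r x * r x) p e" for e :: "complex^'n^'n"
  define T where "T e = lev_trace J r p e + lev_trace J G p e" for e :: "complex^'n^'n"
  have r2W: "Ck_on 2 (\<lambda>x. r x * r x) W" by (intro Ck_on_mult W(1) rW)
  have lev2: "lev (\<lambda>x. r x * r x) p a = ((D1 r p a)\<^sup>2 + (D1 r p (\<i> *s a))\<^sup>2) / 2" for a
    by (rule lev_square[OF W(1) rW W(2) rS[OF W(2) S(1)]])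
  have "continuous_on (frames J) T" "continuous_on (frames J) \<rho>"
    unfolding T_def \<rho>_def using W(2)
    by (auto intro!: continuous_intros continuous_on_lev_trace[OF rW W(1)]
        continuous_on_lev_trace[OF GW W(1)] continuous_on_lev_trace[OF r2W W(1)])
  moreover have "0 \<le> \<rho> e" for e by (auto simp: \<rho>_def lev_trace_def lev2 intro!: sum_nonneg)
  \<comment> \<open>On \<open>T10\<close> all terms are nonnegative, so T e \<le> 0 would force each
    to vanish. The frame would then lie in the space cut out by F, whose dimension is less than
    \<open>card J\<close>.\<close>
  moreover have "0 < T e" if e: "e \<in> frames J" "\<rho> e = 0" for e
  proof (rule ccontr)
    assume "\<not> 0 < T e"
    have "\<forall>j\<in>J. ((D1 r p (e $ j))\<^sup>2 + (D1 r p (\<i> *s e $ j))\<^sup>2) / 2 = 0"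
      using e(2) unfolding \<rho>_def lev_trace_def lev2 by (subst (asm) sum_nonneg_eq_0_iff) auto
    then have T10: "e $ j \<in> T10 r p" if "j \<in> J" for j
      using that by (simp add: T10_iff[OF diff] sum_power2_eq_zero_iff)
    have levr0: "0 \<le> lev r p (e $ j)" if "j \<in> J" for j
      using psd[OF T10[OF that]] levi_form_self[OF C] by simp
    have "(\<Sum>j\<in>J. lev r p (e $ j) + lev G p (e $ j)) \<le> 0"
      using \<open>\<not> 0 < T e\<close> by (simp add: T_def lev_trace_def sum.distrib)
    moreover have "0 \<le> (\<Sum>j\<in>J. lev r p (e $ j) + lev G p (e $ j))"
      using levr0 levG0 by (intro sum_nonneg add_nonneg_nonneg) auto
    ultimately have "(\<Sum>j\<in>J. lev r p (e $ j) + lev G p (e $ j)) = 0" by linarith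
    then have "\<forall>j\<in>J. lev r p (e $ j) + lev G p (e $ j) = 0"
      by (subst (asm) sum_nonneg_eq_0_iff) (use levr0 levG0 in \<open>auto intro!: add_nonneg_nonneg\<close>)
    then have z: "lev r p (e $ j) = 0" "lev G p (e $ j) = 0" if "j \<in> J" for j
      using levr0[OF that] levG0[of "e $ j"] that by (auto simp: add_nonneg_eq_0_iff)
    have "e $ j \<in> {a \<in> levi_kernel r p. \<forall>g\<in>F. D1 g p a = 0 \<and> D1 g p (\<i> *s a) = 0}" if j: "j \<in> J" for j
    proof -
      have "\<forall>g\<in>F. ((D1 g p (e $ j))\<^sup>2 + (D1 g p (\<i> *s e $ j))\<^sup>2) / 2 = 0"
        using z(2)[OF j] unfolding levG by (subst (asm) sum_nonneg_eq_0_iff) (auto simp: F(1))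
      then have "\<forall>g\<in>F. D1 g p (e $ j) = 0 \<and> D1 g p (\<i> *s e $ j) = 0"
        by (simp add: sum_power2_eq_zero_iff)
      moreover have "e $ j \<in> levi_kernel r p"
        using T10[OF j] z(1)[OF j] T10_iff[OF diff] by (intro iffD2[OF levi_kernel_iff[OF C psd]]) auto
      ultimately show ?thesis by simp
    qed
    then have "(\<lambda>j. e $ j) ` J \<subseteq> {a \<in> levi_kernel r p. \<forall>g\<in>F. D1 g p a = 0 \<and> D1 g p (\<i> *s a) = 0}" by blast
    from vec.dim_subset[OF this] have "vec.dim ((\<lambda>j. e $ j) ` J) < card J" using F(3) by simp
    then show False using frame_dim_span[of J e] e(1) by (simp add: frames_def)
  qed
  ultimately obtain l c where l: "0 < l" and c: "0 < c" "\<And>e. e \<in> frames J \<Longrightarrow> c \<le> T e + l * \<rho> e"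
    using positive_penalized_form[OF compact_frames] by metis
  define h where "h = (\<lambda>x. (r x + l * (r x * r x)) + G x)"
  have lr2W: "Ck_on 2 (\<lambda>x. l * (r x * r x)) W" by (rule Ck_on_mult[OF W(1) Ck_on_const r2W])
  have rlW: "Ck_on 2 (\<lambda>x. r x + l * (r x * r x)) W" by (rule Ck_on_add[OF W(1) rW lr2W])
  have hW: "Ck_on 2 h W" unfolding h_def by (rule Ck_on_add[OF W(1) rlW GW])
  have tr_h: "c \<le> lev_trace J h p e" if "e \<in> frames J" for e
    unfolding h_def lev_trace_add[OF W(1) rlW GW W(2)] lev_trace_add[OF W(1) rW lr2W W(2)]
      lev_trace_scale[OF W(1) r2W W(2)]
    using c(2)[OF that] by (simp add: T_def \<rho>_def)
  have h0: "h x = 0" if "x \<in> W" "x \<in> S" for x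
  proof -
    have "G x = 0" unfolding G_def by (rule sum.neutral) (simp add: g0[OF _ that])
    then show ?thesis using rS[OF that] by (simp add: h_def)
  qed
  obtain d where d: "d > 0" "cball p d \<subseteq> W" using W open_contains_cball by blast
  have "compact (cball p d \<times> (frames J :: (complex^'n^'n) set))" by (intro compact_Times compact_frames) auto
  moreover have "continuous_on (cball p d \<times> frames J) (\<lambda>x. lev_trace J h (fst x) (snd x))"
    by (intro continuous_on_lev_trace[OF hW W(1)] continuous_intros) (use d(2) in auto)
  ultimately have "uniformly_continuous_on (cball p d \<times> frames J) (\<lambda>x. lev_trace J h (fst x) (snd x))"
    by (rule compact_uniformly_continuous[rotated])
  \<comment> \<open>Uniformity over frames is what yields a single radius for all of them.\<close>
  then obtain d' where d': "d' > 0" "\<And>x y. x \<in> cball p d \<times> frames J \<Longrightarrow> y \<in> cball p d \<times> frames J \<Longrightarrow>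
      dist y x < d' \<Longrightarrow> dist (lev_trace J h (fst y) (snd y)) (lev_trace J h (fst x) (snd x)) < c / 2"
    unfolding uniformly_continuous_on_def using c(1) by (metis half_gt_zero)
  define \<delta> where "\<delta> = min d d'"
  have \<delta>: "\<delta> > 0" "\<delta> \<le> d" "\<delta> \<le> d'" using d(1) d'(1) by (simp_all add: \<delta>_def)
  have tr: "c / 2 \<le> lev_trace J h z e" if z: "z \<in> ball p \<delta>" and e: "frame J e" for z e
  proof -
    define e' where "e' = frame_trunc J e"
    have e': "e' \<in> frames J" unfolding e'_def by (rule frame_trunc[OF e])
    have "dist (z, e') (p, e') < d'" using z \<delta>(3) by (simp add: dist_Pair_Pair dist_commute)
    then have "dist (lev_trace J h z e') (lev_trace J h p e') < c / 2"
      using d'(2)[of "(p, e')" "(z, e')"] z \<delta>(2) d(1) e' by simp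
    then have "\<bar>lev_trace J h z e - lev_trace J h p e\<bar> < c / 2"
      unfolding e'_def lev_trace_trunc dist_real_def .
    moreover have "c \<le> lev_trace J h p e" using tr_h[OF e'] unfolding e'_def lev_trace_trunc .
    ultimately show ?thesis using abs_ge_minus_self[of "lev_trace J h z e - lev_trace J h p e"] by linarith
  qed
  have "admits_lev J (S \<inter> cball p (\<delta> / 2)) L 1" if L: "L > 0" for L
  proof -
    define k where "k = 2 * L / c"
    have k: "k > 0" "k * (c / 2) = L" using L c(1) by (simp_all add: k_def)
    have bW: "ball p \<delta> \<subseteq> W" using d(2) \<delta>(2) by auto
    \<comment> \<open>As h vanishes on S, k h + 1/2 has values in [0, 1] on this neighborhood of S.
      Only \<open>Y\<close> shrinks as L grows; the radius \<delta> / 2 is independent of L.\<close>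
    define Y where "Y = ball p \<delta> \<inter> (\<lambda>x. k * h x) -` {-1 / 2<..<1 / 2}"
    have "continuous_on (ball p \<delta>) h"
      using Ck_on_subset[OF Ck_on_Suc[OF Ck_on_Suc[OF hW[unfolded numeral_2_eq_2]]] bW] by simp
    then have Y: "open Y"
      unfolding Y_def by (intro continuous_open_preimage continuous_intros) auto
    have YW: "Y \<subseteq> W" using bW by (auto simp: Y_def)
    have hY: "Ck_on 2 h Y" by (rule Ck_on_subset[OF hW YW])
    have khY: "Ck_on 2 (\<lambda>x. k * h x) Y" by (intro Ck_on_mult Ck_on_const Y hY)
    have "S \<inter> cball p (\<delta> / 2) \<subseteq> Y"
      using \<delta>(1) h0 bW by (force simp: Y_def)
    moreover have "Ck_on 2 (\<lambda>x. k * h x + 1 / 2) Y" by (intro Ck_on_add Ck_on_const Y khY)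
    moreover have "(\<lambda>x. k * h x + 1 / 2) ` Y \<subseteq> {0..1}" by (auto simp: Y_def)
    moreover have "L \<le> lev_trace J (\<lambda>x. k * h x + 1 / 2) z e" if z: "z \<in> Y" "frame J e" for z e
    proof -
      have "lev_trace J (\<lambda>x. k * h x + 1 / 2) z e = k * lev_trace J h z e"
        unfolding lev_trace_add[OF Y khY Ck_on_const z(1)] lev_trace_scale[OF Y hY z(1)] lev_trace_zero by simp
      moreover have "k * (c / 2) \<le> k * lev_trace J h z e"
        using k(1) z by (intro mult_left_mono tr) (auto simp: Y_def)
      ultimately show ?thesis using k(2) by simp
    qed
    ultimately show ?thesis
      unfolding admits_lev_def using Y by (intro exI[of _ Y] exI[of _ "\<lambda>x. k * h x + 1 / 2"] conjI) auto
  qed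
  then show ?thesis using \<delta>(1) by (intro exI[of _ "\<delta> / 2"]) simp
qed

section \<open>Limits of tangent and Levi conditions; complexified tangent spaces\<close>

lemma tendsto_D1:
  assumes "Ck_on 2 f U" "open U" "p \<in> U" "(P \<longlongrightarrow> p) G" "(a \<longlongrightarrow> b) G"
  shows "((\<lambda>x. D1 f (P x) (a x)) \<longlongrightarrow> D1 f p b) G"
proof -
  have "continuous_on (U \<times> UNIV) (\<lambda>x. D1 f (fst x) (snd x))"
    by (intro continuous_on_D1[OF assms(1)] continuous_intros) auto
  then have "isCont (\<lambda>x. D1 f (fst x) (snd x)) (p, b)"
    using assms(2,3) by (auto simp: continuous_on_eq_continuous_at open_Times)
  from isCont_tendsto_compose[OF this tendsto_Pair[OF assms(4,5)]] show ?thesis by simp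
qed

lemma tendsto_lev:
  assumes "Ck_on 2 f U" "open U" "p \<in> U" "(P \<longlongrightarrow> p) G" "(a \<longlongrightarrow> b) G"
  shows "((\<lambda>x. lev f (P x) (a x)) \<longlongrightarrow> lev f p b) G"
proof -
  have "continuous_on (U \<times> UNIV) (\<lambda>x. lev f (fst x) (snd x))"
    unfolding lev_def by (intro continuous_intros continuous_on_D2[OF assms(1,2)]) auto
  then have "isCont (\<lambda>x. lev f (fst x) (snd x)) (p, b)"
    using assms(2,3) by (auto simp: continuous_on_eq_continuous_at open_Times)
  from isCont_tendsto_compose[OF this tendsto_Pair[OF assms(4,5)]] show ?thesis by simp
qed

lemma tendsto_vec_scale:
  fixes a :: "'b \<Rightarrow> complex^'n"
  assumes "(a \<longlongrightarrow> b) G"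
  shows "((\<lambda>x. c *s a x) \<longlongrightarrow> c *s b) G"
proof -
  have "continuous_on UNIV (\<lambda>v :: complex^'n. c *s v)" by (intro continuous_intros)
  then have "isCont (\<lambda>v :: complex^'n. c *s v) b" by (simp add: continuous_on_eq_continuous_at)
  from isCont_tendsto_compose[OF this assms] show ?thesis .
qed

text \<open>A local extension at p is also one at all nearby points, so each equation defining the
  tangent space holds along the tail of the sequence and passes to the limit.\<close>

lemma subset_tangent_space_closed:
  assumes C: "Ck_on 2 r U" "open U" "p \<in> U"
    and lim: "P \<longlonglongrightarrow> p" "a \<longlonglongrightarrow> b" "\<And>n. a n \<in> subset_tangent_space r M S (P n)"
  shows "b \<in> subset_tangent_space r M S p"
  unfolding subset_tangent_space_D1
proof (intro conjI allI impI)
  have "(\<lambda>n. D1 r (P n) (a n)) \<longlonglongrightarrow> D1 r p b" by (rule tendsto_D1[OF C lim(1,2)])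
  moreover have "D1 r (P n) (a n) = 0" for n using lim(3) subset_tangent_space_D1 by blast
  ultimately show "D1 r p b = 0" by (simp add: LIMSEQ_const_iff)
next
  fix f g
  assume fg: "smooth_on_hypersurface M f \<and> (\<forall>x\<in>S. f x = 0) \<and> local_extension M f p g"
  then obtain V where V: "open V" "p \<in> V" "smooth_on g V" "\<forall>x\<in>V \<inter> M. g x = f x"
    unfolding local_extension_def by blast
  have "(\<lambda>n. D1 g (P n) (a n)) \<longlonglongrightarrow> D1 g p b"
    by (rule tendsto_D1[OF smooth_on_Ck_on[OF V(3)] V(1,2) lim(1,2)])
  moreover have "eventually (\<lambda>n. D1 g (P n) (a n) = 0) sequentially"
    using topological_tendstoD[OF lim(1) V(1,2)]
  proof (rule eventually_mono)
    fix n assume "P n \<in> V"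
    then have "local_extension M f (P n) g" using V unfolding local_extension_def by blast
    then show "D1 g (P n) (a n) = 0" using lim(3)[of n] fg unfolding subset_tangent_space_D1 by blast
  qed
  then have "(\<lambda>n. D1 g (P n) (a n)) \<longlonglongrightarrow> 0" by (rule tendsto_eventually)
  ultimately show "D1 g p b = 0" using LIMSEQ_unique by blast
qed

lemma of_type10_linear:
  "of_type10 (a + b) = of_type10 a + of_type10 b" "of_type10 (c *s a) = c *s of_type10 a"
  "of_type10 0 = 0"
  by (auto simp: of_type10_def vec_eq_iff split: sum.split)

lemma of_type10_inject: "of_type10 a = of_type10 b \<longleftrightarrow> a = b"
proof
  assume "of_type10 a = of_type10 b"
  then have "of_type10 a $ Inl j = of_type10 b $ Inl j" for j by simp
  then show "a = b" by (simp add: of_type10_def vec_eq_iff)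
qed simp

text \<open>A vector of type (1,0) lies in the complexification of a real subspace \<open>T\<close> iff it lies in
  \<open>T \<inter> \<i>T\<close>: its real and imaginary parts are \<open>a / 2\<close> and \<open>- \<i> a / 2\<close>.\<close>

lemma of_type10_mem_complexified:
  fixes T :: "(complex^'n) set"
  assumes T: "subspace T"
  shows "of_type10 a \<in> vec.span (of_real_tangent ` T) \<longleftrightarrow> a \<in> T \<and> \<i> *s a \<in> T"
proof
  \<comment> \<open>Real and imaginary parts: w is \<open>of_real_tangent (u w)\<close> plus i times
    \<open>of_real_tangent (v w)\<close>. Having both parts in T is a complex-linear condition that
    holds for the generators, hence on their span.\<close>
  define u :: "'n ctangent \<Rightarrow> complex^'n" where
    "u w = (\<chi> j. (w $ Inl j + cnj (w $ Inr j)) / 2)" for w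
  define v :: "'n ctangent \<Rightarrow> complex^'n" where
    "v w = (\<chi> j. - \<i> * (w $ Inl j - cnj (w $ Inr j)) / 2)" for w
  have "vec.subspace {w. u w \<in> T \<and> v w \<in> T}"
    unfolding vec.subspace_def
  proof (intro conjI allI ballI)
    have "u 0 = 0" "v 0 = 0" by (simp_all add: u_def v_def vec_eq_iff)
    then show "0 \<in> {w. u w \<in> T \<and> v w \<in> T}" using subspace_0[OF T] by simp
  next
    fix x y assume xy: "x \<in> {w. u w \<in> T \<and> v w \<in> T}" "y \<in> {w. u w \<in> T \<and> v w \<in> T}"
    have "u (x + y) = u x + u y" "v (x + y) = v x + v y"
      by (simp_all add: u_def v_def vec_eq_iff complex_eq_iff field_simps)
    then show "x + y \<in> {w. u w \<in> T \<and> v w \<in> T}" using xy subspace_add[OF T] by simp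
  next
    fix c x assume x: "x \<in> {w. u w \<in> T \<and> v w \<in> T}"
    have "u (c *s x) = Re c *\<^sub>R u x - Im c *\<^sub>R v x" "v (c *s x) = Re c *\<^sub>R v x + Im c *\<^sub>R u x"
      by (simp_all add: u_def v_def vec_eq_iff complex_eq_iff field_simps)
    then show "c *s x \<in> {w. u w \<in> T \<and> v w \<in> T}"
      using x subspace_add[OF T] subspace_diff[OF T] subspace_scale[OF T] by simp
  qed
  moreover have "of_real_tangent ` T \<subseteq> {w. u w \<in> T \<and> v w \<in> T}"
  proof -
    have "u (of_real_tangent t) = t" "v (of_real_tangent t) = 0" for t
      by (simp_all add: u_def v_def of_real_tangent_def vec_eq_iff)
    then show ?thesis using subspace_0[OF T] by auto
  qed
  ultimately have span: "vec.span (of_real_tangent ` T) \<subseteq> {w. u w \<in> T \<and> v w \<in> T}"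
    by (intro vec.span_minimal)
  assume "of_type10 a \<in> vec.span (of_real_tangent ` T)"
  then have "u (of_type10 a) \<in> T" "v (of_type10 a) \<in> T" using span by auto
  from subspace_scale[OF T this(1), of 2] subspace_scale[OF T this(2), of "-2"]
  have "2 *\<^sub>R u (of_type10 a) \<in> T" "(-2) *\<^sub>R v (of_type10 a) \<in> T" by auto
  moreover have "2 *\<^sub>R u (of_type10 a) = a" "(-2) *\<^sub>R v (of_type10 a) = \<i> *s a"
    by (simp_all add: u_def v_def of_type10_def vec_eq_iff complex_eq_iff)
  ultimately show "a \<in> T \<and> \<i> *s a \<in> T" by simp
next
  assume a: "a \<in> T \<and> \<i> *s a \<in> T"
  have "of_type10 a = (1 / 2) *s of_real_tangent a + (- \<i> / 2) *s of_real_tangent (\<i> *s a)"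
    by (auto simp: of_type10_def of_real_tangent_def vec_eq_iff complex_eq_iff split: sum.split)
  also have "\<dots> \<in> vec.span (of_real_tangent ` T)"
    using a by (intro vec.span_add vec.span_scale vec.span_base) auto
  finally show "of_type10 a \<in> vec.span (of_real_tangent ` T)" .
qed

subsection \<open>The stages of the derivation\<close>

text \<open>The common form of all stages: intersecting with a complexified tangent distribution, or
  over a family of stages, changes only the fibers E.\<close>

definition type10_distribution ::
    "(complex^'n) set \<Rightarrow> (complex^'n \<Rightarrow> (complex^'n) set) \<Rightarrow> ((complex^'n) \<times> 'n ctangent) set" where
  "type10_distribution M E = {(p, of_type10 a) | p a. p \<in> M \<and> a \<in> E p}"

lemma levi_null_type10: "levi_null r M = type10_distribution M (levi_kernel r)"
  unfolding levi_null_def type10_distribution_def levi_kernel_def by blast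

lemma Gr_Int: "Gr q D \<inter> Gr q D' = Gr q (D \<inter> D')"
  unfolding Gr_def by auto

lemma Gr_INT: "I \<noteq> {} \<Longrightarrow> (\<Inter>i\<in>I. Gr q (D i)) = Gr q (\<Inter>i\<in>I. D i)"
  unfolding Gr_def by fast

lemma type10_distributionE:
  assumes "x \<in> type10_distribution M E"
  obtains p a where "x = (p, of_type10 a)"
  using assms unfolding type10_distribution_def by blast

lemma type10_distribution_iff: "(p, of_type10 a) \<in> type10_distribution M E \<longleftrightarrow> p \<in> M \<and> a \<in> E p"
  by (auto simp: type10_distribution_def of_type10_inject)

lemma type10_distribution_INT:
  assumes "I \<noteq> {}"
  shows "(\<Inter>i\<in>I. type10_distribution M (E i)) = type10_distribution M (\<lambda>p. \<Inter>i\<in>I. E i p)"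
proof (rule set_eqI)
  fix x
  have "x \<in> (\<Inter>i\<in>I. type10_distribution M (E i)) \<longleftrightarrow> x \<in> type10_distribution M (\<lambda>p. \<Inter>i\<in>I. E i p)"
    if "x = (p, of_type10 a)" for p a
    unfolding that INT_iff type10_distribution_iff using assms by blast
  moreover obtain i where "i \<in> I" using assms by blast
  ultimately show "x \<in> (\<Inter>i\<in>I. type10_distribution M (E i)) \<longleftrightarrow>
      x \<in> type10_distribution M (\<lambda>p. \<Inter>i\<in>I. E i p)"
    by (metis INT_E type10_distributionE)
qed

lemma type10_distribution_Int_complexified:
  assumes "\<And>p. p \<in> M \<Longrightarrow> r differentiable (at p)"
  shows "type10_distribution M E \<inter> complexified_tangent r M S
    = type10_distribution M (\<lambda>p. E p \<inter> holo_tangent r M S p)"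
proof (rule set_eqI)
  fix x
  have key: "of_type10 a \<in> vec.span (of_real_tangent ` subset_tangent_space r M S p)
      \<longleftrightarrow> a \<in> holo_tangent r M S p" if "p \<in> M" for p a
    unfolding holo_tangent_def mem_Collect_eq
    by (rule of_type10_mem_complexified[OF subspace_subset_tangent_space[OF assms[OF that]]])
  have "x \<in> type10_distribution M E \<inter> complexified_tangent r M S \<longleftrightarrow>
      x \<in> type10_distribution M (\<lambda>p. E p \<inter> holo_tangent r M S p)" if "x = (p, of_type10 a)" for p a
    using key[of p a] unfolding that Int_iff type10_distribution_iff
    by (auto simp: complexified_tangent_def)
  then show "x \<in> type10_distribution M E \<inter> complexified_tangent r M S \<longleftrightarrow>
      x \<in> type10_distribution M (\<lambda>p. E p \<inter> holo_tangent r M S p)"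
    by (metis IntE type10_distributionE)
qed

lemma support_Gr: "support (Gr q D) = {p. \<exists>V. vec.subspace V \<and> vec.dim V = q \<and> V \<subseteq> D `` {p}}"
  unfolding support_def Gr_def by (auto simp: image_iff)

text \<open>\<open>of_type10\<close> is linear and injective, so subspaces of a fiber correspond to
  subspaces of \<open>E p\<close>. Orthonormal frames then represent points of the Grassmannian by
  elements of a compact set of matrices.\<close>

lemma support_Gr_type10:
  fixes E :: "complex^'n \<Rightarrow> (complex^'n) set" and J :: "'n set"
  assumes E: "\<And>p. p \<in> M \<Longrightarrow> vec.subspace (E p)"
  shows "support (Gr (card J) (type10_distribution M E)) =
    {p \<in> M. \<exists>e. frame J e \<and> (\<forall>j\<in>J. e $ j \<in> E p)}"
proof -
  have lin: "Vector_Spaces.linear (*s) (*s) (of_type10 :: complex^'n \<Rightarrow> 'n ctangent)"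
    by unfold_locales (simp_all add: of_type10_linear)
  have inj: "inj (of_type10 :: complex^'n \<Rightarrow> 'n ctangent)"
    by (rule injI) (simp add: of_type10_inject)
  have dim: "vec.dim (of_type10 ` A) = vec.dim A" for A :: "(complex^'n) set"
    by (rule vec.dim_image_eq[OF lin inj_on_subset[OF inj subset_UNIV]])
  have fib: "type10_distribution M E `` {p} = (if p \<in> M then of_type10 ` E p else {})" for p
    by (auto simp: type10_distribution_def)
  have "(\<exists>V. vec.subspace V \<and> vec.dim V = card J \<and> V \<subseteq> type10_distribution M E `` {p}) \<longleftrightarrow>
      p \<in> M \<and> (\<exists>e. frame J e \<and> (\<forall>j\<in>J. e $ j \<in> E p))" for p
  proof
    assume "\<exists>V. vec.subspace V \<and> vec.dim V = card J \<and> V \<subseteq> type10_distribution M E `` {p}"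
    then obtain V where V: "vec.subspace V" "vec.dim V = card J" "V \<subseteq> type10_distribution M E `` {p}" by blast
    have p: "p \<in> M" using vec.subspace_0[OF V(1)] V(3) fib[of p] by (auto split: if_splits)
    define V' where "V' = {a. of_type10 a \<in> V}"
    have V': "V = of_type10 ` V'" using V(3) p unfolding fib V'_def by auto
    have "vec.subspace V'" using V(1) by (simp add: vec.subspace_def V'_def of_type10_linear)
    moreover have "vec.dim V' = card J" using V(2) dim[of V'] V' by simp
    ultimately obtain e :: "complex^'n^'n" where "frame J e" "\<forall>j\<in>J. e $ j \<in> V'"
      using frame_exists[of V' J] by auto
    moreover have "V' \<subseteq> E p" using V(3) p unfolding fib V'_def by (auto simp: of_type10_inject)
    ultimately show "p \<in> M \<and> (\<exists>e. frame J e \<and> (\<forall>j\<in>J. e $ j \<in> E p))" using p by blast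
  next
    assume "p \<in> M \<and> (\<exists>e. frame J e \<and> (\<forall>j\<in>J. e $ j \<in> E p))"
    then obtain e :: "complex^'n^'n" where p: "p \<in> M" and e: "frame J e" "\<forall>j\<in>J. e $ j \<in> E p" by blast
    define A where "A = vec.span ((\<lambda>j. e $ j) ` J)"
    have A: "A \<subseteq> E p" unfolding A_def using e(2) by (intro vec.span_minimal E p) auto
    have "vec.subspace (of_type10 ` A :: 'n ctangent set)"
    proof -
      have A: "vec.subspace A" unfolding A_def by (rule vec.subspace_span)
      show ?thesis
        unfolding vec.subspace_def
      proof (intro conjI allI ballI)
        show "0 \<in> (of_type10 ` A :: 'n ctangent set)"
          using vec.subspace_0[OF A] by (metis imageI of_type10_linear(3))
      next
        fix x y :: "'n ctangent" assume "x \<in> of_type10 ` A" "y \<in> of_type10 ` A"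
        then obtain a b where ab: "x = of_type10 a" "y = of_type10 b" "a \<in> A" "b \<in> A" by blast
        then have "a + b \<in> A" using vec.subspace_add[OF A] by blast
        then show "x + y \<in> of_type10 ` A" unfolding ab(1,2) of_type10_linear(1)[symmetric] by blast
      next
        fix c and x :: "'n ctangent" assume "x \<in> of_type10 ` A"
        then obtain a where a: "x = of_type10 a" "a \<in> A" by blast
        then have "c *s a \<in> A" using vec.subspace_scale[OF A] by blast
        then show "c *s x \<in> of_type10 ` A" unfolding a(1) of_type10_linear(2)[symmetric] by blast
      qed
    qed
    moreover have "vec.dim (of_type10 ` A :: 'n ctangent set) = card J"
      unfolding dim unfolding A_def by (rule frame_dim_span[OF e(1)])
    moreover have "of_type10 ` A \<subseteq> type10_distribution M E `` {p}" using A p by (auto simp: fib)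
    ultimately show "\<exists>V. vec.subspace V \<and> vec.dim V = card J \<and> V \<subseteq> type10_distribution M E `` {p}" by blast
  qed
  then show ?thesis by (simp only: support_Gr)
qed

text \<open>Every stage of the derivation process is the Grassmannian of a closed distribution by complex
  subspaces of \<open>T\<^sup>1\<^sup>,\<^sup>0\<close>, bounded below by the fibers \<open>\<N>\<^sub>p \<inter> \<complex>T\<^sub>pB\<close> of any \<open>B\<close> for which these
  fibers have dimension at least \<open>q\<close>.\<close>

definition closed_type10_stage ::
    "(complex^'n \<Rightarrow> real) \<Rightarrow> (complex^'n) set \<Rightarrow> nat \<Rightarrow> (complex^'n) set \<Rightarrow> 'n grassmann set
      \<Rightarrow> (complex^'n \<Rightarrow> (complex^'n) set) \<Rightarrow> bool" where
  "closed_type10_stage r M q B F E \<longleftrightarrow>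
     F = Gr q (type10_distribution M E) \<and>
     (\<forall>p\<in>M. vec.subspace (E p)) \<and>
     (\<forall>P p a b. (\<forall>n. P n \<in> M) \<and> P \<longlonglongrightarrow> p \<and> a \<longlonglongrightarrow> b \<and> (\<forall>n. a n \<in> E (P n)) \<longrightarrow> b \<in> E p) \<and>
     (\<forall>p\<in>B. levi_kernel r p \<inter> holo_tangent r M B p \<subseteq> E p)"

lemma closed_type10_stageI:
  assumes "F = Gr q (type10_distribution M E)"
    and "\<And>p. p \<in> M \<Longrightarrow> vec.subspace (E p)"
    and "\<And>P p a b. \<forall>n. P n \<in> M \<Longrightarrow> P \<longlonglongrightarrow> p \<Longrightarrow> a \<longlonglongrightarrow> b \<Longrightarrow> \<forall>n. a n \<in> E (P n) \<Longrightarrow> b \<in> E p"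
    and "\<And>p. p \<in> B \<Longrightarrow> levi_kernel r p \<inter> holo_tangent r M B p \<subseteq> E p"
  shows "closed_type10_stage r M q B F E"
  using assms unfolding closed_type10_stage_def by blast

lemma closed_type10_stage_fibers:
  assumes "closed_type10_stage r M q B F E"
  shows "F = Gr q (type10_distribution M E)"
    and "p \<in> M \<Longrightarrow> vec.subspace (E p)"
    and "\<forall>n. P n \<in> M \<Longrightarrow> P \<longlonglongrightarrow> p \<Longrightarrow> a \<longlonglongrightarrow> b \<Longrightarrow> \<forall>n. a n \<in> E (P n) \<Longrightarrow> b \<in> E p"
    and "p \<in> B \<Longrightarrow> levi_kernel r p \<inter> holo_tangent r M B p \<subseteq> E p"
  using assms unfolding closed_type10_stage_def by blast+

text \<open>For closedness, frames over a convergent sequence of points have a convergent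
  subsequence by \<open>compact_frames\<close>, and the limit frame lies in the limit fiber because
  the distribution is closed.\<close>

lemma closed_type10_stageD:
  fixes J :: "'n::finite set" and r :: "complex^'n \<Rightarrow> real"
  assumes st: "closed_type10_stage r M (card J) B F E" and M: "closed M" "B \<subseteq> M"
    and B: "\<And>p. p \<in> B \<Longrightarrow> \<exists>e. frame J e \<and> (\<forall>j\<in>J. e $ j \<in> levi_kernel r p \<inter> holo_tangent r M B p)"
  shows "support F \<subseteq> M" "closed (support F)" "B \<subseteq> support F"
proof -
  note E = closed_type10_stage_fibers[OF st]
  have sup: "support F = {p \<in> M. \<exists>e. frame J e \<and> (\<forall>j\<in>J. e $ j \<in> E p)}"
    unfolding E(1) by (rule support_Gr_type10[OF E(2)])
  show "support F \<subseteq> M" unfolding sup by blast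
  show "B \<subseteq> support F"
  proof
    fix p assume p: "p \<in> B"
    obtain e :: "complex^'n^'n" where "frame J e" "\<forall>j\<in>J. e $ j \<in> levi_kernel r p \<inter> holo_tangent r M B p"
      using B[OF p] by blast
    then show "p \<in> support F" unfolding sup using E(4)[OF p] M(2) p by blast
  qed
  show "closed (support F)"
    unfolding closed_sequential_limits
  proof (intro allI impI)
    fix P p assume P: "(\<forall>n. P n \<in> support F) \<and> P \<longlonglongrightarrow> p"
    then have PM: "P n \<in> M" for n using sup by blast
    have pM: "p \<in> M" using closed_sequentially[OF M(1)] PM P by blast
    have "\<exists>e. e \<in> frames J \<and> (\<forall>j\<in>J. e $ j \<in> E (P n))" for n
    proof -
      obtain e :: "complex^'n^'n" where e: "frame J e" "\<forall>j\<in>J. e $ j \<in> E (P n)" using P sup by blast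
      then show ?thesis
        using frame_trunc[OF e(1)] by (intro exI[of _ "frame_trunc J e"]) (simp add: frame_trunc_nth)
    qed
    then obtain e where e: "\<And>n. e n \<in> frames J" "\<And>n j. j \<in> J \<Longrightarrow> e n $ j \<in> E (P n)" by metis
    obtain l s where l: "l \<in> frames J" "strict_mono s" "(e \<circ> s) \<longlonglongrightarrow> l"
      using compact_frames[of J, unfolded compact_def] e(1) by metis
    have "l $ j \<in> E p" if j: "j \<in> J" for j
    proof (rule E(3))
      show "\<forall>n. (P \<circ> s) n \<in> M" using PM by simp
      show "(P \<circ> s) \<longlonglongrightarrow> p" using LIMSEQ_subseq_LIMSEQ[OF _ l(2)] P by blast
      show "(\<lambda>n. (e \<circ> s) n $ j) \<longlonglongrightarrow> l $ j" by (rule tendsto_vec_nth[OF l(3)])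
      show "\<forall>n. (e \<circ> s) n $ j \<in> E ((P \<circ> s) n)" using e(2)[OF j] by simp
    qed
    then show "p \<in> support F" unfolding sup using pM l(1) by (auto simp: frames_def)
  qed
qed

lemma holo_tangent_mono: "S \<subseteq> S' \<Longrightarrow> holo_tangent r M S p \<subseteq> holo_tangent r M S' p"
  unfolding holo_tangent_def subset_tangent_space_D1 by blast

lemma subspace_holo_tangent:
  fixes r :: "complex^'n \<Rightarrow> real"
  assumes "r differentiable (at p)"
  shows "vec.subspace (holo_tangent r M S p)"
proof -
  define T where "T = subset_tangent_space r M S p"
  have T: "subspace T" unfolding T_def by (rule subspace_subset_tangent_space[OF assms])
  have "c *s x \<in> T \<and> \<i> *s (c *s x) \<in> T" if x: "x \<in> T" "\<i> *s x \<in> T" for c and x :: "complex^'n"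
  proof -
    have 1: "c *s x = Re c *\<^sub>R x + Im c *\<^sub>R (\<i> *s x)" by (rule vec_scale_decompose)
    have 2: "\<i> *s (c *s x) = Re c *\<^sub>R (\<i> *s x) - Im c *\<^sub>R x"
      by (simp add: vec_eq_iff complex_eq_iff)
    show ?thesis
      unfolding 2 unfolding 1 by (intro conjI subspace_add subspace_diff subspace_scale T x)
  qed
  moreover have "x + y \<in> T \<and> \<i> *s (x + y) \<in> T"
    if "x \<in> T" "\<i> *s x \<in> T" "y \<in> T" "\<i> *s y \<in> T" for x y
    unfolding vec.scale_right_distrib by (intro conjI subspace_add[OF T] that)
  moreover have "0 \<in> T \<and> \<i> *s 0 \<in> T" using subspace_0[OF T] by simp
  ultimately show ?thesis unfolding vec.subspace_def holo_tangent_def T_def[symmetric] by blast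
qed

text \<open>Asserted at every index, so it covers whichever index \<open>stable_value\<close>
  selects.\<close>

lemma transfinite_iterate_stage:
  fixes J :: "'n::finite set" and r :: "complex^'n \<Rightarrow> real"
  assumes C: "Ck_on 2 r U" "open U" "M \<subseteq> U" and M: "closed M" "B \<subseteq> M"
    and psd: "\<And>p a. p \<in> M \<Longrightarrow> a \<in> T10 r p \<Longrightarrow> 0 \<le> Re (levi_form r p a a)"
    and B: "\<And>p. p \<in> B \<Longrightarrow> \<exists>e. frame J e \<and> (\<forall>j\<in>J. e $ j \<in> levi_kernel r p \<inter> holo_tangent r M B p)"
  shows "\<exists>E. closed_type10_stage r M (card J) B
    (transfinite_iterate (grassmann_derived r M (card J)) (Gr (card J) (levi_null r M)) \<alpha>) E"
proof -
  let ?F = "transfinite_iterate (grassmann_derived r M (card J)) (Gr (card J) (levi_null r M))"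
  have diff: "r differentiable (at p)" if "p \<in> M" for p using Ck_on_2D(1)[OF C(1)] C(3) that by blast
  show ?thesis
  proof (induction \<alpha> rule: wo_rel.well_order_induct[OF wo_rel_omega1])
    case (1 \<alpha>)
    then have IH: "\<exists>E. closed_type10_stage r M (card J) B (?F \<beta>) E" if "\<beta> \<in> underS omega1 \<alpha>" for \<beta>
      using that unfolding underS_def by blast
    consider "underS omega1 \<alpha> = {}" | \<beta> where "is_pred_ord \<beta> \<alpha>"
      | "underS omega1 \<alpha> \<noteq> {}" "\<nexists>\<beta>. is_pred_ord \<beta> \<alpha>" by blast
    then show ?case
    proof cases
      case 1
      have "b \<in> levi_kernel r p"
        if lim: "\<forall>n. P n \<in> M" "P \<longlonglongrightarrow> p" "a \<longlonglongrightarrow> b" "\<forall>n. a n \<in> levi_kernel r (P n)" for P p a b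
      proof -
        have pM: "p \<in> M" using closed_sequentially[OF M(1)] lim(1,2) by blast
        have pU: "p \<in> U" using pM C(3) by blast
        have iff: "a \<in> levi_kernel r p \<longleftrightarrow> D1 r p a = 0 \<and> D1 r p (\<i> *s a) = 0 \<and> lev r p a = 0"
          if "p \<in> M" for p a using levi_kernel_iff[OF C(1,2)] psd[OF that] C(3) that by blast
        have "(\<lambda>n. D1 r (P n) (a n)) \<longlonglongrightarrow> D1 r p b" "(\<lambda>n. D1 r (P n) (\<i> *s a n)) \<longlonglongrightarrow> D1 r p (\<i> *s b)"
          "(\<lambda>n. lev r (P n) (a n)) \<longlonglongrightarrow> lev r p b"
          by (intro tendsto_D1[OF C(1,2) pU lim(2)] tendsto_lev[OF C(1,2) pU lim(2)] tendsto_vec_scale lim(3))+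
        moreover have "D1 r (P n) (a n) = 0" "D1 r (P n) (\<i> *s a n) = 0" "lev r (P n) (a n) = 0" for n
          using lim(1,4) iff by blast+
        ultimately show ?thesis unfolding iff[OF pM] by (simp add: LIMSEQ_const_iff)
      qed
      then have "closed_type10_stage r M (card J) B (?F \<alpha>) (levi_kernel r)"
        unfolding closed_type10_stage_def transfinite_iterate_zero[OF 1] levi_null_type10
        using subspace_levi_kernel by blast
      then show ?thesis by blast
    next
      case (2 \<beta>)
      then obtain E where st: "closed_type10_stage r M (card J) B (?F \<beta>) E"
        using IH[of \<beta>] unfolding is_pred_ord_def by blast
      define S where "S = support (?F \<beta>)"
      have BS: "B \<subseteq> S" unfolding S_def by (rule closed_type10_stageD(3)[OF st M B])
      define E' where "E' p = E p \<inter> holo_tangent r M S p" for p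
      have eq: "?F \<alpha> = Gr (card J) (type10_distribution M E')"
      proof -
        have "?F \<alpha> = grassmann_derived r M (card J) (?F \<beta>)" by (rule transfinite_iterate_succ[OF 2])
        also have "\<dots> = ?F \<beta> \<inter> Gr (card J) (complexified_tangent r M S)"
          unfolding grassmann_derived_def S_def ..
        also have "?F \<beta> = Gr (card J) (type10_distribution M E)"
          by (rule closed_type10_stage_fibers(1)[OF st])
        finally show ?thesis
          unfolding Gr_Int E'_def using type10_distribution_Int_complexified[OF diff, of M E S] by simp
      qed
      have sub: "vec.subspace (E' p)" if p: "p \<in> M" for p
      proof -
        have "vec.subspace (holo_tangent r M S p)" by (rule subspace_holo_tangent[OF diff[OF p]])
        moreover have "vec.subspace (E p)" by (rule closed_type10_stage_fibers(2)[OF st p])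
        ultimately show ?thesis unfolding E'_def by (intro vec.subspace_inter)
      qed
      have cl: "b \<in> E' p" if lim: "\<forall>n. P n \<in> M" "P \<longlonglongrightarrow> p" "a \<longlonglongrightarrow> b" "\<forall>n. a n \<in> E' (P n)" for P p a b
      proof -
        have pM: "p \<in> M" using closed_sequentially[OF M(1)] lim(1,2) by blast
        then have pU: "p \<in> U" using C(3) by blast
        have "\<forall>n. a n \<in> E (P n)" using lim(4) by (simp add: E'_def)
        then have "b \<in> E p" by (rule closed_type10_stage_fibers(3)[OF st lim(1-3)])
        moreover have "b \<in> holo_tangent r M S p"
          using lim(4) subset_tangent_space_closed[OF C(1,2) pU lim(2,3), of M S]
            subset_tangent_space_closed[OF C(1,2) pU lim(2) tendsto_vec_scale[OF lim(3)], of \<i> M S]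
          unfolding E'_def holo_tangent_def by blast
        ultimately show ?thesis by (simp add: E'_def)
      qed
      \<comment> \<open>The previous stage already has B in its support S, so tangency to B implies
        tangency to S and the new intersection keeps the lower bound.\<close>
      have low: "levi_kernel r p \<inter> holo_tangent r M B p \<subseteq> E' p" if p: "p \<in> B" for p
      proof -
        have "levi_kernel r p \<inter> holo_tangent r M B p \<subseteq> E p"
          by (rule closed_type10_stage_fibers(4)[OF st p])
        then show ?thesis unfolding E'_def using holo_tangent_mono[OF BS, of r M p] by blast
      qed
      have "closed_type10_stage r M (card J) B (?F \<alpha>) E'"
        by (rule closed_type10_stageI[OF eq sub cl low])
      then show ?thesis by blast
    next
      case 3
      obtain E where E: "\<And>\<beta>. \<beta> \<in> underS omega1 \<alpha> \<Longrightarrow> closed_type10_stage r M (card J) B (?F \<beta>) (E \<beta>)"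
        using IH by metis
      have "?F \<alpha> = (\<Inter>\<beta>\<in>underS omega1 \<alpha>. ?F \<beta>)" by (rule transfinite_iterate_limit[OF 3])
      also have "\<dots> = (\<Inter>\<beta>\<in>underS omega1 \<alpha>. Gr (card J) (type10_distribution M (E \<beta>)))"
        by (intro INF_cong refl closed_type10_stage_fibers(1)[OF E])
      also have "\<dots> = Gr (card J) (type10_distribution M (\<lambda>p. \<Inter>\<beta>\<in>underS omega1 \<alpha>. E \<beta> p))"
        unfolding Gr_INT[OF 3(1)] type10_distribution_INT[OF 3(1)] ..
      finally have eq: "?F \<alpha> = Gr (card J) (type10_distribution M (\<lambda>p. \<Inter>\<beta>\<in>underS omega1 \<alpha>. E \<beta> p))" .
      have sub: "vec.subspace (\<Inter>\<beta>\<in>underS omega1 \<alpha>. E \<beta> p)" if "p \<in> M" for p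
      proof -
        have "vec.subspace (E \<beta> p)" if "\<beta> \<in> underS omega1 \<alpha>" for \<beta>
          by (rule closed_type10_stage_fibers(2)[OF E[OF that] \<open>p \<in> M\<close>])
        then show ?thesis by (intro vec.subspace_Inter) auto
      qed
      have cl: "b \<in> (\<Inter>\<beta>\<in>underS omega1 \<alpha>. E \<beta> p)"
        if lim: "\<forall>n. P n \<in> M" "P \<longlonglongrightarrow> p" "a \<longlonglongrightarrow> b" "\<forall>n. a n \<in> (\<Inter>\<beta>\<in>underS omega1 \<alpha>. E \<beta> (P n))" for P p a b
      proof
        fix \<beta> assume b: "\<beta> \<in> underS omega1 \<alpha>"
        have "\<forall>n. a n \<in> E \<beta> (P n)" using lim(4) b by blast
        then show "b \<in> E \<beta> p" by (rule closed_type10_stage_fibers(3)[OF E[OF b] lim(1-3)])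
      qed
      have low: "levi_kernel r p \<inter> holo_tangent r M B p \<subseteq> (\<Inter>\<beta>\<in>underS omega1 \<alpha>. E \<beta> p)" if p: "p \<in> B" for p
      proof (rule INT_greatest)
        fix \<beta> assume b: "\<beta> \<in> underS omega1 \<alpha>"
        show "levi_kernel r p \<inter> holo_tangent r M B p \<subseteq> E \<beta> p"
          by (rule closed_type10_stage_fibers(4)[OF E[OF b] p])
      qed
      have "closed_type10_stage r M (card J) B (?F \<alpha>) (\<lambda>p. \<Inter>\<beta>\<in>underS omega1 \<alpha>. E \<beta> p)"
        by (rule closed_type10_stageI[OF eq sub cl low])
      then show ?thesis by blast
    qed
  qed
qed

section \<open>The bad set and the core\<close>

theorem theorem1p3:
  fixes \<Omega> :: "(complex^'n) set" and r :: "complex^'n \<Rightarrow> real" and q :: nat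
  assumes "open \<Omega>" and "connected \<Omega>" and "\<Omega> \<noteq> {}" and "bounded \<Omega>"
    and "smooth_defining_function r \<Omega>"
    and "levi_pseudoconvex r \<Omega>"
    and "q \<in> {1..CARD('n)}"
  shows "property_P q (support (q_core r (frontier \<Omega>) q (levi_null r (frontier \<Omega>))))
           \<longleftrightarrow> property_P q (frontier \<Omega>)"
proof -
  define M where "M = frontier \<Omega>"
  have M: "compact M" unfolding M_def using assms(4) by (rule compact_frontier_bounded)
  then have clM: "closed M" by (rule compact_imp_closed)
  obtain U where "open U" "M \<subseteq> U" "smooth_on r U" and r0: "M = {z \<in> U. r z = 0}"
    using assms(5) unfolding smooth_defining_function_def M_def by blast
  then have C: "Ck_on 2 r U" "open U" "M \<subseteq> U" using smooth_on_Ck_on by blast+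
  have psd: "0 \<le> Re (levi_form r p a a)" if "p \<in> M" "a \<in> T10 r p" for p a
    using assms(6) that unfolding levi_pseudoconvex_def M_def by blast
  obtain J :: "'n set" where J: "card J = q"
    using assms(7) obtain_subset_with_card_n[of q "UNIV :: 'n set"] by auto
  define S where "S = support (q_core r M q (levi_null r M))"
  have stage: "\<exists>E. closed_type10_stage r M q B (q_core r M q (levi_null r M)) E"
    if "B \<subseteq> M" "\<And>p. p \<in> B \<Longrightarrow> \<exists>e. frame J e \<and> (\<forall>j\<in>J. e $ j \<in> levi_kernel r p \<inter> holo_tangent r M B p)" for B
    unfolding q_core_def stable_value_def J[symmetric]
    by (rule transfinite_iterate_stage[OF C clM that(1) psd that(2)])
  have S: "compact S" "S \<subseteq> M"
  proof -
    \<comment> \<open>For empty B the frame condition is vacuous; this instance gives closedness of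
      the support in both directions of the equivalence.\<close>
    obtain E where E: "closed_type10_stage r M q {} (q_core r M q (levi_null r M)) E"
      using stage[of "{}"] by blast
    have S: "closed S" "S \<subseteq> M" unfolding S_def
      using closed_type10_stageD[of r M J "{}", unfolded J, OF E clM] by auto
    show "S \<subseteq> M" by (rule S(2))
    show "compact S" using M S compact_Int_closed[of M S] by (simp add: Int_absorb1)
  qed
  have "property_P q M" if P: "property_P q S"
  proof -
    define B where "B = {p \<in> M. \<nexists>\<delta>. \<delta> > 0 \<and> (\<forall>L>0. admits_lev J (M \<inter> cball p \<delta>) L 1)}"
    have BM: "B \<subseteq> M" by (auto simp: B_def)
    have notB: "\<exists>\<delta>>0. \<forall>L>0. admits_lev J (M \<inter> cball p \<delta>) L 1" if "p \<in> M - B" for p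
      using that by (auto simp: B_def)
    have frameB: "\<exists>e. frame J e \<and> (\<forall>j\<in>J. e $ j \<in> levi_kernel r p \<inter> holo_tangent r M B p)" if p: "p \<in> B" for p
    proof (rule ccontr)
      assume no: "\<not> ?thesis"
      have pM: "p \<in> M" using p BM by blast
      then have "p \<in> U" using C(3) by blast
      moreover have "r x = 0" if "x \<in> B" for x using that BM r0 by blast
      ultimately obtain \<delta> where \<delta>: "\<delta> > 0" "\<forall>L>0. admits_lev J (B \<inter> cball p \<delta>) L 1"
        using admits_lev_transverse_point[OF C(1,2) _ _ psd[OF pM] p BM no] by blast
      \<comment> \<open>Points of M near p outside B are good by the definition of B, and B itself
        is good near p. Gluing makes p a good point, contradicting \<open>p \<in> B\<close>.\<close>
      have "admits_lev J (M \<inter> cball p \<delta>) L 1" if L: "L > 0" for L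
      proof (rule admits_lev_from_local[of _ J "B \<inter> cball p \<delta>"])
        show "compact (M \<inter> cball p \<delta>)" using M by (intro compact_Int_closed) auto
        show "admits_lev J (B \<inter> cball p \<delta>) L 1" if "0 < L" for L using \<delta>(2) that by blast
        show "\<exists>\<delta>'>0. \<forall>L>0. admits_lev J (M \<inter> cball p \<delta> \<inter> cball x \<delta>') L 1"
          if x: "x \<in> M \<inter> cball p \<delta> - B \<inter> cball p \<delta>" for x
        proof -
          obtain \<delta>' where d: "\<delta>' > 0" "\<forall>L>0. admits_lev J (M \<inter> cball x \<delta>') L 1"
            using notB[of x] x by blast
          have "admits_lev J (M \<inter> cball p \<delta> \<inter> cball x \<delta>') L 1" if "L > 0" for L
            by (rule admits_lev_mono[OF d(2)[rule_format, OF that]]) auto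
          then show ?thesis using d(1) by blast
        qed
      qed (rule L)
      then show False using p \<delta>(1) by (auto simp: B_def)
    qed
    obtain E where E: "closed_type10_stage r M q B (q_core r M q (levi_null r M)) E"
      using stage[OF BM frameB] by blast
    have BS: "B \<subseteq> S" unfolding S_def
      using closed_type10_stageD(3)[of r M J B, unfolded J, OF E clM BM frameB] .
    \<comment> \<open>B inherits the functions of S by inclusion, and all other points of M are
      locally good.\<close>
    have "admits_lev J B L 1" if "L > 0" for L
      using P that unfolding property_P_iff[of J S, unfolded J] by (meson BS admits_lev_mono order_refl)
    then have "admits_lev J M L 1" if "L > 0" for L
      by (rule admits_lev_from_local[OF M _ notB that])
    then show ?thesis unfolding property_P_iff[of J M, unfolded J] using M by blast
  qed
  \<comment> \<open>The converse is monotonicity, S being a compact subset of M.\<close>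
  then show ?thesis
    using property_P_subset[OF _ S] unfolding S_def M_def by blast
qed

end
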